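(* Let $\alpha>-1$. (i) If $-1<\alpha\le0$, then for every $t\in\mathbb R$, $$\left\|e^{-itH_\alpha}\right\|_{\ell^1\to\ell^\infty}=(1+t^2)^{-(1+\alpha)/2}.$$ (ii) If $\alpha\ge0$, then (for every $t\in\mathbb R$) $$\left\|e^{-itH_\alpha}\right\|_{\ell^1\to\ell^\infty}\le(1+t^2)^{-1/2}.$$ (iii) In every case $\alpha>-1$, $$\left\|e^{-itH_\alpha}\right\|_{\ell^1\to\ell^\infty}\asymp_\alpha|t|^{-\min\{1,1+\alpha\}},\qquad|t|\to\infty,$$ i.e. the ratio of the two sides is bounded above and below by positive constants depending only on $\alpha$ for all sufficiently large $|t|$.
   Context: For $\alpha>-1$, the discrete Laguerre operator $H_\alpha$ is the self-adjoint Jacobi operator on $\ell^2(\mathbb N_0)$ (with its maximal domain) associated with the expression $$(H_\alpha u)_n=\sqrt{n(n+\alpha)}\,u_{n-1}+(2n+1+\alpha)u_n+\sqrt{(n+1)(n+1+\alpha)}\,u_{n+1},\quad n\in\mathbb N_0,\quad u_{-1}=0.$$ $e^{-itH_\alpha}$ is the associated unitary group, with matrix kernel $e^{-itH_\alpha}(n,m)=\langle\delta_n,e^{-itH_\alpha}\delta_m\rangle$, and $\|\cdot\|_{\ell^1\to\ell^\infty}$ is the operator norm from $\ell^1(\mathbb N_0)$ to $\ell^\infty(\mathbb N_0)$; it equals $\sup_{n,m\in\mathbb N_0}|e^{-itH_\alpha}(n,m)|$. *)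

theory Defs
  imports "HOL-Analysis.Analysis"
begin

definition ell2 :: "(nat \<Rightarrow> complex) set" where
  "ell2 = {u. summable (\<lambda>n. (cmod (u n))\<^sup>2)}"

definition ell2_norm :: "(nat \<Rightarrow> complex) \<Rightarrow> real" where
  "ell2_norm u = sqrt (\<Sum>n. (cmod (u n))\<^sup>2)"

definition ell2_inner :: "(nat \<Rightarrow> complex) \<Rightarrow> (nat \<Rightarrow> complex) \<Rightarrow> complex" where
  "ell2_inner u v = (\<Sum>n. cnj (u n) * v n)"

text \<open>Operators on the sequence space are functions on sequences, meaningful on \<open>ell2\<close> only.\<close>

definition unitary_ell2 :: "((nat \<Rightarrow> complex) \<Rightarrow> (nat \<Rightarrow> complex)) \<Rightarrow> bool" where
  "unitary_ell2 V \<longleftrightarrow>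
     bij_betw V ell2 ell2 \<and>
     (\<forall>u\<in>ell2. \<forall>v\<in>ell2. \<forall>c. V (\<lambda>n. u n + c * v n) = (\<lambda>n. V u n + c * V v n)) \<and>
     (\<forall>u\<in>ell2. \<forall>v\<in>ell2. ell2_inner (V u) (V v) = ell2_inner u v)"

definition unitary_group_ell2 :: "(real \<Rightarrow> (nat \<Rightarrow> complex) \<Rightarrow> (nat \<Rightarrow> complex)) \<Rightarrow> bool" where
  "unitary_group_ell2 U \<longleftrightarrow>
     (\<forall>t. unitary_ell2 (U t)) \<and>
     (\<forall>u\<in>ell2. U 0 u = u) \<and>
     (\<forall>s t. \<forall>u\<in>ell2. U (s + t) u = U s (U t u)) \<and>
     (\<forall>u\<in>ell2. \<forall>t. ((\<lambda>s. ell2_norm (\<lambda>n. U s u n - U t u n)) \<longlongrightarrow> 0) (at t))"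

text \<open>
  The operator \<open>A\<close> with domain \<open>D\<close> is exactly \<open>\<i>\<close> times the infinitesimal generator of \<open>U\<close>:
  \<open>u\<close> belongs to \<open>D\<close> and \<open>A u = v\<close> if and only if the difference quotients
  \<open>(U t u - u) / t\<close> converge to \<open>- \<i> v\<close> in the norm of \<open>ell2\<close> as \<open>t\<close> tends to 0.
\<close>
definition generates_ell2 ::
  "(nat \<Rightarrow> complex) set \<Rightarrow> ((nat \<Rightarrow> complex) \<Rightarrow> (nat \<Rightarrow> complex)) \<Rightarrow>
   (real \<Rightarrow> (nat \<Rightarrow> complex) \<Rightarrow> (nat \<Rightarrow> complex)) \<Rightarrow> bool" where
  "generates_ell2 D A U \<longleftrightarrow>
     (\<forall>u\<in>ell2. \<forall>v\<in>ell2.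
        (u \<in> D \<and> A u = v) \<longleftrightarrow>
        ((\<lambda>t. ell2_norm (\<lambda>n. (U t u n - u n) / of_real t - (- \<i> * v n))) \<longlongrightarrow> 0) (at 0))"

text \<open>
  The group \<open>t \<mapsto> exp (- \<i> t A)\<close> of a self-adjoint operator \<open>A\<close> with domain \<open>D\<close>, by Stone's
  theorem the unique strongly continuous unitary group with this generator. Extensionality pins
  down the irrelevant values outside \<open>ell2\<close>, so that the description is indeed definite.
\<close>
definition exp_group_ell2 ::
  "(nat \<Rightarrow> complex) set \<Rightarrow> ((nat \<Rightarrow> complex) \<Rightarrow> (nat \<Rightarrow> complex)) \<Rightarrow>
   real \<Rightarrow> (nat \<Rightarrow> complex) \<Rightarrow> (nat \<Rightarrow> complex)" where
  "exp_group_ell2 D A =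
     (THE U. unitary_group_ell2 U \<and> generates_ell2 D A U \<and> (\<forall>t. U t \<in> extensional ell2))"

definition laguerre_op :: "real \<Rightarrow> (nat \<Rightarrow> complex) \<Rightarrow> (nat \<Rightarrow> complex)" where
  "laguerre_op \<alpha> u = (\<lambda>n.
     of_real (sqrt (real n * (real n + \<alpha>))) * (if n = 0 then 0 else u (n - 1)) +
     of_real (2 * real n + 1 + \<alpha>) * u n +
     of_real (sqrt ((real n + 1) * (real n + 1 + \<alpha>))) * u (n + 1))"

text \<open>The maximal domain.\<close>
definition laguerre_dom :: "real \<Rightarrow> (nat \<Rightarrow> complex) set" where
  "laguerre_dom \<alpha> = {u \<in> ell2. laguerre_op \<alpha> u \<in> ell2}"

definition laguerre_group :: "real \<Rightarrow> real \<Rightarrow> (nat \<Rightarrow> complex) \<Rightarrow> (nat \<Rightarrow> complex)" where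
  "laguerre_group \<alpha> = exp_group_ell2 (laguerre_dom \<alpha>) (laguerre_op \<alpha>)"

definition ell1 :: "(nat \<Rightarrow> complex) set" where
  "ell1 = {u. summable (\<lambda>n. cmod (u n))}"

definition ell1_norm :: "(nat \<Rightarrow> complex) \<Rightarrow> real" where
  "ell1_norm u = (\<Sum>n. cmod (u n))"

definition ellinf_norm :: "(nat \<Rightarrow> complex) \<Rightarrow> ennreal" where
  "ellinf_norm u = (SUP n. ennreal (cmod (u n)))"

text \<open>
  The operator norm from \<open>ell1\<close> to bounded sequences of (the restriction to \<open>ell1 \<subseteq> ell2\<close> of) \<open>V\<close>,
  valued in \<open>ennreal\<close> so that the supremum is meaningful even when \<open>V\<close> is unbounded.
\<close>
definition opnorm_1_inf :: "((nat \<Rightarrow> complex) \<Rightarrow> (nat \<Rightarrow> complex)) \<Rightarrow> ennreal" where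
  "opnorm_1_inf V = (SUP u \<in> {u \<in> ell1. ell1_norm u \<le> 1}. ellinf_norm (V u))"

end

theory Submission
  imports Defs
begin

text \<open>
  With \<open>\<kappa> = 1 + \<alpha>\<close> and \<open>c\<^sub>n = sqrt (\<kappa> (\<kappa> + 1) \<dots> (\<kappa> + n - 1) / n!)\<close>, the map \<open>\<delta>\<^sub>n \<mapsto> c\<^sub>n z ^ n\<close> turns the operator into
  \<open>(1 + z)\<^sup>2 d/dz + \<kappa> (1 + z)\<close>, which generates a group of weighted composition operators by parabolic
  Moebius maps (translations \<open>w \<mapsto> w + \<i> t\<close> in the variable \<open>w = 1 / (1 + z)\<close>). This gives the kernel explicitly
  and the group law; self-adjointness on the maximal domain follows from Carleman's condition.

  Let \<open>\<sigma> = (1 + t\<^sup>2) powr (- 1/2)\<close>. The modulus of the kernel is \<open>\<sigma> powr \<kappa>\<close> times a coefficient \<open>V\<close>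
  of an \<open>su(1,1)\<close> representation, and \<open>\<sigma> powr \<alpha> * V\<close> is also a coefficient of a formal representation of \<open>su(2)\<close>
  whose spin need not be half-integral. The weight spaces of a tensor product carry a symmetric operator preserving the flag of
  multiples of \<open>(z - z')\<^sup>k\<close>; its eigenvalues are kernels of the summands, so products of kernels are bounded by
  the kernels of the summands. In the \<open>su(2)\<close> picture this bounds \<open>g \<alpha> (n, m)\<^sup>2\<close> by some
  \<open>g (2 \<alpha>) (l, l)\<close>, where \<open>g \<le> 1 / \<sigma>\<close> by unitarity; iteration gives \<open>g \<le> 1\<close>, which is (ii). In the \<open>su(1,1)\<close>
  picture with parameters \<open>\<kappa>\<close> and \<open>1 - \<kappa>\<close> it reduces (i) to (ii). The lower bound in (iii) is attained in the
  first column at rows of size \<open>t\<^sup>2\<close>.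
\<close>


section \<open>Symmetric operators preserving a flag\<close>

text \<open>The bound in (ii) has constant exactly 1, uniformly in t and both indices, so
  asymptotics of the kernel would not suffice. The su(2) picture is needed because of what doubles:
  in su(1,1) the parameters \<kappa> add up, sending 1 + \<alpha> to 2 + 2\<alpha>, and the
  comparison loses powers of \<sigma>; in su(2) the quantity that doubles is \<alpha> itself and the
  determinant is -1, so nothing is lost. The price is a spin that is not half-integral. The full
  representation is then not unitary, and positivity is required only on the finite weight spaces
  where it is used.

  The norm estimates concern a definite description. Before they say anything about it, the explicit
  kernel has to be shown to define a unitary group whose generator is exactly the maximal operator,
  and this group has to be the only one. Basis vectors are handled by explicit limits at t = 0, and
  general elements of the domain by duality with basis vectors.\<close>

definition weighted_ip :: "(nat \<Rightarrow> real) \<Rightarrow> nat \<Rightarrow> real poly \<Rightarrow> real poly \<Rightarrow> real" where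
  "weighted_ip \<theta> m p q = (\<Sum>j\<le>m. \<theta> j * (coeff p j * coeff q j))"

lemma weighted_ip_linear:
  "weighted_ip \<theta> m (p + q) r = weighted_ip \<theta> m p r + weighted_ip \<theta> m q r"
  "weighted_ip \<theta> m r (p + q) = weighted_ip \<theta> m r p + weighted_ip \<theta> m r q"
  "weighted_ip \<theta> m (p - q) r = weighted_ip \<theta> m p r - weighted_ip \<theta> m q r"
  "weighted_ip \<theta> m r (p - q) = weighted_ip \<theta> m r p - weighted_ip \<theta> m r q"
  "weighted_ip \<theta> m (smult c p) r = c * weighted_ip \<theta> m p r"
  "weighted_ip \<theta> m r (smult c p) = c * weighted_ip \<theta> m r p"
  unfolding weighted_ip_def
  by (simp_all add: sum.distrib[symmetric] sum_subtractf[symmetric] sum_distrib_left algebra_simps)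

lemma weighted_ip_commute: "weighted_ip \<theta> m p q = weighted_ip \<theta> m q p"
  unfolding weighted_ip_def by (simp add: mult_ac)

lemma weighted_ip_nonneg:
  assumes "\<And>j. j \<le> m \<Longrightarrow> \<theta> j > 0"
  shows "weighted_ip \<theta> m p p \<ge> 0"
  unfolding weighted_ip_def using assms by (intro sum_nonneg) (simp add: less_imp_le)

lemma weighted_ip_null:
  assumes "\<And>j. j \<le> m \<Longrightarrow> \<theta> j > 0" and "weighted_ip \<theta> m p p = 0"
  shows "weighted_ip \<theta> m q p = 0"
proof -
  have "\<forall>j\<in>{..m}. \<theta> j * (coeff p j * coeff p j) = 0"
    using assms(2) unfolding weighted_ip_def
    by (subst (asm) sum_nonneg_eq_0_iff) (use assms(1) in \<open>auto simp: less_imp_le\<close>)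
  then have "\<forall>j\<in>{..m}. coeff p j = 0"
    using assms(1) by (metis atMost_iff less_irrefl mult_eq_0_iff)
  then show ?thesis unfolding weighted_ip_def by simp
qed

text \<open>The filtration of a weight space by order of vanishing on the diagonal. Its successive
  quotients are one-dimensional, so a triangular operator has one scalar per step.\<close>

definition flag :: "nat \<Rightarrow> nat \<Rightarrow> real poly set" where
  "flag m k = {p. degree p \<le> m \<and> [:-1, 1:] ^ k dvd p}"

lemma flag_closed:
  assumes "p \<in> flag m k" "q \<in> flag m k"
  shows "p + q \<in> flag m k" "p - q \<in> flag m k" "smult c p \<in> flag m k"
  using assms degree_smult_le[of c p] order_trans
  by (auto simp: flag_def intro: degree_add_le degree_diff_le dvd_smult)

lemma flag_Suc: "p \<in> flag m (Suc k) \<Longrightarrow> p \<in> flag m k"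
  unfolding flag_def using power_le_dvd[of "[:-1, 1:]" "Suc k" p k] by auto

lemma flag_top: "flag m (Suc m) = {0}"
proof -
  have "p = 0" if "degree p \<le> m" "[:-1, 1:] ^ Suc m dvd p" for p :: "real poly"
  proof (rule ccontr)
    assume "p \<noteq> 0"
    have "degree ([:-1, 1::real:] ^ Suc m) = Suc m"
      by (subst degree_power_eq) simp_all
    then show False
      using dvd_imp_degree_le[OF that(2) \<open>p \<noteq> 0\<close>] that(1) by simp
  qed
  then show ?thesis by (auto simp: flag_def)
qed

lemma flag_quotient:
  assumes "k \<le> m" "p \<in> flag m k"
  obtains c where "p - smult c ([:-1, 1:] ^ k) \<in> flag m (Suc k)"
proof -
  obtain h where h: "p = [:-1, 1:] ^ k * h" using assms(2) by (auto simp: flag_def)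
  have "[:-1, 1:] dvd h - [:poly h 1:]"
    using poly_eq_0_iff_dvd[of "h - [:poly h 1:]" 1] by simp
  then have "[:-1, 1:] ^ k * [:-1, 1:] dvd [:-1, 1:] ^ k * (h - [:poly h 1:])"
    by (rule mult_dvd_mono[OF dvd_refl])
  also have "[:-1, 1:] ^ k * (h - [:poly h 1:]) = p - smult (poly h 1) ([:-1, 1:] ^ k)"
    unfolding h by (simp add: right_diff_distrib)
  finally have "[:-1, 1:] ^ Suc k dvd p - smult (poly h 1) ([:-1, 1:] ^ k)"
    by (simp only: power_Suc2)
  moreover have "degree (p - smult (poly h 1) ([:-1, 1:] ^ k)) \<le> m"
    using assms by (intro degree_diff_le) (auto simp: flag_def degree_power_eq degree_smult_eq)
  ultimately show ?thesis by (intro that[of "poly h 1"]) (simp add: flag_def)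
qed

text \<open>A symmetric operator leaving each member of a flag invariant also preserves the
  orthogonal complement of each member inside the previous one. With one-dimensional quotients these
  complements are eigenlines, and the eigenvalues \<open>e k\<close> can be read off modulo the next
  member.\<close>

lemma flag_bound:
  fixes B :: "real poly \<Rightarrow> real poly"
  assumes \<theta>: "\<And>j. j \<le> m \<Longrightarrow> \<theta> j > 0"
    and add: "\<And>p q. B (p + q) = B p + B q"
    and scale: "\<And>c p. B (smult c p) = smult c (B p)"
    and sym: "\<And>p q. degree p \<le> m \<Longrightarrow> degree q \<le> m \<Longrightarrow>
                weighted_ip \<theta> m (B p) q = weighted_ip \<theta> m p (B q)"
    and tri: "\<And>k p. k \<le> m \<Longrightarrow> p \<in> flag m k \<Longrightarrow> B p - smult (e k) p \<in> flag m (Suc k)"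
    and e: "\<And>k. k \<le> m \<Longrightarrow> e k \<le> R"
    and p: "degree p \<le> m"
  shows "weighted_ip \<theta> m p (B p) \<le> R * weighted_ip \<theta> m p p"
proof -
  let ?ip = "weighted_ip \<theta> m"
  \<comment> \<open>Downward induction from the zero space. The second conjunct, existence of
    orthogonal projections onto the flag members, is carried along because it produces the next
    eigenvector.\<close>
  have claim: "(\<forall>p\<in>flag m k. ?ip p (B p) \<le> R * ?ip p p) \<and>
        (\<forall>p. \<exists>s\<in>flag m k. \<forall>y\<in>flag m k. ?ip (p - s) y = 0)" if "k \<le> Suc m" for k
    using that
  proof (induction k rule: inc_induct)
    case base
    have "B 0 = 0" using scale[of 0 0] by simp
    then show ?case by (simp add: flag_top weighted_ip_def)
  next
    case (step k)
    then have k: "k \<le> m" by simp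
    define b :: "real poly" where "b = [:-1, 1:] ^ k"
    have b: "b \<in> flag m k" using k by (simp add: flag_def b_def degree_power_eq)
    obtain s where s: "s \<in> flag m (Suc k)" "\<And>y. y \<in> flag m (Suc k) \<Longrightarrow> ?ip (b - s) y = 0"
      using step.IH by blast
    \<comment> \<open>One Gram-Schmidt step: \<open>w\<close> is the part of the k-th power
      orthogonal to the next flag member.\<close>
    define w where "w = b - s"
    have w: "w \<in> flag m k" unfolding w_def by (rule flag_closed(2)[OF b flag_Suc[OF s(1)]])
    have wort: "?ip w y = 0" if "y \<in> flag m (Suc k)" for y
      using s(2)[OF that] by (simp add: w_def)
    have split: "\<exists>c y. y \<in> flag m (Suc k) \<and> x = smult c w + y" if x: "x \<in> flag m k" for x
    proof -
      obtain c where c: "x - smult c b \<in> flag m (Suc k)"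
        using flag_quotient[OF k x] by (auto simp: b_def)
      have "x = smult c w + ((x - smult c b) + smult c s)"
        by (simp add: w_def smult_diff_right)
      moreover have "(x - smult c b) + smult c s \<in> flag m (Suc k)"
        by (rule flag_closed(1)[OF c flag_closed(3)[OF s(1) s(1)]])
      ultimately show ?thesis by blast
    qed
    have B_inv: "B y \<in> flag m j" if "y \<in> flag m j" "j \<le> m" for y j
    proof -
      have "B y = (B y - smult (e j) y) + smult (e j) y" by simp
      also have "\<dots> \<in> flag m j"
        by (rule flag_closed(1)[OF flag_Suc[OF tri[OF that(2,1)]] flag_closed(3)[OF that(1) that(1)]])
      finally show ?thesis .
    qed
    have B_inv': "B y \<in> flag m (Suc k)" if "y \<in> flag m (Suc k)" for y
    proof (cases "k = m")
      case True
      then show ?thesis using that scale[of 0 0] by (simp add: flag_top)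
    next
      case False
      with k that show ?thesis by (intro B_inv) auto
    qed
    have deg: "degree x \<le> m" if "x \<in> flag m j" for x j using that by (simp add: flag_def)
    have "?ip x (B x) \<le> R * ?ip x x" if x: "x \<in> flag m k" for x
    proof -
      obtain c y where y: "y \<in> flag m (Suc k)" "x = smult c w + y" using split[OF x] by blast
      have "?ip w (B w) = ?ip w ((B w - smult (e k) w) + smult (e k) w)" by simp
      also have "\<dots> = e k * ?ip w w"
        unfolding weighted_ip_linear(2) weighted_ip_linear(6) using wort[OF tri[OF k w]] by simp
      finally have 1: "?ip w (B w) = e k * ?ip w w" .
      have 2: "?ip w (B y) = 0" by (intro wort B_inv' y)
      have 3: "?ip y (B w) = 0"
        using sym[OF deg[OF y(1)] deg[OF w]] 2 by (simp add: weighted_ip_commute)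
      have 4: "?ip w y = 0" "?ip y w = 0" using wort[OF y(1)] by (simp_all add: weighted_ip_commute)
      have "?ip x (B x) = c\<^sup>2 * (e k * ?ip w w) + ?ip y (B y)"
        by (simp add: y(2) add scale weighted_ip_linear 1 2 3 power2_eq_square)
      also have "\<dots> \<le> c\<^sup>2 * (R * ?ip w w) + R * ?ip y y"
        using step.IH y(1) e[OF k] weighted_ip_nonneg[of m \<theta> w] \<theta>
        by (intro add_mono mult_left_mono mult_right_mono) auto
      also have "\<dots> = R * ?ip x x"
        by (simp add: y(2) weighted_ip_linear 4 power2_eq_square algebra_simps)
      finally show ?thesis .
    qed
    moreover have "\<exists>s\<in>flag m k. \<forall>y\<in>flag m k. ?ip (x - s) y = 0" for x
    proof -
      obtain u where u: "u \<in> flag m (Suc k)" "\<And>y. y \<in> flag m (Suc k) \<Longrightarrow> ?ip (x - u) y = 0"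
        using step.IH by blast
      \<comment> \<open>The Fourier coefficient along \<open>w\<close>. If \<open>?ip w w\<close>
        were 0, division would give \<open>c = 0\<close>, which still fits because
        \<open>?ip x w\<close> would vanish too.\<close>
      define c where "c = ?ip x w / ?ip w w"
      have uw: "?ip u w = 0" using wort[OF u(1)] by (simp add: weighted_ip_commute)
      have cw: "c * ?ip w w = ?ip x w"
        using weighted_ip_null[of m \<theta> w x] \<theta> by (cases "?ip w w = 0") (auto simp: c_def)
      have "?ip (x - (u + smult c w)) y = 0" if y: "y \<in> flag m k" for y
      proof -
        obtain d z where z: "z \<in> flag m (Suc k)" "y = smult d w + z" using split[OF y] by blast
        have "?ip x z - ?ip u z = 0" using u(2)[OF z(1)] by (simp add: weighted_ip_linear)
        then show ?thesis
          using wort[OF z(1)] uw cw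
          by (simp add: z(2) weighted_ip_linear algebra_simps)
      qed
      moreover have "u + smult c w \<in> flag m k"
        by (rule flag_closed(1)[OF flag_Suc[OF u(1)] flag_closed(3)[OF w w]])
      ultimately show ?thesis by blast
    qed
    ultimately show ?case by blast
  qed
  have "p \<in> flag m 0" using p by (simp add: flag_def)
  with claim[of 0] show ?thesis by simp
qed

section \<open>Moebius kernels and their tensor products\<close>

text \<open>The formal series of \<open>1 + x X\<close> raised to the real power \<open>e\<close>;
  exponents add with no question of convergence.\<close>

definition binom_fps :: "real \<Rightarrow> real \<Rightarrow> real fps" where
  "binom_fps e x = Abs_fps (\<lambda>n. (e gchoose n) * x ^ n)"

lemma binom_fps_add: "binom_fps (e + f) x = binom_fps e x * binom_fps f x"
proof (rule fps_ext)
  fix n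
  have "(\<Sum>i=0..n. (e gchoose i) * x ^ i * ((f gchoose (n - i)) * x ^ (n - i))) =
        (\<Sum>i=0..n. (e gchoose i) * (f gchoose (n - i))) * x ^ n"
    unfolding sum_distrib_right
    by (intro sum.cong refl) (simp add: mult_ac flip: power_add)
  then show "fps_nth (binom_fps (e + f) x) n = fps_nth (binom_fps e x * binom_fps f x) n"
    by (simp add: binom_fps_def fps_mult_nth gbinomial_Vandermonde)
qed

lemma binom_fps_0: "binom_fps 0 x = 1"
  by (rule fps_ext) (simp add: binom_fps_def gbinomial_0_left)

lemma binom_fps_1: "binom_fps 1 x = 1 + fps_const x * fps_X"
proof (rule fps_ext)
  fix n
  have "(1::real) gchoose n = (if n \<le> 1 then 1 else 0)"
    using binomial_gbinomial[of 1 n, where 'a = real] by (cases n) (auto simp: binomial_eq_0)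
  then show "fps_nth (binom_fps 1 x) n = fps_nth (1 + fps_const x * fps_X) n"
    by (cases n) (auto simp: binom_fps_def fps_X_def)
qed

text \<open>\<open>mob a b c d \<kappa> i j\<close> is the coefficient of \<open>z ^ i\<close> in \<open>(a + b z) powr (- \<kappa> - j) * (c + d z) ^ j\<close>.\<close>

definition mob_fps :: "real \<Rightarrow> real \<Rightarrow> real \<Rightarrow> real \<Rightarrow> real \<Rightarrow> nat \<Rightarrow> real fps" where
  "mob_fps a b c d \<kappa> j =
     fps_const (a powr (- \<kappa> - real j)) * binom_fps (- \<kappa> - real j) (b / a) * (fps_const c + fps_const d * fps_X) ^ j"

definition mob :: "real \<Rightarrow> real \<Rightarrow> real \<Rightarrow> real \<Rightarrow> real \<Rightarrow> nat \<Rightarrow> nat \<Rightarrow> real" where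
  "mob a b c d \<kappa> i j = fps_nth (mob_fps a b c d \<kappa> j) i"

lemma fps_nth_linear_mult:
  "fps_nth ((fps_const c + fps_const d * fps_X) * f) n =
     c * fps_nth f n + d * (if n = 0 then 0 else fps_nth f (n - 1))" for c d :: real
  by (simp add: distrib_right mult.assoc)

text \<open>Contiguity: passing from \<kappa> + 1 to \<kappa> multiplies the generating series by
  the denominator \<open>a + b z\<close>. Together with its counterpart for the numerator this
  drives \<open>mob_tensor_factor\<close>.\<close>

lemma mob_denominator:
  assumes "a > 0"
  shows "mob a b c d \<kappa> i j =
    a * mob a b c d (\<kappa> + 1) i j + b * (if i = 0 then 0 else mob a b c d (\<kappa> + 1) (i - 1) j)"
proof -
  let ?e = "- (\<kappa> + 1) - real j"
  have 1: "- \<kappa> - real j = 1 + ?e" by simp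
  have 2: "a powr (1 + ?e) = a * a powr ?e" using assms by (simp only: powr_add powr_one)
  have 3: "fps_const a * (1 + fps_const (b / a) * fps_X) = fps_const a + fps_const b * fps_X"
    using assms by (simp add: distrib_left flip: mult.assoc)
  have "mob_fps a b c d \<kappa> j = (fps_const a * (1 + fps_const (b / a) * fps_X)) * mob_fps a b c d (\<kappa> + 1) j"
    unfolding mob_fps_def 1 binom_fps_add 2 binom_fps_1 by (simp add: mult_ac flip: fps_const_mult)
  then show ?thesis unfolding mob_def 3 by (simp only: fps_nth_linear_mult)
qed

lemma mob_numerator:
  "mob a b c d \<kappa> i (Suc j) =
    c * mob a b c d (\<kappa> + 1) i j + d * (if i = 0 then 0 else mob a b c d (\<kappa> + 1) (i - 1) j)"
proof -
  have 1: "- \<kappa> - real (Suc j) = - (\<kappa> + 1) - real j" by simp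
  have "mob_fps a b c d \<kappa> (Suc j) = (fps_const c + fps_const d * fps_X) * mob_fps a b c d (\<kappa> + 1) j"
    unfolding mob_fps_def 1 by (simp add: mult_ac)
  then show ?thesis unfolding mob_def by (simp only: fps_nth_linear_mult)
qed

text \<open>The generating series for (\<kappa>, j) and (\<mu>, m - j) multiply to the one for
  (\<kappa> + \<mu>, m), whatever the splitting. In tensor language, restriction to the diagonal
  intertwines the product with the representation of parameter \<kappa> + \<mu>.\<close>

lemma mob_convolution:
  assumes "a > 0" "j \<le> m"
  shows "(\<Sum>i\<le>n. mob a b c d \<kappa> i j * mob a b c d \<mu> (n - i) (m - j)) = mob a b c d (\<kappa> + \<mu>) n m"
proof -
  have 1: "- (\<kappa> + \<mu>) - real m = (- \<kappa> - real j) + (- \<mu> - real (m - j))"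
    using assms by (simp add: of_nat_diff)
  have 2: "X ^ m = X ^ j * X ^ (m - j)" for X :: "real fps" using assms by (simp flip: power_add)
  have "mob_fps a b c d (\<kappa> + \<mu>) m = mob_fps a b c d \<kappa> j * mob_fps a b c d \<mu> (m - j)"
    unfolding mob_fps_def 1 binom_fps_add powr_add 2[of "fps_const c + fps_const d * fps_X"]
    by (simp add: mult_ac flip: fps_const_mult)
  then show ?thesis by (simp add: mob_def fps_mult_nth atMost_atLeast0)
qed

text \<open>
  A polynomial of degree at most \<open>m\<close> stands for a homogeneous one of degree \<open>m\<close> in \<open>z\<close> and \<open>z'\<close>, with \<open>z' = 1\<close>;
  the factor \<open>z - z'\<close> becomes \<open>[:-1, 1:]\<close>, and restriction to the diagonal becomes evaluation at 1.
\<close>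

definition mob_tensor ::
  "real \<Rightarrow> real \<Rightarrow> real \<Rightarrow> real \<Rightarrow> real \<Rightarrow> real \<Rightarrow> nat \<Rightarrow> nat \<Rightarrow> real poly \<Rightarrow> real poly" where
  "mob_tensor a b c d \<kappa> \<mu> n m p = (\<Sum>i\<le>n. monom
     (\<Sum>j\<le>m. mob a b c d \<kappa> i j * mob a b c d \<mu> (n - i) (m - j) * coeff p j) i)"

lemma coeff_mob_tensor:
  "coeff (mob_tensor a b c d \<kappa> \<mu> n m p) i =
     (if i \<le> n then \<Sum>j\<le>m. mob a b c d \<kappa> i j * mob a b c d \<mu> (n - i) (m - j) * coeff p j else 0)"
proof -
  have "coeff (mob_tensor a b c d \<kappa> \<mu> n m p) i = (\<Sum>k\<le>n. if i = k then
     (\<Sum>j\<le>m. mob a b c d \<kappa> i j * mob a b c d \<mu> (n - i) (m - j) * coeff p j) else 0)"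
    unfolding mob_tensor_def coeff_sum coeff_monom by (intro sum.cong) auto
  also have "\<dots> = (if i \<le> n then \<Sum>j\<le>m. mob a b c d \<kappa> i j * mob a b c d \<mu> (n - i) (m - j) * coeff p j else 0)"
    by (subst sum.delta') auto
  finally show ?thesis .
qed

lemma degree_mob_tensor: "degree (mob_tensor a b c d \<kappa> \<mu> n m p) \<le> n"
  by (rule degree_le) (simp add: coeff_mob_tensor)

lemma mob_tensor_add:
  "mob_tensor a b c d \<kappa> \<mu> n m (p + q) = mob_tensor a b c d \<kappa> \<mu> n m p + mob_tensor a b c d \<kappa> \<mu> n m q"
  by (rule poly_eqI) (simp add: coeff_mob_tensor sum.distrib algebra_simps)

lemma mob_tensor_smult:
  "mob_tensor a b c d \<kappa> \<mu> n m (smult s p) = smult s (mob_tensor a b c d \<kappa> \<mu> n m p)"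
  by (rule poly_eqI) (simp add: coeff_mob_tensor sum_distrib_left mult_ac)

lemma poly_1_eq_sum_coeff:
  fixes p :: "real poly"
  assumes "degree p \<le> n" shows "poly p 1 = (\<Sum>i\<le>n. coeff p i)"
proof -
  have "poly p 1 = (\<Sum>i\<le>degree p. coeff p i)" by (simp add: poly_altdef)
  also have "\<dots> = (\<Sum>i\<le>n. coeff p i)"
    using assms by (intro sum.mono_neutral_left) (auto intro: coeff_eq_0)
  finally show ?thesis .
qed

lemma poly_mob_tensor_1:
  assumes "a > 0" "degree p \<le> m"
  shows "poly (mob_tensor a b c d \<kappa> \<mu> n m p) 1 = mob a b c d (\<kappa> + \<mu>) n m * poly p 1"
proof -
  have "poly (mob_tensor a b c d \<kappa> \<mu> n m p) 1 =
      (\<Sum>i\<le>n. \<Sum>j\<le>m. mob a b c d \<kappa> i j * mob a b c d \<mu> (n - i) (m - j) * coeff p j)"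
    by (simp add: poly_1_eq_sum_coeff[OF degree_mob_tensor] coeff_mob_tensor)
  also have "\<dots> = (\<Sum>j\<le>m. (\<Sum>i\<le>n. mob a b c d \<kappa> i j * mob a b c d \<mu> (n - i) (m - j)) * coeff p j)"
    by (subst sum.swap) (simp add: sum_distrib_right)
  also have "\<dots> = mob a b c d (\<kappa> + \<mu>) n m * poly p 1"
    using assms by (simp add: mob_convolution poly_1_eq_sum_coeff sum_distrib_left)
  finally show ?thesis .
qed

text \<open>For \<open>f z = (c + d z) / (a + b z)\<close> one has
  \<open>f z - f z' = (a d - b c) (z - z') / ((a + b z) (a + b z'))\<close>. So a factor
  \<open>z - z'\<close> passes through the operator at the cost of the determinant, and the two
  denominators raise both parameters by one.\<close>

lemma mob_tensor_factor:
  assumes a: "a > 0" and p: "degree p \<le> m"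
  shows "mob_tensor a b c d \<kappa> \<mu> (Suc n) (Suc m) ([:-1, 1:] * p) =
    smult (a * d - b * c) ([:-1, 1:] * mob_tensor a b c d (\<kappa> + 1) (\<mu> + 1) n m p)"
proof (rule poly_eqI)
  fix i
  let ?X = "mob a b c d (\<kappa> + 1)" and ?Y = "mob a b c d (\<mu> + 1)" and ?\<Delta> = "a * d - b * c"
  let ?P = "mob a b c d \<kappa>" and ?Q = "mob a b c d \<mu>"
  have cf: "coeff ([:-1, 1:] * q) k = (if k = 0 then 0 else coeff q (k - 1)) - coeff q k" for q :: "real poly" and k
    by (cases k) simp_all
  show "coeff (mob_tensor a b c d \<kappa> \<mu> (Suc n) (Suc m) ([:-1, 1:] * p)) i =
     coeff (smult ?\<Delta> ([:-1, 1:] * mob_tensor a b c d (\<kappa> + 1) (\<mu> + 1) n m p)) i"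
  proof (cases "i \<le> Suc n")
    case False
    then show ?thesis by (simp only: coeff_smult cf) (simp add: coeff_mob_tensor)
  next
    case True
    have pm: "coeff p (Suc m) = 0" using p by (simp add: coeff_eq_0)
    have "coeff (mob_tensor a b c d \<kappa> \<mu> (Suc n) (Suc m) ([:-1, 1:] * p)) i =
      (\<Sum>j\<le>Suc m. ?P i j * ?Q (Suc n - i) (Suc m - j) * (if j = 0 then 0 else coeff p (j - 1))) -
      (\<Sum>j\<le>Suc m. ?P i j * ?Q (Suc n - i) (Suc m - j) * coeff p j)"
      unfolding coeff_mob_tensor cf using True
      by (simp only: if_True right_diff_distrib sum_subtractf)
    also have "(\<Sum>j\<le>Suc m. ?P i j * ?Q (Suc n - i) (Suc m - j) * (if j = 0 then 0 else coeff p (j - 1))) =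
      (\<Sum>j\<le>m. ?P i (Suc j) * ?Q (Suc n - i) (m - j) * coeff p j)"
      by (subst sum.atMost_Suc_shift) simp
    also have "(\<Sum>j\<le>Suc m. ?P i j * ?Q (Suc n - i) (Suc m - j) * coeff p j) =
      (\<Sum>j\<le>m. ?P i j * ?Q (Suc n - i) (Suc m - j) * coeff p j)"
      by (simp add: pm)
    finally have L: "coeff (mob_tensor a b c d \<kappa> \<mu> (Suc n) (Suc m) ([:-1, 1:] * p)) i =
      (\<Sum>j\<le>m. (?P i (Suc j) * ?Q (Suc n - i) (m - j) - ?P i j * ?Q (Suc n - i) (Suc m - j)) * coeff p j)"
      by (simp only: sum_subtractf left_diff_distrib)
    have E: "?P i (Suc j) * ?Q (Suc n - i) (m - j) - ?P i j * ?Q (Suc n - i) (Suc m - j) =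
       ?\<Delta> * ((if i = 0 then 0 else ?X (i - 1) j * ?Y (n - (i - 1)) (m - j)) -
              (if i \<le> n then ?X i j * ?Y (n - i) (m - j) else 0))" if "j \<le> m" for j
    proof -
      have s: "Suc m - j = Suc (m - j)" using that by simp
      have t: "i \<le> n \<Longrightarrow> Suc n - i = Suc (n - i)" "i \<noteq> 0 \<Longrightarrow> n - (i - 1) = Suc n - i"
        using True by auto
      show ?thesis
        unfolding s mob_numerator mob_denominator[OF a, of b c d \<kappa> i j] mob_denominator[OF a, of b c d \<mu> "Suc n - i" "m - j"]
        using True t by (cases "i = 0"; cases "i \<le> n") (auto simp: algebra_simps)
    qed
    let ?S = "\<lambda>i. \<Sum>j\<le>m. ?X i j * ?Y (n - i) (m - j) * coeff p j"
    have "(\<Sum>j\<le>m. (?P i (Suc j) * ?Q (Suc n - i) (m - j) - ?P i j * ?Q (Suc n - i) (Suc m - j)) * coeff p j) =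
       (\<Sum>j\<le>m. ?\<Delta> * ((if i = 0 then 0 else ?X (i - 1) j * ?Y (n - (i - 1)) (m - j)) -
              (if i \<le> n then ?X i j * ?Y (n - i) (m - j) else 0)) * coeff p j)"
      using E by (intro sum.cong) auto
    also have "\<dots> = ?\<Delta> * ((if i = 0 then 0 else ?S (i - 1)) - (if i \<le> n then ?S i else 0))"
      by (cases "i = 0"; cases "i \<le> n")
        (simp_all add: sum_distrib_left left_diff_distrib right_diff_distrib sum_subtractf mult.assoc)
    also have "\<dots> = coeff (smult ?\<Delta> ([:-1, 1:] * mob_tensor a b c d (\<kappa> + 1) (\<mu> + 1) n m p)) i"
      unfolding coeff_smult cf coeff_mob_tensor using True by auto
    finally show ?thesis unfolding L .
  qed
qed

lemma mob_tensor_power: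
  assumes a: "a > 0" and "degree p \<le> m"
  shows "mob_tensor a b c d \<kappa> \<mu> (n + k) (m + k) ([:-1, 1:] ^ k * p) =
    smult ((a * d - b * c) ^ k) ([:-1, 1:] ^ k * mob_tensor a b c d (\<kappa> + real k) (\<mu> + real k) n m p)"
  using assms(2)
proof (induction k arbitrary: \<kappa> \<mu>)
  case (Suc k)
  have "degree ([:-1, 1:] ^ k * p) \<le> degree ([:-1, 1::real:] ^ k) + degree p" by (rule degree_mult_le)
  then have deg: "degree ([:-1, 1:] ^ k * p) \<le> m + k" using Suc.prems by (simp add: degree_power_eq)
  have "[:-1, 1:] ^ Suc k * p = [:-1, 1:] * ([:-1, 1:] ^ k * p)" by (simp only: power_Suc mult.assoc)
  then have "mob_tensor a b c d \<kappa> \<mu> (n + Suc k) (m + Suc k) ([:-1, 1:] ^ Suc k * p) =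
    smult (a * d - b * c) ([:-1, 1:] * mob_tensor a b c d (\<kappa> + 1) (\<mu> + 1) (n + k) (m + k) ([:-1, 1:] ^ k * p))"
    using mob_tensor_factor[OF a deg, of b c d \<kappa> \<mu> "n + k"] by (simp only: add_Suc_right)
  also have "\<dots> = smult ((a * d - b * c) ^ Suc k) ([:-1, 1:] ^ Suc k *
      mob_tensor a b c d (\<kappa> + real (Suc k)) (\<mu> + real (Suc k)) n m p)"
    unfolding Suc.IH[OF Suc.prems, of "\<kappa> + 1" "\<mu> + 1"] mult_smult_right smult_smult power_Suc mult.assoc
    by (simp add: add_ac)
  finally show ?case .
qed simp

text \<open>The symmetry of the factors makes \<open>T'\<close> adjoint to \<open>T\<close>, so
  \<open>T' T\<close> is symmetric. It preserves the flag; on the k-th quotient \<open>T\<close> and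
  \<open>T'\<close> act as kernel entries of parameter \<kappa> + \<mu> + 2k times the k-th power of
  the determinant. Up to weights, the product in the conclusion is a squared entry of
  \<open>T\<close>, which is at most the quadratic form of \<open>T' T\<close> at a basis
  vector.\<close>

lemma mob_tensor_bound:
  fixes a b c d \<kappa> \<mu> :: real
  assumes a: "a > 0" and mn: "m \<le> n" and ij: "i \<le> n" "j \<le> m"
    and w: "\<And>i. i \<le> n \<Longrightarrow> w i > 0"
    and w_sym: "\<And>i j. i \<le> n \<Longrightarrow> j \<le> n \<Longrightarrow> w j * mob a b c d \<kappa> i j = w i * mob a b c d \<kappa> j i"
    and v: "\<And>i. i \<le> n \<Longrightarrow> v i > 0"
    and v_sym: "\<And>i j. i \<le> n \<Longrightarrow> j \<le> n \<Longrightarrow> v j * mob a b c d \<mu> i j = v i * mob a b c d \<mu> j i"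
    and R: "\<And>k. k \<le> m \<Longrightarrow> ((a * d - b * c) ^ k)\<^sup>2 *
       (mob a b c d (\<kappa> + \<mu> + 2 * real k) (n - k) (m - k) * mob a b c d (\<kappa> + \<mu> + 2 * real k) (m - k) (n - k)) \<le> R"
  shows "(mob a b c d \<kappa> i j * mob a b c d \<kappa> j i) *
     (mob a b c d \<mu> (n - i) (m - j) * mob a b c d \<mu> (m - j) (n - i)) \<le> R"
proof -
  let ?P = "mob a b c d \<kappa>" and ?Q = "mob a b c d \<mu>" and ?\<Delta> = "a * d - b * c"
  define T where "T = mob_tensor a b c d \<kappa> \<mu> n m"
  define T' where "T' = mob_tensor a b c d \<kappa> \<mu> m n"
  \<comment> \<open>Reciprocals, because \<open>w_sym\<close> says that the matrix becomes symmetric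
    once row i is divided by \<open>w i\<close>.\<close>
  define \<theta> where "\<theta> j = 1 / (w j * v (m - j))" for j
  define \<eta> where "\<eta> i = 1 / (w i * v (n - i))" for i
  define e where "e k = (?\<Delta> ^ k)\<^sup>2 *
       (mob a b c d (\<kappa> + \<mu> + 2 * real k) (n - k) (m - k) * mob a b c d (\<kappa> + \<mu> + 2 * real k) (m - k) (n - k))" for k
  have \<theta>: "\<theta> j > 0" if "j \<le> m" for j using that mn w[of j] v[of "m - j"] by (simp add: \<theta>_def)
  have \<eta>: "\<eta> i > 0" if "i \<le> n" for i using that w[of i] v[of "n - i"] by (simp add: \<eta>_def)
  have adj: "\<theta> j * (?P j i * ?Q (m - j) (n - i)) = \<eta> i * (?P i j * ?Q (n - i) (m - j))"
    if "i \<le> n" "j \<le> m" for i j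
  proof -
    have pos: "w i > 0" "w j > 0" "v (n - i) > 0" "v (m - j) > 0"
      using that mn w[of i] w[of j] v[of "n - i"] v[of "m - j"] by auto
    have eq: "?P j i = w j * ?P i j / w i" "?Q (m - j) (n - i) = v (m - j) * ?Q (n - i) (m - j) / v (n - i)"
      using w_sym[of i j] v_sym[of "n - i" "m - j"] that mn pos by (auto simp: field_simps)
    show ?thesis unfolding eq using pos by (simp add: \<theta>_def \<eta>_def)
  qed
  have adjoint: "weighted_ip \<theta> m (T' (T p)) q = weighted_ip \<eta> n (T p) (T q)" for p q
  proof -
    have "weighted_ip \<theta> m (T' (T p)) q =
        (\<Sum>j\<le>m. \<Sum>i\<le>n. (\<theta> j * (?P j i * ?Q (m - j) (n - i))) * (coeff (T p) i * coeff q j))"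
      by (simp add: weighted_ip_def T'_def coeff_mob_tensor sum_distrib_left sum_distrib_right mult_ac)
    also have "\<dots> = (\<Sum>j\<le>m. \<Sum>i\<le>n. (\<eta> i * (?P i j * ?Q (n - i) (m - j))) * (coeff (T p) i * coeff q j))"
      by (intro sum.cong refl) (simp add: adj)
    also have "\<dots> = weighted_ip \<eta> n (T p) (T q)"
      by (subst sum.swap) (simp add: weighted_ip_def T_def[of ] coeff_mob_tensor[of _ _ _ _ _ _ _ _ q] sum_distrib_left mult_ac)
    finally show ?thesis .
  qed
  have tri: "T' (T p) - smult (e k) p \<in> flag m (Suc k)" if k: "k \<le> m" and p: "p \<in> flag m k" for k p
  proof (cases "p = 0")
    case True
    have "T' (T 0) = 0" unfolding T_def T'_def
      by (rule poly_eqI) (simp add: coeff_mob_tensor)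
    with True show ?thesis by (simp add: flag_def)
  next
    case False
    obtain h where h: "p = [:-1, 1:] ^ k * h" using p by (auto simp: flag_def)
    with False have h0: "h \<noteq> 0" by auto
    have dh: "degree h \<le> m - k"
      using p h0 by (simp add: flag_def h degree_mult_eq degree_power_eq)
    let ?T = "mob_tensor a b c d (\<kappa> + real k) (\<mu> + real k)"
    define g where "g = smult ((?\<Delta> ^ k)\<^sup>2) (?T (m - k) (n - k) (?T (n - k) (m - k) h))"
    have "T p = smult (?\<Delta> ^ k) ([:-1, 1:] ^ k * ?T (n - k) (m - k) h)"
      unfolding T_def h using mob_tensor_power[OF a dh, of b c d \<kappa> \<mu> "n - k" k] k mn by simp
    then have "T' (T p) = smult (?\<Delta> ^ k) (T' ([:-1, 1:] ^ k * ?T (n - k) (m - k) h))"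
      by (simp add: T'_def mob_tensor_smult)
    also have "T' ([:-1, 1:] ^ k * ?T (n - k) (m - k) h) = smult (?\<Delta> ^ k) ([:-1, 1:] ^ k * ?T (m - k) (n - k) (?T (n - k) (m - k) h))"
      unfolding T'_def using mob_tensor_power[OF a degree_mob_tensor[where n = "n - k"], of b c d \<kappa> \<mu> "m - k" k] k mn by simp
    finally have TT: "T' (T p) = [:-1, 1:] ^ k * g"
      by (simp add: g_def power2_eq_square)
    have "poly g 1 = e k * poly h 1"
      unfolding g_def e_def
      by (simp add: poly_mob_tensor_1[OF a degree_mob_tensor] poly_mob_tensor_1[OF a dh] algebra_simps)
    then have "[:-1, 1:] dvd g - smult (e k) h"
      using poly_eq_0_iff_dvd[of "g - smult (e k) h" 1] by simp
    then have "[:-1, 1:] ^ k * [:-1, 1:] dvd [:-1, 1:] ^ k * (g - smult (e k) h)"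
      by (rule mult_dvd_mono[OF dvd_refl])
    also have "[:-1, 1:] ^ k * (g - smult (e k) h) = T' (T p) - smult (e k) p"
      unfolding TT unfolding h by (simp add: right_diff_distrib)
    finally have "[:-1, 1:] ^ Suc k dvd T' (T p) - smult (e k) p" by (simp only: power_Suc2)
    moreover have "degree (T' (T p) - smult (e k) p) \<le> m"
      using p order_trans[OF degree_smult_le[of "e k" p]]
      by (intro degree_diff_le) (auto simp: flag_def T'_def degree_mob_tensor)
    ultimately show ?thesis by (simp add: flag_def)
  qed
  define p :: "real poly" where "p = monom 1 j"
  have dp: "degree p \<le> m" using ij by (simp add: p_def degree_monom_eq)
  have "weighted_ip \<theta> m p (T' (T p)) \<le> R * weighted_ip \<theta> m p p"
  proof (rule flag_bound[OF \<theta> _ _ _ tri _ dp])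
    show "T' (T (p + q)) = T' (T p) + T' (T q)" for p q
      by (simp add: T_def T'_def mob_tensor_add)
    show "T' (T (smult s p)) = smult s (T' (T p))" for s p
      by (simp add: T_def T'_def mob_tensor_smult)
    show "weighted_ip \<theta> m (T' (T p)) q = weighted_ip \<theta> m p (T' (T q))" for p q
      by (metis adjoint weighted_ip_commute)
    show "e k \<le> R" if "k \<le> m" for k using R[OF that] by (simp add: e_def)
  qed
  moreover have "weighted_ip \<theta> m p p = \<theta> j"
    using ij by (simp add: weighted_ip_def p_def if_distrib[of "\<lambda>x. _ * x"] cong: if_cong)
  moreover have "weighted_ip \<theta> m p (T' (T p)) = weighted_ip \<eta> n (T p) (T p)"
    by (metis adjoint weighted_ip_commute)
  moreover have "\<eta> i * (coeff (T p) i * coeff (T p) i) \<le> weighted_ip \<eta> n (T p) (T p)"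
    unfolding weighted_ip_def using ij \<eta>
    by (intro member_le_sum) (auto simp: less_imp_le)
  moreover have "coeff (T p) i = ?P i j * ?Q (n - i) (m - j)"
    using ij by (simp add: T_def coeff_mob_tensor p_def if_distrib[of "\<lambda>x. _ * x"] cong: if_cong)
  ultimately have "\<eta> i * (?P i j * ?Q (n - i) (m - j)) * (?P i j * ?Q (n - i) (m - j)) \<le> \<theta> j * R"
    by (simp add: mult_ac)
  then have "\<theta> j * ((?P j i * ?Q (m - j) (n - i)) * (?P i j * ?Q (n - i) (m - j))) \<le> \<theta> j * R"
    unfolding adj[OF ij, symmetric] by (simp add: mult_ac)
  then show ?thesis using \<theta>[OF ij(2)] by (simp add: mult_ac)
qed

section \<open>Closed forms and weighted symmetry of the Moebius coefficients\<close>

lemma binom_fps_of_nat: "binom_fps (real n) x = (1 + fps_const x * fps_X) ^ n"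
proof (induction n)
  case (Suc n)
  have "real (Suc n) = 1 + real n" by simp
  then show ?case by (simp only: binom_fps_add binom_fps_1 Suc power_Suc)
qed (simp add: binom_fps_0)

lemma mob_eq_sum_gbinomial:
  "mob a b c d \<kappa> i j = a powr (- \<kappa> - real j) *
    (\<Sum>k\<le>min i j. real (j choose k) * c ^ (j - k) * d ^ k *
       ((- \<kappa> - real j) gchoose (i - k)) * (b / a) ^ (i - k))"
proof -
  let ?B = "binom_fps (- \<kappa> - real j) (b / a)"
  have "(fps_const c + fps_const d * fps_X) ^ j =
      (\<Sum>k\<le>j. of_nat (j choose k) * (fps_const d * fps_X) ^ k * fps_const c ^ (j - k))"
    by (subst add.commute) (rule binomial_ring)
  also have "\<dots> = (\<Sum>k\<le>j. fps_const (real (j choose k) * c ^ (j - k) * d ^ k) * fps_X ^ k)"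
    by (intro sum.cong refl)
      (simp add: power_mult_distrib fps_const_power fps_of_nat[symmetric] mult_ac flip: fps_const_mult)
  finally have "mob_fps a b c d \<kappa> j = fps_const (a powr (- \<kappa> - real j)) *
      (\<Sum>k\<le>j. fps_const (real (j choose k) * c ^ (j - k) * d ^ k) * (fps_X ^ k * ?B))"
    unfolding mob_fps_def by (simp add: sum_distrib_left sum_distrib_right mult_ac)
  then have "mob a b c d \<kappa> i j = a powr (- \<kappa> - real j) *
      (\<Sum>k\<le>j. real (j choose k) * c ^ (j - k) * d ^ k * (if i < k then 0 else fps_nth ?B (i - k)))"
    unfolding mob_def by (simp add: fps_sum_nth fps_X_power_mult_nth)
  also have "(\<Sum>k\<le>j. real (j choose k) * c ^ (j - k) * d ^ k * (if i < k then 0 else fps_nth ?B (i - k))) =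
      (\<Sum>k\<le>min i j. real (j choose k) * c ^ (j - k) * d ^ k *
       ((- \<kappa> - real j) gchoose (i - k)) * (b / a) ^ (i - k))"
    by (intro sum.mono_neutral_cong_right) (auto simp: binom_fps_def)
  finally show ?thesis .
qed

text \<open>Writing \<open>c + d z = c (1 + (b / a) z) + ((a d - b c) / a) z\<close> lets the first
  summand merge with the denominator before expansion. Rows and columns then enter in nearly the
  same way, which exposes the symmetry; the plain expansion of the numerator does not show
  it.\<close>

lemma mob_eq_sum_pochhammer:
  assumes a: "a > 0"
  shows "mob a b c d \<kappa> i j = a powr (- \<kappa>) *
    (\<Sum>k\<le>min i j. real (j choose k) * (pochhammer (\<kappa> + real k) (i - k) / fact (i - k)) *
       (c / a) ^ (j - k) * (- b / a) ^ (i - k) * ((a * d - b * c) / a\<^sup>2) ^ k)"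
proof -
  let ?\<Delta> = "a * d - b * c"
  let ?B = "\<lambda>e. binom_fps e (b / a)"
  have lin: "fps_const c + fps_const d * fps_X = fps_const c * ?B 1 + fps_const (?\<Delta> / a) * fps_X"
    using a by (intro fps_ext) (auto simp: binom_fps_1 fps_X_def field_simps)
  have B_pow: "?B 1 ^ n = ?B (real n)" for n
    by (simp add: binom_fps_of_nat binom_fps_1)
  have "(fps_const c + fps_const d * fps_X) ^ j =
      (\<Sum>k\<le>j. of_nat (j choose k) * (fps_const (?\<Delta> / a) * fps_X) ^ k * (fps_const c * ?B 1) ^ (j - k))"
    unfolding lin by (subst add.commute) (rule binomial_ring)
  also have "\<dots> = (\<Sum>k\<le>j. fps_const (real (j choose k) * c ^ (j - k) * (?\<Delta> / a) ^ k) * (fps_X ^ k * ?B (real (j - k))))"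
    by (intro sum.cong refl)
      (simp add: power_mult_distrib fps_const_power fps_of_nat[symmetric] B_pow mult_ac flip: fps_const_mult)
  finally have "mob_fps a b c d \<kappa> j = fps_const (a powr (- \<kappa> - real j)) *
      (\<Sum>k\<le>j. fps_const (real (j choose k) * c ^ (j - k) * (?\<Delta> / a) ^ k) *
         (fps_X ^ k * (?B (- \<kappa> - real j) * ?B (real (j - k)))))"
    unfolding mob_fps_def by (simp add: sum_distrib_left sum_distrib_right mult_ac)
  also have "\<dots> = (\<Sum>k\<le>j. fps_const (a powr (- \<kappa> - real j) * (real (j choose k) * c ^ (j - k) * (?\<Delta> / a) ^ k)) *
         (fps_X ^ k * ?B (- \<kappa> - real k)))"
    unfolding binom_fps_add[symmetric] sum_distrib_left
    by (intro sum.cong refl) (auto simp: of_nat_diff mult.assoc simp flip: fps_const_mult)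
  finally have "mob a b c d \<kappa> i j =
      (\<Sum>k\<le>j. a powr (- \<kappa> - real j) * (real (j choose k) * c ^ (j - k) * (?\<Delta> / a) ^ k) *
         (if i < k then 0 else fps_nth (?B (- \<kappa> - real k)) (i - k)))"
    unfolding mob_def by (simp add: fps_sum_nth fps_X_power_mult_nth)
  also have "\<dots> = (\<Sum>k\<le>min i j. a powr (- \<kappa>) * (real (j choose k) *
       (pochhammer (\<kappa> + real k) (i - k) / fact (i - k)) *
       (c / a) ^ (j - k) * (- b / a) ^ (i - k) * (?\<Delta> / a\<^sup>2) ^ k))"
  proof (rule sum.mono_neutral_cong_right)
    fix k assume "k \<in> {..min i j}"
    then have k: "k \<le> i" "k \<le> j" by auto
    have "a powr (- \<kappa> - real j) = a powr (- \<kappa>) / (a ^ (j - k) * a ^ k)"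
      using a k by (simp add: powr_diff powr_realpow flip: power_add)
    moreover have "(\<kappa>::real) + real k = - (- \<kappa> - real k)" by simp
    then have "(- \<kappa> - real k) gchoose (i - k) = (-1) ^ (i - k) * pochhammer (\<kappa> + real k) (i - k) / fact (i - k)"
      by (simp only: gbinomial_pochhammer)
    moreover have "(- b / a) ^ (i - k) = (-1) ^ (i - k) * (b / a) ^ (i - k)"
      by (simp flip: power_mult_distrib)
    ultimately show "a powr (- \<kappa> - real j) * (real (j choose k) * c ^ (j - k) * (?\<Delta> / a) ^ k) *
         (if i < k then 0 else fps_nth (?B (- \<kappa> - real k)) (i - k)) =
       a powr (- \<kappa>) * (real (j choose k) * (pochhammer (\<kappa> + real k) (i - k) / fact (i - k)) *
       (c / a) ^ (j - k) * (- b / a) ^ (i - k) * (?\<Delta> / a\<^sup>2) ^ k)"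
      using a k by (simp add: binom_fps_def power_divide power2_eq_square power_mult_distrib mult_ac)
  qed auto
  finally show ?thesis by (simp add: sum_distrib_left)
qed

text \<open>Multiplication by the weight turns each summand of the Pochhammer form into an
  expression invariant under exchange of i and j. The sign \<open>s\<close> is 1 for su(1,1) and -1
  for su(2); in the latter case, with \<kappa> = -N, the weight is the binomial coefficient of N
  over j.\<close>

lemma mob_symmetric:
  assumes a: "a > 0" and b: "b = - s * c" and s: "s\<^sup>2 = 1"
  shows "s ^ j * (pochhammer \<kappa> j / fact j) * mob a b c d \<kappa> i j =
         s ^ i * (pochhammer \<kappa> i / fact i) * mob a b c d \<kappa> j i"
proof -
  define S where "S i j k = s ^ k * s ^ (i - k) * s ^ (j - k) * (pochhammer \<kappa> k / fact k) *
      (pochhammer (\<kappa> + real k) (i - k) / fact (i - k)) * (pochhammer (\<kappa> + real k) (j - k) / fact (j - k)) *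
      (c / a) ^ (i - k) * (c / a) ^ (j - k) * ((a * d - b * c) / a\<^sup>2) ^ k" for i j k
  have 1: "s ^ j * (pochhammer \<kappa> j / fact j) * mob a b c d \<kappa> i j =
      a powr (- \<kappa>) * (\<Sum>k\<le>min i j. S i j k)" for i j
  proof -
    have "s ^ j * (pochhammer \<kappa> j / fact j) *
        (real (j choose k) * (pochhammer (\<kappa> + real k) (i - k) / fact (i - k)) *
       (c / a) ^ (j - k) * (- b / a) ^ (i - k) * ((a * d - b * c) / a\<^sup>2) ^ k) = S i j k"
      if "k \<le> min i j" for k
    proof -
      have k: "k \<le> j" using that by simp
      have "pochhammer \<kappa> j = pochhammer \<kappa> k * pochhammer (\<kappa> + real k) (j - k)"
        using k by (rule pochhammer_product)
      moreover have "real (j choose k) = fact j / (fact k * fact (j - k))"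
        using k by (rule binomial_fact)
      moreover have "s ^ j = s ^ k * s ^ (j - k)" using k by (simp flip: power_add)
      moreover have "(- b / a) ^ (i - k) = s ^ (i - k) * (c / a) ^ (i - k)"
        by (simp add: b flip: power_mult_distrib)
      ultimately show ?thesis by (simp add: S_def mult_ac)
    qed
    then have "s ^ j * (pochhammer \<kappa> j / fact j) * (\<Sum>k\<le>min i j. real (j choose k) *
       (pochhammer (\<kappa> + real k) (i - k) / fact (i - k)) *
       (c / a) ^ (j - k) * (- b / a) ^ (i - k) * ((a * d - b * c) / a\<^sup>2) ^ k) = (\<Sum>k\<le>min i j. S i j k)"
      unfolding sum_distrib_left by (intro sum.cong) auto
    then show ?thesis unfolding mob_eq_sum_pochhammer[OF a] by (simp add: mult_ac)
  qed
  have "S i j = S j i" by (rule ext) (simp add: S_def mult_ac)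
  then show ?thesis unfolding 1 by (simp add: min.commute)
qed

text \<open>Matrix coefficients, in the unnormalised monomials, of the involution sending z to
  \<open>(\<rho> - z) / (1 - \<rho> z)\<close>. For \<rho> \<noteq> 0 they are Meixner polynomials
  up to elementary factors.\<close>

definition su11 :: "real \<Rightarrow> real \<Rightarrow> nat \<Rightarrow> nat \<Rightarrow> real" where
  "su11 \<rho> \<kappa> = mob 1 (- \<rho>) \<rho> (- 1) \<kappa>"

lemma su11_symmetric: "pochhammer \<kappa> j / fact j * su11 \<rho> \<kappa> i j = pochhammer \<kappa> i / fact i * su11 \<rho> \<kappa> j i"
  using mob_symmetric[of 1 "- \<rho>" 1 \<rho> j \<kappa> "- 1" i] by (simp add: su11_def)

text \<open>The two closed forms agree term by term: the su(2) side is expanded along its numerator,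
  the su(1,1) side after absorption into the denominator. The spin depends on n + m, so only entries
  with the same n + m share an su(2) representation.\<close>

lemma su11_eq_su2:
  assumes "\<sigma> > 0" "\<rho>\<^sup>2 + \<sigma>\<^sup>2 = 1"
  shows "mob \<sigma> \<rho> \<rho> (- \<sigma>) (- (real n + real m + \<alpha>)) n m = \<sigma> powr \<alpha> * su11 \<rho> (1 + \<alpha>) n m"
proof -
  have "\<sigma> powr (real n + \<alpha>) * (real (m choose k) * \<rho> ^ (m - k) * (- \<sigma>) ^ k *
         ((real n + \<alpha>) gchoose (n - k)) * (\<rho> / \<sigma>) ^ (n - k)) =
       \<sigma> powr \<alpha> * (real (m choose k) * (pochhammer (1 + \<alpha> + real k) (n - k) / fact (n - k)) *
         \<rho> ^ (m - k) * \<rho> ^ (n - k) * (- (\<sigma>\<^sup>2)) ^ k)" if k: "k \<le> n" for k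
  proof -
    have "real n + \<alpha> - real (n - k) + 1 = 1 + \<alpha> + real k" using k by (simp add: of_nat_diff)
    then have 1: "(real n + \<alpha>) gchoose (n - k) = pochhammer (1 + \<alpha> + real k) (n - k) / fact (n - k)"
      by (simp only: gbinomial_pochhammer')
    have 2: "\<sigma> powr (real n + \<alpha>) = \<sigma> powr \<alpha> * (\<sigma> ^ k * \<sigma> ^ (n - k))"
      using assms k by (simp add: powr_add powr_realpow mult.commute flip: power_add)
    have 3: "(- (\<sigma>\<^sup>2)) ^ k = (- \<sigma>) ^ k * \<sigma> ^ k"
      by (simp add: power2_eq_square flip: power_mult_distrib)
    show ?thesis unfolding 1 2 3 using assms(1) by (simp add: power_divide mult_ac)
  qed
  moreover have "- \<rho> * \<rho> + 1 = \<sigma>\<^sup>2" using assms(2) by (simp add: power2_eq_square)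
  then have "1 * (- 1) - (- \<rho>) * \<rho> = - (\<sigma>\<^sup>2)" by simp
  moreover have "- (- (real n + real m + \<alpha>)) - real m = real n + \<alpha>" by simp
  ultimately show ?thesis
    unfolding su11_def mob_eq_sum_gbinomial[of \<sigma>] mob_eq_sum_pochhammer[OF zero_less_one]
    by (simp only: sum_distrib_left) (auto intro!: sum.cong)
qed


lemma su11_0_0: "su11 \<rho> \<kappa> 0 0 = 1"
  by (simp add: su11_def mob_eq_sum_pochhammer)

text \<open>
  The tensor square of the \<open>su(2)\<close> picture, restricted to the weight space spanned by
  \<open>v ^ i * v' ^ (n + m - i)\<close>; the entry at \<open>(n, m)\<close>, \<open>(m, n)\<close> is chosen because this weight space
  is positive definite for \<open>\<alpha> \<ge> 0\<close>, whatever the size of \<open>n - m\<close>.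
\<close>

lemma su11_doubling:
  fixes n m :: nat
  assumes \<sigma>: "\<sigma> > 0" "\<rho>\<^sup>2 + \<sigma>\<^sup>2 = 1" and \<alpha>: "\<alpha> \<ge> 0"
  defines "Q \<equiv> \<lambda>\<alpha> n m. \<sigma> powr (2 * \<alpha>) * (su11 \<rho> (1 + \<alpha>) n m * su11 \<rho> (1 + \<alpha>) m n)"
  shows "\<exists>l. (Q \<alpha> n m)\<^sup>2 \<le> Q (2 * \<alpha>) l l"
proof -
  define s where "s = n + m"
  define N where "N = real n + real m + \<alpha>"
  define R where "R = Max ((\<lambda>l. Q (2 * \<alpha>) l l) ` {..s})"
  have R: "Q (2 * \<alpha>) l l \<le> R" if "l \<le> s" for l
    unfolding R_def using that by (intro Max_ge) auto
  have "R \<in> (\<lambda>l. Q (2 * \<alpha>) l l) ` {..s}" unfolding R_def by (intro Max_in) auto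
  then obtain l where l: "R = Q (2 * \<alpha>) l l" by blast
  have \<sigma>2: "\<sigma> powr (2 * x) = \<sigma> powr x * \<sigma> powr x" for x by (simp flip: powr_add)
  have \<Delta>: "\<sigma> * - \<sigma> - \<rho> * \<rho> = - 1" using \<sigma>(2) by (simp add: power2_eq_square)
  have Q: "mob \<sigma> \<rho> \<rho> (- \<sigma>) (- N) n m * mob \<sigma> \<rho> \<rho> (- \<sigma>) (- N) m n = Q \<alpha> n m"
    using su11_eq_su2[OF \<sigma>, of n m \<alpha>] su11_eq_su2[OF \<sigma>, of m n \<alpha>]
    unfolding N_def Q_def \<sigma>2 by (simp add: add.commute mult_ac)
  define w where "w j = (- 1) ^ j * (pochhammer (- N) j / fact j)" for j :: nat
  have w: "w j > 0" if "j \<le> s" for j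
  proof -
    \<comment> \<open>Here j \<le> n + m \<le> N because \<alpha> \<ge> 0, so all factors N, ..., N
      - j + 1 are positive.\<close>
    have "w j = N gchoose j" by (simp add: w_def gbinomial_pochhammer)
    also have "\<dots> > 0" using that \<alpha>
      by (auto simp: gbinomial_prod_rev N_def s_def intro!: divide_pos_pos prod_pos)
    finally show ?thesis .
  qed
  have w_sym: "w j * mob \<sigma> \<rho> \<rho> (- \<sigma>) (- N) i j = w i * mob \<sigma> \<rho> \<rho> (- \<sigma>) (- N) j i" for i j
    unfolding w_def by (rule mob_symmetric) (use \<sigma> in auto)
  have "(mob \<sigma> \<rho> \<rho> (- \<sigma>) (- N) n m * mob \<sigma> \<rho> \<rho> (- \<sigma>) (- N) m n) *
      (mob \<sigma> \<rho> \<rho> (- \<sigma>) (- N) (s - n) (s - m) * mob \<sigma> \<rho> \<rho> (- \<sigma>) (- N) (s - m) (s - n)) \<le> R"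
  proof (rule mob_tensor_bound[where w = w and v = w])
    fix k assume k: "k \<le> s"
    \<comment> \<open>The count that closes the recursion: 2N - 2k = 2(s - k) + 2\<alpha>, so the
      k-th eigenvalue is the diagonal expression at l = s - k with \<alpha> doubled.\<close>
    have "- N + - N + 2 * real k = - (real (s - k) + real (s - k) + 2 * \<alpha>)"
      using k by (simp add: N_def s_def of_nat_diff)
    moreover have "((\<sigma> * - \<sigma> - \<rho> * \<rho>) ^ k)\<^sup>2 = 1"
      unfolding \<Delta> by (simp flip: power_mult)
    ultimately show "((\<sigma> * - \<sigma> - \<rho> * \<rho>) ^ k)\<^sup>2 *
        (mob \<sigma> \<rho> \<rho> (- \<sigma>) (- N + - N + 2 * real k) (s - k) (s - k) *
         mob \<sigma> \<rho> \<rho> (- \<sigma>) (- N + - N + 2 * real k) (s - k) (s - k)) \<le> R"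
      using R[of "s - k"] su11_eq_su2[OF \<sigma>, of "s - k" "s - k" "2 * \<alpha>"]
      unfolding Q_def \<sigma>2[of "2 * \<alpha>"] by (simp only:) (simp add: mult_ac)
  qed (use w w_sym \<sigma> in \<open>auto simp: s_def\<close>)
  moreover have sn: "s - n = m" "s - m = n" by (auto simp: s_def)
  ultimately have "Q \<alpha> n m * Q \<alpha> n m \<le> R"
    unfolding sn by (simp only: Q mult.commute[of "mob \<sigma> \<rho> \<rho> (- \<sigma>) (- N) m n"])
  then show ?thesis unfolding l by (auto simp: power2_eq_square)
qed

text \<open>The powers of Q with exponents 2, 4, 8, ... all stay below C, hence Q is at most 1. Each
  doubling also doubles \<alpha>, so it is essential that one C serves every \<alpha> \<ge> 0. The
  exponents start at 2 because \<open>crude\<close> speaks of diagonal entries, which one doubling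
  reaches.\<close>

lemma su11_bound_nonneg:
  assumes \<sigma>: "\<sigma> > 0" "\<rho>\<^sup>2 + \<sigma>\<^sup>2 = 1" and \<alpha>: "\<alpha> \<ge> 0"
    and crude: "\<And>\<alpha> l. \<alpha> \<ge> 0 \<Longrightarrow> \<sigma> powr (2 * \<alpha>) * (su11 \<rho> (1 + \<alpha>) l l * su11 \<rho> (1 + \<alpha>) l l) \<le> C"
  shows "\<sigma> powr (2 * \<alpha>) * (su11 \<rho> (1 + \<alpha>) n m * su11 \<rho> (1 + \<alpha>) m n) \<le> 1"
proof -
  define Q where "Q \<alpha> n m = \<sigma> powr (2 * \<alpha>) * (su11 \<rho> (1 + \<alpha>) n m * su11 \<rho> (1 + \<alpha>) m n)" for \<alpha> n m
  have pow: "Q \<alpha> n m ^ 2 ^ Suc j \<le> C" if "\<alpha> \<ge> 0" for \<alpha> n m j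
    using that
  proof (induction j arbitrary: \<alpha> n m)
    case 0
    obtain l where "(Q \<alpha> n m)\<^sup>2 \<le> Q (2 * \<alpha>) l l"
      using su11_doubling[OF \<sigma> 0, of n m] unfolding Q_def by blast
    also have "\<dots> \<le> C" using crude[of "2 * \<alpha>" l] 0 by (simp add: Q_def)
    finally show ?case by simp
  next
    case (Suc j)
    obtain l where l: "(Q \<alpha> n m)\<^sup>2 \<le> Q (2 * \<alpha>) l l"
      using su11_doubling[OF \<sigma> Suc.prems, of n m] unfolding Q_def by blast
    have "Q \<alpha> n m ^ 2 ^ Suc (Suc j) = ((Q \<alpha> n m)\<^sup>2) ^ 2 ^ Suc j"
      by (simp flip: power_mult)
    also have "\<dots> \<le> Q (2 * \<alpha>) l l ^ 2 ^ Suc j" by (intro power_mono l) simp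
    also have "\<dots> \<le> C" using Suc by simp
    finally show ?case .
  qed
  have "Q \<alpha> n m \<le> 1"
  proof (rule ccontr)
    assume "\<not> Q \<alpha> n m \<le> 1"
    then obtain j where "C < Q \<alpha> n m ^ j" using real_arch_pow[of "Q \<alpha> n m" C] by auto
    also have "\<dots> \<le> Q \<alpha> n m ^ 2 ^ Suc j"
      using \<open>\<not> Q \<alpha> n m \<le> 1\<close> less_exp[of "Suc j"] by (intro power_increasing) auto
    also have "\<dots> \<le> C" by (rule pow[OF \<alpha>])
    finally show False by simp
  qed
  then show ?thesis by (simp add: Q_def)
qed

text \<open>Tensoring with the representation of parameter \<open>1 - \<kappa>\<close> reduces to integral \<open>\<alpha>\<close>.\<close>

lemma su11_bound_le_1:
  assumes \<sigma>: "\<sigma> > 0" "\<rho>\<^sup>2 + \<sigma>\<^sup>2 = 1" and \<kappa>: "0 < \<kappa>" "\<kappa> < 1"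
    and bound: "\<And>\<alpha> n m. \<alpha> \<ge> 0 \<Longrightarrow> \<sigma> powr (2 * \<alpha>) * (su11 \<rho> (1 + \<alpha>) n m * su11 \<rho> (1 + \<alpha>) m n) \<le> 1"
  shows "su11 \<rho> \<kappa> n m * su11 \<rho> \<kappa> m n \<le> 1"
proof -
  have *: "su11 \<rho> \<kappa> n m * su11 \<rho> \<kappa> m n \<le> 1" if mn: "m \<le> n" for n m
  proof -
    let ?w = "\<lambda>\<kappa> j. pochhammer \<kappa> j / fact j :: real"
    have \<Delta>: "1 * - 1 - - \<rho> * \<rho> = - (\<sigma>\<^sup>2)" using \<sigma>(2) by (simp add: power2_eq_square)
    have "(mob 1 (- \<rho>) \<rho> (- 1) \<kappa> n m * mob 1 (- \<rho>) \<rho> (- 1) \<kappa> m n) *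
       (mob 1 (- \<rho>) \<rho> (- 1) (1 - \<kappa>) (n - n) (m - m) * mob 1 (- \<rho>) \<rho> (- 1) (1 - \<kappa>) (m - m) (n - n)) \<le> 1"
    proof (rule mob_tensor_bound[where w = "?w \<kappa>" and v = "?w (1 - \<kappa>)"])
      fix k assume k: "k \<le> m"
      \<comment> \<open>The k-th eigenvalue has parameter 1 + 2k, and the determinant supplies
        exactly the power of \<sigma> that \<open>bound\<close> asks for at \<alpha> = 2k. The
        second tensor factor enters only through its entry (0, 0), which is 1.\<close>
      have "((- (\<sigma>\<^sup>2)) ^ k)\<^sup>2 = \<sigma> powr (2 * (2 * real k))"
      proof -
        have "((- (\<sigma>\<^sup>2)) ^ k)\<^sup>2 = ((- (\<sigma>\<^sup>2))\<^sup>2) ^ k" by (simp only: power_mult[symmetric] mult.commute)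
        also have "\<dots> = \<sigma> ^ (4 * k)" by (simp flip: power_mult)
        also have "\<dots> = \<sigma> powr real (4 * k)" using \<sigma> by (simp only: powr_realpow)
        finally show ?thesis by simp
      qed
      then show "((1 * - 1 - - \<rho> * \<rho>) ^ k)\<^sup>2 *
        (mob 1 (- \<rho>) \<rho> (- 1) (\<kappa> + (1 - \<kappa>) + 2 * real k) (n - k) (m - k) *
         mob 1 (- \<rho>) \<rho> (- 1) (\<kappa> + (1 - \<kappa>) + 2 * real k) (m - k) (n - k)) \<le> 1"
        using bound[of "2 * real k" "n - k" "m - k"] unfolding \<Delta> by (simp add: su11_def)
    qed (use \<kappa> mn su11_symmetric[of \<kappa>] su11_symmetric[of "1 - \<kappa>"] in
        \<open>auto simp: pochhammer_pos su11_def\<close>)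
    then show ?thesis using su11_0_0[of \<rho> "1 - \<kappa>"] by (simp add: su11_def)
  qed
  show ?thesis using *[of m n] *[of n m] by (cases "m \<le> n") (auto simp: mult.commute)
qed

section \<open>Power series of the evolution kernel\<close>

lemma suminf_swap_dominated:
  fixes f :: "nat \<Rightarrow> nat \<Rightarrow> complex"
  assumes "\<And>n k. norm (f n k) \<le> a n * b k" "summable a" "summable b" "\<And>n. a n \<ge> 0" "\<And>k. b k \<ge> 0"
  shows "(\<Sum>n. \<Sum>k. f n k) = (\<Sum>k. \<Sum>n. f n k)"
proof -
  have ab: "Infinite_Set_Sum.abs_summable_on (\<lambda>(n, k). a n * b k) (UNIV \<times> UNIV)"
    using assms by (intro abs_summable_on_product) (auto simp: Infinite_Set_Sum.abs_summable_on_nat_iff')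
  have f: "Infinite_Set_Sum.abs_summable_on (\<lambda>(n, k). f n k) (UNIV \<times> UNIV)"
    using assms by (intro Infinite_Set_Sum.abs_summable_on_comparison_test[OF ab]) (auto simp: abs_mult)
  have 1: "summable (\<lambda>k. norm (f n k))" for n
    by (rule summable_comparison_test'[OF summable_mult[OF assms(3), of "a n"], of 0]) (use assms(1) in auto)
  have 2: "summable (\<lambda>n. norm (f n k))" for k
    by (rule summable_comparison_test'[OF summable_mult2[OF assms(2), of "b k"], of 0]) (use assms(1) in auto)
  have bb: "summable (\<lambda>n. norm (\<Sum>k. f n k))"
  proof (rule summable_comparison_test'[OF summable_mult2[OF assms(2), of "suminf b"], of 0])
    fix n
    have "norm (\<Sum>k. f n k) \<le> (\<Sum>k. norm (f n k))" by (rule summable_norm[OF 1])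
    also have "\<dots> \<le> (\<Sum>k. a n * b k)" using assms 1 by (intro suminf_le summable_mult) auto
    finally show "norm (norm (\<Sum>k. f n k)) \<le> a n * suminf b" using assms by (simp add: suminf_mult)
  qed
  have cc: "summable (\<lambda>k. norm (\<Sum>n. f n k))"
  proof (rule summable_comparison_test'[OF summable_mult[OF assms(3), of "suminf a"], of 0])
    fix k
    have "norm (\<Sum>n. f n k) \<le> (\<Sum>n. norm (f n k))" by (rule summable_norm[OF 2])
    also have "\<dots> \<le> (\<Sum>n. a n * b k)" using assms 2 by (intro suminf_le summable_mult2) auto
    finally show "norm (norm (\<Sum>n. f n k)) \<le> suminf a * b k" using assms by (simp add: suminf_mult2)
  qed
  have e1: "infsetsum (f n) UNIV = suminf (f n)" for n
    using 1 by (intro infsetsum_nat') (simp add: Infinite_Set_Sum.abs_summable_on_nat_iff')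
  have e2: "infsetsum (\<lambda>n. f n k) UNIV = suminf (\<lambda>n. f n k)" for k
    using 2 by (intro infsetsum_nat') (simp add: Infinite_Set_Sum.abs_summable_on_nat_iff')
  have "infsetsum (\<lambda>n. infsetsum (f n) UNIV) UNIV = infsetsum (\<lambda>k. infsetsum (\<lambda>n. f n k) UNIV) UNIV"
    by (rule infsetsum_swap) (use f in simp_all)
  then show ?thesis
    unfolding e1 e2 using bb cc
    by (simp add: infsetsum_nat' Infinite_Set_Sum.abs_summable_on_nat_iff')
qed

lemma powser_coeff_unique:
  fixes a b :: "nat \<Rightarrow> complex"
  assumes r: "r > 0" and eq: "\<And>z. norm z \<le> r \<Longrightarrow> summable (\<lambda>n. a n * z ^ n) \<and> summable (\<lambda>n. b n * z ^ n) \<and>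
       (\<Sum>n. a n * z ^ n) = (\<Sum>n. b n * z ^ n)"
  shows "a = b"
proof -
  have cr: "fps_conv_radius (Abs_fps c) > 0" if "\<And>z. norm z \<le> r \<Longrightarrow> summable (\<lambda>n. c n * z ^ n)" for c :: "nat \<Rightarrow> complex"
  proof -
    have "summable (\<lambda>n. c n * of_real r ^ n)" using that[of "of_real r"] r by simp
    then have "norm (of_real r :: complex) \<le> conv_radius c" by (rule conv_radius_geI)
    then show ?thesis using r by (simp add: fps_conv_radius_def) (metis ereal_less(2) less_le_trans)
  qed
  have "Abs_fps a = Abs_fps b"
  proof (rule eval_fps_eqD)
    show "fps_conv_radius (Abs_fps a) > 0" "fps_conv_radius (Abs_fps b) > 0"
      using eq by (auto intro!: cr)
    have "eventually (\<lambda>z::complex. z \<in> ball 0 r) (nhds 0)"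
      using r by (intro eventually_nhds_in_open) auto
    then show "eventually (\<lambda>z. eval_fps (Abs_fps a) z = eval_fps (Abs_fps b) z) (nhds 0)"
      by eventually_elim (use eq in \<open>auto simp: eval_fps_def\<close>)
  qed
  then show ?thesis by (metis fps_nth_Abs_fps ext)
qed

text \<open>Coefficient of \<open>z ^ n\<close> in
  \<open>(1 - x z) powr (- \<kappa>) * (x + y z / (1 - x z)) ^ m\<close>. This is the complex
  Pochhammer form for a Moebius map whose value at 0 is the reciprocal of its pole, so a single
  \<open>x\<close> plays both roles.\<close>

definition hcoef :: "real \<Rightarrow> complex \<Rightarrow> complex \<Rightarrow> nat \<Rightarrow> nat \<Rightarrow> complex" where
  "hcoef \<kappa> x y n m = (\<Sum>k\<le>min n m. of_nat (m choose k) *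
     of_real (pochhammer (\<kappa> + real k) (n - k) / fact (n - k)) * x ^ (n - k) * x ^ (m - k) * y ^ k)"

lemma pochhammer_sums:
  fixes z :: complex and \<mu> :: real
  assumes "norm z < 1"
  shows "(\<lambda>n. of_real (pochhammer \<mu> n / fact n) * z ^ n) sums (1 - z) powr (- of_real \<mu>)"
proof -
  have "(\<lambda>n. ((- of_real \<mu>) gchoose n) * (- z) ^ n) sums (1 + - z) powr (- of_real \<mu>)"
    using assms by (intro gen_binomial_complex) simp
  moreover have "((- of_real \<mu> :: complex) gchoose n) * (- z) ^ n = of_real (pochhammer \<mu> n / fact n) * z ^ n" for n
  proof -
    have "((- 1) ^ n * (- z) ^ n :: complex) = z ^ n" by (simp flip: power_mult_distrib)
    then show ?thesis
      by (simp add: gbinomial_pochhammer pochhammer_of_real mult_ac)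
  qed
  ultimately show ?thesis by simp
qed

lemma hcoef_sums:
  assumes xz: "norm (x * z) < 1"
  shows "(\<lambda>n. hcoef \<kappa> x y n m * z ^ n) sums
    ((1 - x * z) powr (- of_real \<kappa>) * (x + y * z / (1 - x * z)) ^ m)"
proof -
  have nz: "1 - x * z \<noteq> 0" using xz by auto
  define D where "D = 1 - x * z"
  define c where "c k = (of_nat (m choose k) * x ^ (m - k) * (y * z) ^ k :: complex)" for k
  define g where "g k n = (if n < k then 0 else
     of_real (pochhammer (\<kappa> + real k) (n - k) / fact (n - k)) * (x * z) ^ (n - k))" for k n
  have g: "g k sums (D powr (- of_real \<kappa>) / D ^ k)" for k
  proof -
    have "(\<lambda>n. g k (n + k)) sums D powr (- of_real (\<kappa> + real k))"
      unfolding g_def D_def using pochhammer_sums[OF xz, of "\<kappa> + real k"] by simp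
    then have "g k sums (D powr (- of_real (\<kappa> + real k)) + (\<Sum>i<k. g k i))"
      by (simp only: sums_iff_shift)
    moreover have "(\<Sum>i<k. g k i) = 0" by (simp add: g_def)
    moreover have "D powr (- of_real (\<kappa> + real k)) = D powr (- of_real \<kappa>) / D ^ k"
    proof -
      have "- complex_of_real (\<kappa> + real k) = - of_real \<kappa> - of_nat k" by simp
      then show ?thesis using nz by (simp add: powr_diff powr_nat' D_def)
    qed
    ultimately show ?thesis by simp
  qed
  have "(\<lambda>n. \<Sum>k\<le>m. c k * g k n) sums (\<Sum>k\<le>m. c k * (D powr (- of_real \<kappa>) / D ^ k))"
    by (intro sums_sum sums_mult g)
  moreover have "(\<Sum>k\<le>m. c k * g k n) = hcoef \<kappa> x y n m * z ^ n" for n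
  proof -
    have "(\<Sum>k\<le>m. c k * g k n) = (\<Sum>k\<le>min n m. c k * g k n)"
      by (rule sum.mono_neutral_right) (auto simp: g_def)
    also have "\<dots> = hcoef \<kappa> x y n m * z ^ n"
      unfolding hcoef_def sum_distrib_right
    proof (intro sum.cong refl)
      fix k assume "k \<in> {..min n m}"
      then have "z ^ n = z ^ k * z ^ (n - k)" by (simp flip: power_add)
      then show "c k * g k n = of_nat (m choose k) *
          of_real (pochhammer (\<kappa> + real k) (n - k) / fact (n - k)) * x ^ (n - k) * x ^ (m - k) * y ^ k * z ^ n"
        using \<open>k \<in> _\<close> by (simp add: c_def g_def power_mult_distrib mult_ac)
    qed
    finally show ?thesis .
  qed
  moreover have "(\<Sum>k\<le>m. c k * (D powr (- of_real \<kappa>) / D ^ k)) = D powr (- of_real \<kappa>) * (x + y * z / D) ^ m"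
    unfolding add.commute[of x] binomial_ring sum_distrib_left
    by (intro sum.cong refl) (simp add: c_def power_divide mult_ac)
  ultimately show ?thesis by (simp add: D_def)
qed

text \<open>Cauchy's estimate without a contour integral: passing to moduli gives nonnegative
  coefficients whose series at \<open>r\<close> has a closed form, and one term is at most the whole
  sum.\<close>

lemma hcoef_norm_bound:
  assumes \<kappa>: "\<kappa> > 0" and X: "norm x = X" and Y: "norm y = Y" and Xr: "X * r < 1" and r: "r > 0"
  shows "norm (hcoef \<kappa> x y n m) \<le> (1 - X * r) powr (- \<kappa>) * (X + Y * r / (1 - X * r)) ^ m * (1 / r) ^ n"
proof -
  have X0: "X \<ge> 0" "Y \<ge> 0" using X Y by auto
  define h where "h n = (\<Sum>k\<le>min n m. real (m choose k) *
     (pochhammer (\<kappa> + real k) (n - k) / fact (n - k)) * X ^ (n - k) * X ^ (m - k) * Y ^ k)" for n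
  have p: "pochhammer (\<kappa> + real k) l > 0" for k l using \<kappa> by (intro pochhammer_pos) auto
  have h0: "h n \<ge> 0" for n unfolding h_def using X0 p by (intro sum_nonneg mult_nonneg_nonneg) (auto simp: less_imp_le)
  have "norm (hcoef \<kappa> x y n m) \<le> h n"
    unfolding hcoef_def h_def
    by (rule sum_norm_le) (use p X Y in \<open>simp add: norm_mult norm_divide norm_power less_imp_le\<close>)
  also have "h n * r ^ n \<le> (1 - X * r) powr (- \<kappa>) * (X + Y * r / (1 - X * r)) ^ m"
  proof -
    let ?s = "(1 - X * r) powr (- \<kappa>) * (X + Y * r / (1 - X * r)) ^ m"
    have "(\<lambda>n. hcoef \<kappa> (of_real X) (of_real Y) n m * of_real r ^ n) sums
      ((1 - of_real X * of_real r) powr (- of_real \<kappa>) *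
        (of_real X + of_real Y * of_real r / (1 - of_real X * of_real r)) ^ m)"
      using X0 r Xr by (intro hcoef_sums) (simp add: norm_mult)
    moreover have "(1 - of_real X * of_real r :: complex) powr (- of_real \<kappa>) = of_real ((1 - X * r) powr (- \<kappa>))"
      using powr_of_real[of "1 - X * r" "- \<kappa>"] Xr by simp
    moreover have "hcoef \<kappa> (of_real X) (of_real Y) n m * of_real r ^ n = of_real (h n * r ^ n)" for n
      by (simp add: hcoef_def h_def)
    ultimately have "(\<lambda>n. complex_of_real (h n * r ^ n)) sums of_real ?s" by simp
    then have "(\<lambda>n. h n * r ^ n) sums ?s" by (simp only: sums_of_real_iff)
    moreover from this have "(\<Sum>i\<in>{n}. h i * r ^ i) \<le> (\<Sum>n. h n * r ^ n)"
      using h0 r by (intro sum_le_suminf) (auto simp: sums_iff)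
    ultimately show ?thesis by (simp add: sums_iff)
  qed
  then have "h n \<le> (1 - X * r) powr (- \<kappa>) * (X + Y * r / (1 - X * r)) ^ m * (1 / r) ^ n"
    using r by (simp add: field_simps power_divide)
  finally show ?thesis .
qed

text \<open>
  \<open>laguerre_coef \<kappa> t n m\<close> is the coefficient of \<open>y ^ n\<close> in \<open>laguerre_mult \<kappa> t y * laguerre_flow t y ^ m\<close>.
\<close>

definition laguerre_coef :: "real \<Rightarrow> real \<Rightarrow> nat \<Rightarrow> nat \<Rightarrow> complex" where
  "laguerre_coef \<kappa> t n m = (1 + \<i> * of_real t) powr (- of_real \<kappa>) *
     hcoef \<kappa> (- \<i> * of_real t / (1 + \<i> * of_real t)) (1 / (1 + \<i> * of_real t)\<^sup>2) n m"

text \<open>The factor \<open>((w + \<i> t) / w) powr (- \<kappa>)\<close> at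
  \<open>w = 1 / (1 + y)\<close>. Writing it with a difference of logarithms turns the cocycle law
  into a telescoping sum, free of branch corrections.\<close>

definition laguerre_mult :: "real \<Rightarrow> real \<Rightarrow> complex \<Rightarrow> complex" where
  "laguerre_mult \<kappa> t y = exp (- of_real \<kappa> * (Ln (1 / (1 + y) + \<i> * of_real t) - Ln (1 / (1 + y))))"

definition laguerre_flow :: "real \<Rightarrow> complex \<Rightarrow> complex" where
  "laguerre_flow t y = 1 / (1 / (1 + y) + \<i> * of_real t) - 1"

lemma one_plus_i_nz: "1 + \<i> * of_real t \<noteq> 0"
  by (simp add: complex_eq_iff)

lemma norm_one_plus_i: "(norm (1 + \<i> * of_real t))\<^sup>2 = 1 + t\<^sup>2"
  by (simp add: cmod_power2)

lemma cayley_half_plane: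
  assumes "norm (y::complex) < 1"
  shows "Re (1 + y) > 0" "1 + y \<noteq> 0" "Re (1 / (1 + y)) > 0"
proof -
  have "\<bar>Re y\<bar> < 1" using assms abs_Re_le_cmod[of y] by linarith
  then show 1: "Re (1 + y) > 0" by simp
  then show 2: "1 + y \<noteq> 0" by (metis less_irrefl zero_complex.simps(1))
  show "Re (1 / (1 + y)) > 0"
    using 1 2 by (simp add: Re_divide sum_power2_gt_zero_iff complex_eq_iff add_pos_nonneg)
qed

lemma flow_denominator:
  assumes "norm (y::complex) < 1"
  shows "norm (- \<i> * of_real t / (1 + \<i> * of_real t) * y) < 1"
    "1 + \<i> * of_real t * (1 + y) = (1 + \<i> * of_real t) * (1 - (- \<i> * of_real t / (1 + \<i> * of_real t)) * y)"
    "1 + \<i> * of_real t * (1 + y) \<noteq> 0"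
    "1 / (1 + y) + \<i> * of_real t = (1 + \<i> * of_real t * (1 + y)) / (1 + y)"
proof -
  let ?A = "1 + \<i> * of_real t"
  have "\<bar>t\<bar>\<^sup>2 < (norm ?A)\<^sup>2" by (simp add: norm_one_plus_i)
  then have "\<bar>t\<bar> < norm ?A" by (rule power2_less_imp_less) simp
  then have "norm (- \<i> * of_real t / ?A) \<le> 1" by (simp add: norm_mult norm_divide divide_le_eq_1)
  then have "norm (- \<i> * of_real t / ?A * y) \<le> 1 * norm y"
    unfolding norm_mult[of _ y] by (rule mult_right_mono) simp
  then show 1: "norm (- \<i> * of_real t / ?A * y) < 1" using assms by simp
  show 2: "1 + \<i> * of_real t * (1 + y) = ?A * (1 - (- \<i> * of_real t / ?A) * y)"
    using one_plus_i_nz[of t] by (simp add: field_simps)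
  have "1 - (- \<i> * of_real t / ?A) * y \<noteq> 0" using 1 by (metis eq_iff_diff_eq_0 less_irrefl norm_one)
  then show "1 + \<i> * of_real t * (1 + y) \<noteq> 0" unfolding 2 using one_plus_i_nz[of t] by simp
  show "1 / (1 + y) + \<i> * of_real t = (1 + \<i> * of_real t * (1 + y)) / (1 + y)"
    using cayley_half_plane[OF assms] by (simp add: field_simps)
qed

lemma laguerre_flow_eq:
  assumes "norm y < 1"
  shows "- \<i> * of_real t / (1 + \<i> * of_real t) +
      1 / (1 + \<i> * of_real t)\<^sup>2 * y / (1 - - \<i> * of_real t / (1 + \<i> * of_real t) * y) = laguerre_flow t y"
proof -
  let ?A = "1 + \<i> * of_real t" and ?D = "1 + \<i> * of_real t * (1 + y)"
  have A: "?A \<noteq> 0" by (rule one_plus_i_nz)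
  have D: "?D \<noteq> 0" and y: "1 + y \<noteq> 0"
    using flow_denominator[OF assms] cayley_half_plane[OF assms] by auto
  have 1: "1 - - \<i> * of_real t / ?A * y = ?D / ?A"
    using flow_denominator(2)[OF assms, of t] A by (simp add: field_simps)
  have "- \<i> * of_real t / ?A + 1 / ?A\<^sup>2 * y / (?D / ?A) = (- \<i> * of_real t * ?D + y) / (?A * ?D)"
    using A D by (simp add: divide_simps power2_eq_square)
  also have "- \<i> * of_real t * ?D + y = ?A * ((1 + y) - ?D)"
    by (simp add: algebra_simps)
  also have "?A * ((1 + y) - ?D) / (?A * ?D) = ((1 + y) - ?D) / ?D"
    using A by (rule mult_divide_mult_cancel_left)
  also have "\<dots> = (1 + y) / ?D - 1"
    by (simp only: diff_divide_distrib divide_self[OF D])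
  also have "\<dots> = laguerre_flow t y"
    unfolding laguerre_flow_def flow_denominator(4)[OF assms] using D y by simp
  finally show ?thesis unfolding 1 .
qed

text \<open>The branch check. The arguments of all logarithms stay in the right half-plane, so the
  difference \<open>F\<close> is holomorphic on the disc; its derivative vanishes and
  \<open>F 0 = 0\<close>, which excludes an offset by a multiple of
  \<open>2 \<pi> \<i>\<close>.\<close>

lemma Ln_flow:
  assumes "norm y < 1"
  shows "Ln (1 + \<i> * of_real t) + Ln (1 - (- \<i> * of_real t / (1 + \<i> * of_real t)) * y) =
         Ln (1 / (1 + y) + \<i> * of_real t) - Ln (1 / (1 + y))"
proof -
  let ?A = "1 + \<i> * of_real t" and ?p = "- \<i> * of_real t / (1 + \<i> * of_real t)"
  define F where "F z = Ln ?A + Ln (1 - ?p * z) - Ln (1 / (1 + z) + \<i> * of_real t) - Ln (1 + z)" for z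
  have re: "Re x > 0 \<Longrightarrow> x \<notin> \<real>\<^sub>\<le>\<^sub>0" for x :: complex
    by (auto simp: complex_nonpos_Reals_iff)
  have "\<exists>c. \<forall>z\<in>ball 0 1. F z = c"
  proof (rule has_field_derivative_zero_constant[OF convex_ball])
    fix z :: complex assume "z \<in> ball 0 1"
    then have z: "norm z < 1" by simp
    have "\<bar>Re (?p * z)\<bar> < 1" using abs_Re_le_cmod[of "?p * z"] flow_denominator(1)[OF z, of t] by linarith
    then have r1: "Re (1 - ?p * z) > 0" by simp
    have r2: "Re (1 / (1 + z) + \<i> * of_real t) > 0" using cayley_half_plane[OF z] by simp
    have A: "?A \<noteq> 0" by (rule one_plus_i_nz)
    let ?D = "1 + \<i> * of_real t * (1 + z)"
    have D: "?D \<noteq> 0" "1 + z \<noteq> 0"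
      using flow_denominator[OF z] cayley_half_plane[OF z] by auto
    let ?F = "at z within ball 0 1"
    have "((\<lambda>z. 1 - ?p * z) has_field_derivative - ?p) ?F"
      using A by (auto intro!: derivative_eq_intros)
    from has_field_derivative_Ln[THEN DERIV_chain2, OF re[OF r1] this]
    have d1: "((\<lambda>z. Ln (1 - ?p * z)) has_field_derivative - ?p / (1 - ?p * z)) ?F"
      by (simp add: divide_inverse mult_ac)
    have "((\<lambda>z. 1 / (1 + z) + \<i> * of_real t) has_field_derivative - 1 / (1 + z)\<^sup>2) ?F"
      using D by (auto intro!: derivative_eq_intros simp: power2_eq_square)
    from has_field_derivative_Ln[THEN DERIV_chain2, OF re[OF r2] this]
    have d2: "((\<lambda>z. Ln (1 / (1 + z) + \<i> * of_real t)) has_field_derivative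
        (- 1 / (1 + z)\<^sup>2) / (1 / (1 + z) + \<i> * of_real t)) ?F"
      by (simp add: divide_inverse mult_ac)
    have "((\<lambda>z. 1 + z) has_field_derivative 1) ?F"
      by (auto intro!: derivative_eq_intros)
    from has_field_derivative_Ln[THEN DERIV_chain2, OF re[OF cayley_half_plane(1)[OF z]] this]
    have d3: "((\<lambda>z. Ln (1 + z)) has_field_derivative 1 / (1 + z)) ?F"
      by (simp add: divide_inverse mult_ac)
    have dF: "(F has_field_derivative
       (0 + (- ?p / (1 - ?p * z)) - ((- 1 / (1 + z)\<^sup>2) / (1 / (1 + z) + \<i> * of_real t)) - 1 / (1 + z))) ?F"
      unfolding F_def by (intro DERIV_diff DERIV_add DERIV_const d1 d2 d3)
    have e1: "- ?p / (1 - ?p * z) = \<i> * of_real t / ?D"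
    proof -
      have "1 - ?p * z = ?D / ?A" using flow_denominator(2)[OF z, of t] A by (simp add: field_simps)
      then show ?thesis using A D by simp
    qed
    have e2: "(- 1 / (1 + z)\<^sup>2) / (1 / (1 + z) + \<i> * of_real t) = - 1 / ((1 + z) * ?D)"
      unfolding flow_denominator(4)[OF z] using D by (simp add: power2_eq_square)
    have e3: "\<i> * of_real t / ?D - - 1 / ((1 + z) * ?D) - 1 / (1 + z) = 0"
      using D by (simp add: divide_simps)
    show "(F has_field_derivative 0) (at z within ball 0 1)"
      using dF unfolding e1 e2 add_0 e3 .
  qed
  then obtain c where c: "\<And>z. norm z < 1 \<Longrightarrow> F z = c" by auto
  have "F 0 = 0" by (simp add: F_def)
  then have "F y = 0" using c[of 0] c[OF assms] by simp
  moreover have "Ln (1 / (1 + y)) = - Ln (1 + y)"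
    using Ln_inverse[OF re[OF cayley_half_plane(1)[OF assms]]] by (simp add: inverse_eq_divide)
  ultimately show ?thesis by (simp add: F_def diff_eq_eq add.commute)
qed

lemma laguerre_coef_sums:
  assumes "norm y < 1"
  shows "(\<lambda>n. laguerre_coef \<kappa> t n m * y ^ n) sums (laguerre_mult \<kappa> t y * laguerre_flow t y ^ m)"
proof -
  let ?A = "1 + \<i> * of_real t" and ?p = "- \<i> * of_real t / (1 + \<i> * of_real t)"
  have nz: "1 - ?p * y \<noteq> 0"
    using flow_denominator(1)[OF assms, of t] by (metis eq_iff_diff_eq_0 less_irrefl norm_one)
  have "(\<lambda>n. ?A powr (- of_real \<kappa>) * (hcoef \<kappa> ?p (1 / ?A\<^sup>2) n m * y ^ n)) sums
    (?A powr (- of_real \<kappa>) * ((1 - ?p * y) powr (- of_real \<kappa>) * (?p + 1 / ?A\<^sup>2 * y / (1 - ?p * y)) ^ m))"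
    by (intro sums_mult hcoef_sums flow_denominator(1) assms)
  moreover have "?A powr (- of_real \<kappa>) * (1 - ?p * y) powr (- of_real \<kappa>) = laguerre_mult \<kappa> t y"
    unfolding laguerre_mult_def Ln_flow[OF assms, symmetric]
    using nz one_plus_i_nz[of t] by (simp add: powr_def algebra_simps flip: exp_add)
  ultimately show ?thesis
    unfolding laguerre_flow_eq[OF assms]
    by (simp add: laguerre_coef_def mult.assoc[symmetric])
qed

lemma laguerre_flow_cocycle:
  assumes "norm y < 1" "norm (laguerre_flow s y) < 1"
  shows "laguerre_flow t (laguerre_flow s y) = laguerre_flow (s + t) y"
    "laguerre_mult \<kappa> s y * laguerre_mult \<kappa> t (laguerre_flow s y) = laguerre_mult \<kappa> (s + t) y"
proof -
  have "1 / (1 + laguerre_flow s y) = 1 / (1 + y) + \<i> * of_real s"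
    by (simp add: laguerre_flow_def)
  then show "laguerre_flow t (laguerre_flow s y) = laguerre_flow (s + t) y"
    "laguerre_mult \<kappa> s y * laguerre_mult \<kappa> t (laguerre_flow s y) = laguerre_mult \<kappa> (s + t) y"
    unfolding laguerre_flow_def[of t] laguerre_flow_def[of "s + t"] laguerre_mult_def
    by (simp_all add: algebra_simps flip: exp_add)
qed

text \<open>The flow maps the disc of radius 1/4 into one of radius q < 1, which yields the decay in
  m; Cauchy's estimate at the same radius yields the growth \<open>4 ^ n\<close>.\<close>

lemma laguerre_coef_norm_bound:
  assumes \<kappa>: "\<kappa> > 0"
  obtains C q where "C \<ge> 0" "0 \<le> q" "q < 1"
    "\<And>n m. norm (laguerre_coef \<kappa> t n m) \<le> C * q ^ m * 4 ^ n"
    "\<And>y. norm y \<le> 1 / 4 \<Longrightarrow> norm (laguerre_flow t y) \<le> q"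
proof -
  let ?A = "1 + \<i> * of_real t" and ?p = "- \<i> * of_real t / (1 + \<i> * of_real t)"
  define X where "X = norm ?p"
  define Y where "Y = norm (1 / ?A\<^sup>2)"
  define q where "q = X + Y * (1 / 4) / (1 - X * (1 / 4))"
  have N: "(norm ?A)\<^sup>2 = 1 + t\<^sup>2" by (rule norm_one_plus_i)
  then have N0: "(norm ?A)\<^sup>2 > 0" by (simp add: add_pos_nonneg)
  have X2: "X\<^sup>2 = t\<^sup>2 / (1 + t\<^sup>2)" by (simp add: X_def norm_mult norm_divide power_divide N)
  have Y: "Y = 1 / (1 + t\<^sup>2)" by (simp add: Y_def norm_divide norm_power N)
  have XY: "Y = 1 - X\<^sup>2" unfolding X2 Y using N0 N by (simp add: field_simps)
  have X0: "X \<ge> 0" by (simp add: X_def)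
  have Y0: "Y > 0" using N N0 by (simp add: Y)
  then have "X\<^sup>2 < 1" using XY by simp
  then have X1: "X < 1" using X0 by (simp add: power2_less_1_iff)
  \<comment> \<open>A radius r works when \<open>(1 + X) * r < 1 - X * r\<close>. As X < 1, any r up
    to 1/3 does, so 1/4 serves every t.\<close>
  have "Y * (1 / 4) < (1 - X) * (1 - X * (1 / 4))"
  proof -
    have "Y * (1 / 4) = (1 - X) * ((1 + X) / 4)" by (simp add: XY algebra_simps power2_eq_square)
    also have "\<dots> < (1 - X) * (1 - X * (1 / 4))" using X1 by (intro mult_strict_left_mono) auto
    finally show ?thesis .
  qed
  then have q1: "q < 1" using X1 by (simp add: q_def field_simps)
  have q0: "q \<ge> 0" unfolding q_def using X0 X1 Y0 by (intro add_nonneg_nonneg divide_nonneg_nonneg) auto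
  define C where "C = norm (?A powr (- of_real \<kappa>)) * (1 - X * (1 / 4)) powr (- \<kappa>)"
  have "norm (laguerre_coef \<kappa> t n m) \<le> C * q ^ m * 4 ^ n" for n m
    using mult_left_mono[OF hcoef_norm_bound[OF \<kappa> X_def[symmetric] Y_def[symmetric], of "1/4" n m],
        of "norm (?A powr (- of_real \<kappa>))"] X1
    unfolding laguerre_coef_def norm_mult C_def q_def by (simp add: mult.assoc)
  moreover have "norm (laguerre_flow t y) \<le> q" if "norm y \<le> 1 / 4" for y
  proof -
    have y: "norm y < 1" using that by simp
    have "norm (?p * y) \<le> X * (1 / 4)"
      unfolding norm_mult[of ?p] X_def using that by (intro mult_left_mono) auto
    then have "1 - X * (1 / 4) \<le> 1 - norm (?p * y)" by simp
    also have "\<dots> \<le> norm (1 - ?p * y)" using norm_triangle_ineq2[of 1 "?p * y"] by simp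
    finally have d: "1 - X * (1 / 4) \<le> norm (1 - ?p * y)" .
    have "norm (laguerre_flow t y) \<le> norm ?p + norm (1 / ?A\<^sup>2 * y / (1 - ?p * y))"
      unfolding laguerre_flow_eq[OF y, symmetric] by (rule norm_triangle_ineq)
    also have "norm (1 / ?A\<^sup>2 * y / (1 - ?p * y)) = Y * norm y / norm (1 - ?p * y)"
      by (simp only: norm_divide[of _ "1 - ?p * y"] norm_mult[of _ y] Y_def)
    also have "\<dots> \<le> Y * (1 / 4) / (1 - X * (1 / 4))"
      using d that X1 Y0 by (intro frac_le mult_left_mono) auto
    finally show ?thesis by (simp add: q_def X_def)
  qed
  moreover have "C \<ge> 0" by (simp add: C_def)
  ultimately show ?thesis using q0 q1 by (intro that[of C q])
qed

text \<open>Multiplying by \<open>z ^ n\<close> and summing over n turns the sum over k into the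
  series for t evaluated at \<open>laguerre_flow s z\<close>. The cocycle law identifies the result,
  and coefficients are compared near 0.\<close>

lemma laguerre_coef_mult:
  assumes \<kappa>: "\<kappa> > 0"
  shows "(\<lambda>k. laguerre_coef \<kappa> s n k * laguerre_coef \<kappa> t k m) sums laguerre_coef \<kappa> (s + t) n m"
    and "summable (\<lambda>k. norm (laguerre_coef \<kappa> s n k * laguerre_coef \<kappa> t k m))"
proof -
  let ?S = "laguerre_coef \<kappa> s" and ?T = "laguerre_coef \<kappa> t"
  obtain C q where C: "C \<ge> 0" "0 \<le> q" "q < 1"
    "\<And>n m. norm (?S n m) \<le> C * q ^ m * 4 ^ n"
    "\<And>y. norm y \<le> 1 / 4 \<Longrightarrow> norm (laguerre_flow s y) \<le> q"
    by (rule laguerre_coef_norm_bound[OF \<kappa>, where t = s]) (rule that)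
  define b where "b k = q ^ k * norm (?T k m)" for k
  have b: "summable b"
  proof -
    \<comment> \<open>A point strictly between q and 1, where the series for \<open>?T\<close> still
      converges; hence absolute convergence at q.\<close>
    have n: "norm (complex_of_real ((1 + q) / 2)) < 1" "norm (complex_of_real q) < norm (complex_of_real ((1 + q) / 2))"
      unfolding norm_of_real using C(2,3) by auto
    have "summable (\<lambda>k. norm (?T k m * (of_real q) ^ k))"
      by (rule powser_insidea[OF sums_summable[OF laguerre_coef_sums[OF n(1)]] n(2)])
    then show ?thesis using C(2) by (simp add: b_def[abs_def] norm_mult norm_power mult.commute)
  qed
  have b0: "b k \<ge> 0" for k using C(2) by (simp add: b_def)
  have bd: "norm (?S n k * ?T k m) \<le> (C * 4 ^ n) * b k" for n k
    using mult_right_mono[OF C(4)[of n k] norm_ge_zero[of "?T k m"]]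
    by (simp add: b_def norm_mult mult_ac)
  show abs: "summable (\<lambda>k. norm (?S n k * ?T k m))" for n
    by (rule summable_comparison_test'[OF summable_mult[OF b, of "C * 4 ^ n"], of 0]) (use bd in auto)
  define B where "B n = (\<Sum>k. ?S n k * ?T k m)" for n
  have Bn: "norm (B n) \<le> (C * suminf b) * 4 ^ n" for n
  proof -
    have "norm (B n) \<le> (\<Sum>k. norm (?S n k * ?T k m))" unfolding B_def by (rule summable_norm[OF abs])
    also have "\<dots> \<le> (\<Sum>k. (C * 4 ^ n) * b k)" by (intro suminf_le bd abs summable_mult b)
    finally show ?thesis unfolding suminf_mult[OF b] by (simp add: mult_ac)
  qed
  have "B = (\<lambda>n. laguerre_coef \<kappa> (s + t) n m)"
  \<comment> \<open>The radius 1/8 beats the growth \<open>4 ^ n\<close>, leaving the majorant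
    \<open>(1 / 2) ^ n\<close>, and is below the radius 1/4 on which the flow is controlled.\<close>
  proof (rule powser_coeff_unique[of "1 / 8"])
    fix z :: complex assume z: "norm z \<le> 1 / 8"
    have z4: "4 ^ n * norm z ^ n \<le> (1 / 2) ^ n" for n
      unfolding power_mult_distrib[symmetric] using z by (intro power_mono) auto
    have zz: "norm z < 1" "norm z \<le> 1 / 4" using z by auto
    have flow: "norm (laguerre_flow s z) < 1" using C(3) C(5)[OF zz(2)] by simp
    have sB: "summable (\<lambda>n. B n * z ^ n)"
    proof (rule summable_comparison_test'[of "\<lambda>n. (C * suminf b) * (1 / 2) ^ n" 0])
      fix n
      have "norm (B n * z ^ n) \<le> ((C * suminf b) * 4 ^ n) * norm z ^ n"
        unfolding norm_mult norm_power by (intro mult_right_mono Bn) auto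
      also have "\<dots> \<le> (C * suminf b) * (1 / 2) ^ n"
        unfolding mult.assoc using C(1) z4[of n] suminf_nonneg[OF b b0] by (intro mult_left_mono) auto
      finally show "norm (B n * z ^ n) \<le> (C * suminf b) * (1 / 2) ^ n" .
    qed (intro summable_mult summable_geometric, simp)
    have "(\<Sum>n. B n * z ^ n) = (\<Sum>n. \<Sum>k. ?S n k * ?T k m * z ^ n)"
      unfolding B_def by (simp add: suminf_mult2[OF summable_norm_cancel[OF abs]])
    also have "\<dots> = (\<Sum>k. \<Sum>n. ?S n k * ?T k m * z ^ n)"
    proof (rule suminf_swap_dominated[where a = "\<lambda>n. C * (1 / 2) ^ n" and b = b])
      fix n k
      have "norm (?S n k * ?T k m * z ^ n) \<le> ((C * 4 ^ n) * b k) * norm z ^ n"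
        unfolding norm_mult[of _ "z ^ n"] norm_power by (intro mult_right_mono bd) auto
      also have "\<dots> = C * b k * (4 ^ n * norm z ^ n)" by (simp add: mult_ac)
      also have "\<dots> \<le> C * b k * (1 / 2) ^ n" using C(1) z4[of n] b0[of k] by (intro mult_left_mono) auto
      finally show "norm (?S n k * ?T k m * z ^ n) \<le> C * (1 / 2) ^ n * b k" by (simp add: mult_ac)
    qed (use C(1) b b0 in \<open>auto intro!: summable_mult summable_geometric\<close>)
    also have "(\<lambda>k. \<Sum>n. ?S n k * ?T k m * z ^ n) = (\<lambda>k. laguerre_mult \<kappa> s z * (?T k m * laguerre_flow s z ^ k))"
    proof
      fix k
      have "(\<lambda>n. ?T k m * (?S n k * z ^ n)) sums (?T k m * (laguerre_mult \<kappa> s z * laguerre_flow s z ^ k))"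
        by (intro sums_mult laguerre_coef_sums zz)
      then show "(\<Sum>n. ?S n k * ?T k m * z ^ n) = laguerre_mult \<kappa> s z * (?T k m * laguerre_flow s z ^ k)"
        by (simp add: sums_iff mult_ac)
    qed
    also have "suminf \<dots> = laguerre_mult \<kappa> s z * (laguerre_mult \<kappa> t (laguerre_flow s z) * laguerre_flow t (laguerre_flow s z) ^ m)"
      using sums_mult[OF laguerre_coef_sums[OF flow, of \<kappa> t m], of "laguerre_mult \<kappa> s z"] by (simp add: sums_iff)
    also have "\<dots> = laguerre_mult \<kappa> (s + t) z * laguerre_flow (s + t) z ^ m"
      using laguerre_flow_cocycle[OF zz(1) flow] by (simp add: mult.assoc[symmetric])
    finally show "summable (\<lambda>n. B n * z ^ n) \<and> summable (\<lambda>n. laguerre_coef \<kappa> (s + t) n m * z ^ n) \<and>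
       (\<Sum>n. B n * z ^ n) = (\<Sum>n. laguerre_coef \<kappa> (s + t) n m * z ^ n)"
      using sB laguerre_coef_sums[OF zz(1), of \<kappa> "s + t" m] by (simp add: sums_iff)
  qed simp
  then have "(\<Sum>k. ?S n k * ?T k m) = laguerre_coef \<kappa> (s + t) n m" unfolding B_def by meson
  then show "(\<lambda>k. ?S n k * ?T k m) sums laguerre_coef \<kappa> (s + t) n m"
    using summable_norm_cancel[OF abs] by (simp add: sums_iff)
qed

text \<open>The square of the normalising constant of the n-th monomial: the negative binomial
  coefficients, generated by \<open>(1 - z) powr (- \<kappa>)\<close>.\<close>

definition nb_weight :: "real \<Rightarrow> nat \<Rightarrow> real" where
  "nb_weight \<kappa> n = pochhammer \<kappa> n / fact n"

lemma nb_weight_pos: "\<kappa> > 0 \<Longrightarrow> nb_weight \<kappa> n > 0"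
  by (simp add: nb_weight_def pochhammer_pos)

lemma nb_weight_Suc: "nb_weight \<kappa> (Suc n) = nb_weight \<kappa> n * ((\<kappa> + real n) / (real n + 1))"
  by (simp add: nb_weight_def pochhammer_Suc)

definition laguerre_kernel :: "real \<Rightarrow> real \<Rightarrow> nat \<Rightarrow> nat \<Rightarrow> complex" where
  "laguerre_kernel \<kappa> t n m = of_real (sqrt (nb_weight \<kappa> m / nb_weight \<kappa> n)) * laguerre_coef \<kappa> t n m"

text \<open>Each summand carries the same power of \<omega>, because (n - k) + (m - k) + 2k = n + m.
  The phase factors out and real coefficients remain.\<close>

lemma hcoef_eq_su11:
  fixes \<omega> :: complex
  assumes "\<rho>\<^sup>2 + \<sigma>\<^sup>2 = 1"
  shows "hcoef \<kappa> (\<omega> * of_real \<rho>) (- (\<omega>\<^sup>2 * of_real (\<sigma>\<^sup>2))) n m = \<omega> ^ (n + m) * of_real (su11 \<rho> \<kappa> n m)"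
proof -
  have \<Delta>: "(1 * - 1 - - \<rho> * \<rho>) / 1\<^sup>2 = - (\<sigma>\<^sup>2)" using assms by (simp add: power2_eq_square)
  have "hcoef \<kappa> (\<omega> * of_real \<rho>) (- (\<omega>\<^sup>2 * of_real (\<sigma>\<^sup>2))) n m =
     (\<Sum>k\<le>min n m. \<omega> ^ (n + m) * of_real (real (m choose k) * (pochhammer (\<kappa> + real k) (n - k) / fact (n - k)) *
       (\<rho> / 1) ^ (m - k) * (- (- \<rho>) / 1) ^ (n - k) * (- (\<sigma>\<^sup>2)) ^ k))"
    unfolding hcoef_def
  proof (intro sum.cong refl)
    fix k assume "k \<in> {..min n m}"
    then have "n + m = (n - k) + (m - k) + 2 * k" by auto
    then have "\<omega> ^ (n + m) = \<omega> ^ (n - k) * \<omega> ^ (m - k) * (\<omega>\<^sup>2) ^ k"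
      by (simp only: power_add power_mult)
    moreover have "(- (\<omega>\<^sup>2 * of_real (\<sigma>\<^sup>2))) ^ k = (\<omega>\<^sup>2) ^ k * of_real (- (\<sigma>\<^sup>2)) ^ k"
      by (simp flip: power_mult_distrib)
    ultimately show "of_nat (m choose k) * of_real (pochhammer (\<kappa> + real k) (n - k) / fact (n - k)) *
        (\<omega> * of_real \<rho>) ^ (n - k) * (\<omega> * of_real \<rho>) ^ (m - k) * (- (\<omega>\<^sup>2 * of_real (\<sigma>\<^sup>2))) ^ k =
      \<omega> ^ (n + m) * of_real (real (m choose k) * (pochhammer (\<kappa> + real k) (n - k) / fact (n - k)) *
       (\<rho> / 1) ^ (m - k) * (- (- \<rho>) / 1) ^ (n - k) * (- (\<sigma>\<^sup>2)) ^ k)"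
      by (simp add: power_mult_distrib)
  qed
  then show ?thesis
    unfolding su11_def mob_eq_sum_pochhammer[OF zero_less_one] \<Delta>
    by (simp add: sum_distrib_left)
qed

lemma laguerre_coef_eq_su11:
  fixes t :: real
  defines "\<sigma> \<equiv> 1 / sqrt (1 + t\<^sup>2)"
  obtains \<omega> where "norm \<omega> = 1"
    "\<And>n m. laguerre_coef \<kappa> t n m = (1 + \<i> * of_real t) powr (- of_real \<kappa>) * \<omega> ^ (n + m) * of_real (su11 (t * \<sigma>) \<kappa> n m)"
proof -
  let ?A = "1 + \<i> * of_real t"
  have A: "norm ?A = sqrt (1 + t\<^sup>2)" by (simp add: cmod_def)
  have pos: "1 + t\<^sup>2 > 0" by (simp add: add_pos_nonneg)
  define \<omega> where "\<omega> = - \<i> * of_real (norm ?A) / ?A"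
  have A0: "?A \<noteq> 0" by (rule one_plus_i_nz)
  have 1: "- \<i> * of_real t / ?A = \<omega> * of_real (t * \<sigma>)"
    unfolding \<omega>_def \<sigma>_def A using pos A0 by (simp add: field_simps)
  have 2: "1 / ?A\<^sup>2 = - (\<omega>\<^sup>2 * of_real (\<sigma>\<^sup>2))"
  proof -
    have "(norm ?A)\<^sup>2 * \<sigma>\<^sup>2 = 1" unfolding \<sigma>_def A using pos by (simp add: power_divide)
    then have "(complex_of_real (norm ?A))\<^sup>2 * of_real (\<sigma>\<^sup>2) = 1"
      by (simp only: of_real_power[symmetric] of_real_mult[symmetric] of_real_1)
    then show ?thesis by (simp add: \<omega>_def power_divide power_mult_distrib)
  qed
  have 3: "(t * \<sigma>)\<^sup>2 + \<sigma>\<^sup>2 = 1" using pos by (simp add: \<sigma>_def power_mult_distrib power_divide field_simps)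
  have "norm \<omega> = 1" using A0 by (simp add: \<omega>_def norm_mult norm_divide)
  moreover have "laguerre_coef \<kappa> t n m = ?A powr (- of_real \<kappa>) * \<omega> ^ (n + m) * of_real (su11 (t * \<sigma>) \<kappa> n m)" for n m
    unfolding laguerre_coef_def 1 2 hcoef_eq_su11[OF 3] by (simp add: mult.assoc)
  ultimately show ?thesis by (rule that)
qed

lemma laguerre_kernel_symmetric:
  assumes \<kappa>: "\<kappa> > 0"
  shows "laguerre_kernel \<kappa> t n m = laguerre_kernel \<kappa> t m n"
proof -
  let ?w = "nb_weight \<kappa>"
  obtain \<omega> where \<omega>: "\<And>n m. laguerre_coef \<kappa> t n m = (1 + \<i> * of_real t) powr (- of_real \<kappa>) * \<omega> ^ (n + m) *
      of_real (su11 (t * (1 / sqrt (1 + t\<^sup>2))) \<kappa> n m)"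
    by (rule laguerre_coef_eq_su11[of \<kappa> t]) (rule that)
  have w: "?w n > 0" "?w m > 0" using \<kappa> by (simp_all add: nb_weight_pos)
  have "sqrt (?w m / ?w n) * x = sqrt (?w n / ?w m) * y" if "?w m * x = ?w n * y" for x y
  proof -
    have "sqrt (?w m / ?w n) = ?w m / sqrt (?w m * ?w n)" "sqrt (?w n / ?w m) = ?w n / sqrt (?w m * ?w n)"
      using w by (simp_all add: real_sqrt_divide real_sqrt_mult real_div_sqrt field_simps)
    then show ?thesis using that by (simp add: field_simps)
  qed
  from this[OF su11_symmetric[of \<kappa> m "t * (1 / sqrt (1 + t\<^sup>2))" n, folded nb_weight_def]]
  have "of_real (sqrt (?w m / ?w n)) * complex_of_real (su11 (t * (1 / sqrt (1 + t\<^sup>2))) \<kappa> n m) =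
        of_real (sqrt (?w n / ?w m)) * of_real (su11 (t * (1 / sqrt (1 + t\<^sup>2))) \<kappa> m n)"
    by (simp only: of_real_mult[symmetric])
  then show ?thesis unfolding laguerre_kernel_def \<omega> by (simp add: add.commute mult_ac)
qed

text \<open>Weighted symmetry replaces the square of one unsymmetric coefficient by the product of
  the entries (n, m) and (m, n). The weights disappear, and what is left has the form of the
  tensor-product bounds.\<close>

lemma norm_laguerre_kernel_square:
  fixes t :: real
  defines "\<sigma> \<equiv> 1 / sqrt (1 + t\<^sup>2)"
  assumes \<kappa>: "\<kappa> > 0"
  shows "(norm (laguerre_kernel \<kappa> t n m))\<^sup>2 =
    \<sigma> powr (2 * \<kappa>) * (su11 (t * \<sigma>) \<kappa> n m * su11 (t * \<sigma>) \<kappa> m n)"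
proof -
  let ?w = "nb_weight \<kappa>"
  obtain \<omega> where \<omega>: "norm \<omega> = 1" "\<And>n m. laguerre_coef \<kappa> t n m = (1 + \<i> * of_real t) powr (- of_real \<kappa>) * \<omega> ^ (n + m) *
      of_real (su11 (t * \<sigma>) \<kappa> n m)"
    by (rule laguerre_coef_eq_su11[of \<kappa> t, folded \<sigma>_def]) (rule that)
  have w: "?w n > 0" "?w m > 0" using \<kappa> by (simp_all add: nb_weight_pos)
  have A: "norm (1 + \<i> * of_real t) = sqrt (1 + t\<^sup>2)" by (simp add: cmod_def)
  have pos: "1 + t\<^sup>2 > 0" by (simp add: add_pos_nonneg)
  have "norm ((1 + \<i> * of_real t) powr (- of_real \<kappa>)) = sqrt (1 + t\<^sup>2) powr (- \<kappa>)"
    using norm_powr_real_powr'[of "- of_real \<kappa>" "1 + \<i> * of_real t"] by (simp add: A)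
  also have "\<dots> = \<sigma> powr \<kappa>" using pos by (simp add: \<sigma>_def powr_minus powr_divide inverse_eq_divide)
  finally have N: "norm ((1 + \<i> * of_real t) powr (- of_real \<kappa>)) = \<sigma> powr \<kappa>" .
  have "?w m * su11 (t * \<sigma>) \<kappa> n m = ?w n * su11 (t * \<sigma>) \<kappa> m n"
    unfolding nb_weight_def by (rule su11_symmetric)
  then have s: "su11 (t * \<sigma>) \<kappa> m n = ?w m / ?w n * su11 (t * \<sigma>) \<kappa> n m" using w by (simp add: field_simps)
  have "(norm (laguerre_kernel \<kappa> t n m))\<^sup>2 = (?w m / ?w n) * (\<sigma> powr \<kappa>)\<^sup>2 * (su11 (t * \<sigma>) \<kappa> n m)\<^sup>2"
    using w by (simp add: laguerre_kernel_def \<omega> norm_mult N norm_power power_mult_distrib abs_mult)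
  also have "(\<sigma> powr \<kappa>)\<^sup>2 = \<sigma> powr (2 * \<kappa>)" by (simp add: power2_eq_square flip: powr_add)
  finally show ?thesis unfolding s by (simp add: power2_eq_square mult_ac)
qed

lemma cnj_laguerre_kernel: "cnj (laguerre_kernel \<kappa> t n m) = laguerre_kernel \<kappa> (- t) n m"
proof -
  have "cnj ((1 + \<i> * of_real t) powr (- of_real \<kappa>)) = (1 + \<i> * of_real (- t)) powr (- of_real \<kappa>)"
    by (subst cnj_powr) simp_all
  then show ?thesis
    by (simp add: laguerre_kernel_def laguerre_coef_def hcoef_def)
qed

lemma laguerre_kernel_mult:
  assumes \<kappa>: "\<kappa> > 0"
  shows "(\<lambda>k. laguerre_kernel \<kappa> s n k * laguerre_kernel \<kappa> t k m) sums laguerre_kernel \<kappa> (s + t) n m"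
proof -
  let ?w = "nb_weight \<kappa>"
  have w: "?w n > 0" for n using \<kappa> by (simp add: nb_weight_pos)
  have "laguerre_kernel \<kappa> s n k * laguerre_kernel \<kappa> t k m =
     of_real (sqrt (?w m / ?w n)) * (laguerre_coef \<kappa> s n k * laguerre_coef \<kappa> t k m)" for k
  proof -
    have "sqrt (?w k / ?w n) * sqrt (?w m / ?w k) = sqrt (?w m / ?w n)"
      using w[of k] by (simp flip: real_sqrt_mult)
    then have "complex_of_real (sqrt (?w k / ?w n)) * of_real (sqrt (?w m / ?w k)) = of_real (sqrt (?w m / ?w n))"
      by (simp only: of_real_mult[symmetric])
    then show ?thesis by (simp add: laguerre_kernel_def mult_ac)
  qed
  then show ?thesis
    unfolding laguerre_kernel_def[of \<kappa> "s + t"] by (simp only:) (intro sums_mult laguerre_coef_mult \<kappa>)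
qed

lemma laguerre_kernel_0:
  assumes \<kappa>: "\<kappa> > 0"
  shows "laguerre_kernel \<kappa> 0 n m = (if n = m then 1 else 0)"
proof -
  have "hcoef \<kappa> 0 1 n m = (\<Sum>k\<le>min n m. if k = n \<and> k = m then 1 else 0)"
    unfolding hcoef_def by (intro sum.cong) (auto simp: power_0_left)
  also have "\<dots> = (if n = m then 1 else 0)"
    by (cases "n = m") (auto simp: sum.delta intro!: sum.neutral)
  finally show ?thesis using nb_weight_pos[OF \<kappa>, of m] by (simp add: laguerre_kernel_def laguerre_coef_def)
qed

section \<open>Behaviour of the kernel at t = 0\<close>

text \<open>The matrix of the discrete Laguerre operator with parameter \<open>\<alpha> = \<kappa> - 1\<close>.\<close>

definition laguerre_matrix :: "real \<Rightarrow> nat \<Rightarrow> nat \<Rightarrow> real" where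
  "laguerre_matrix \<kappa> n m =
     (if n = m then 2 * real m + \<kappa>
      else if n = Suc m then sqrt ((real m + 1) * (real m + \<kappa>))
      else if m = Suc n then sqrt ((real n + 1) * (real n + \<kappa>)) else 0)"

text \<open>The summand k has order n + m - 2k at t = 0, so only k = min n m contributes, and only
  for neighbouring or equal indices. The result is the operator in unnormalised monomials, hence not
  a symmetric matrix.\<close>

lemma laguerre_coef_deriv_0:
  "((\<lambda>t. laguerre_coef \<kappa> t n m) has_vector_derivative
     (- \<i> * of_real (if n = m then 2 * real m + \<kappa> else if n = Suc m then \<kappa> + real m else if m = Suc n then real m else 0))) (at 0)"
proof -
  let ?A = "\<lambda>w::complex. 1 + \<i> * w"
  let ?c = "\<lambda>k. of_nat (m choose k) * complex_of_real (pochhammer (\<kappa> + real k) (n - k) / fact (n - k))"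
  let ?j = "\<lambda>k. (n - k) + (m - k)"
  \<comment> \<open>At \<open>?j k = 0\<close> the truncated exponent gives
    \<open>0 ^ 0 = 1\<close>, but the factor \<open>of_nat (?j k)\<close> is then 0.\<close>
  define D where "D k = - \<i> * ?c k * ((of_real \<kappa> + 2 * of_nat k) * 0 ^ ?j k + of_nat (?j k) * 0 ^ (?j k - 1))" for k
  have dp: "((\<lambda>w. - \<i> * w / ?A w) has_field_derivative - \<i>) (at 0)"
    by (auto intro!: derivative_eq_intros)
  have dP: "((\<lambda>w. (- \<i> * w / ?A w) ^ j) has_field_derivative (of_nat j * (- \<i> * 0 ^ (j - 1)))) (at 0)" for j
    using DERIV_power[OF dp, of j] by simp
  have dB: "((\<lambda>w. 1 / (?A w)\<^sup>2) has_field_derivative - 2 * \<i>) (at 0)"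
    by (auto intro!: derivative_eq_intros)
  have dQ: "((\<lambda>w. (1 / (?A w)\<^sup>2) ^ k) has_field_derivative (of_nat k * (- 2 * \<i>))) (at 0)" for k
    using DERIV_power[OF dB, of k] by simp
  have dE: "((\<lambda>w. ?A w powr (- of_real \<kappa>)) has_field_derivative - \<i> * of_real \<kappa>) (at 0)"
    by (auto intro!: derivative_eq_intros)
  have tm: "((\<lambda>w. ?A w powr (- of_real \<kappa>) * (?c k * ((- \<i> * w / ?A w) ^ ?j k * (1 / (?A w)\<^sup>2) ^ k)))
       has_field_derivative D k) (at 0)" for k
  proof -
    have "((\<lambda>w. (- \<i> * w / ?A w) ^ ?j k * (1 / (?A w)\<^sup>2) ^ k) has_field_derivative
       (of_nat (?j k) * (- \<i> * 0 ^ (?j k - 1)) + of_nat k * (- 2 * \<i>) * 0 ^ ?j k)) (at 0)"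
      using DERIV_mult[OF dP[of "?j k"] dQ[of k]] by simp
    from DERIV_mult[OF dE DERIV_cmult[OF this, of "?c k"]]
    show ?thesis by (rule DERIV_cong) (simp add: D_def algebra_simps)
  qed
  have "((\<lambda>w. \<Sum>k\<le>min n m. ?A w powr (- of_real \<kappa>) * (?c k * ((- \<i> * w / ?A w) ^ ?j k * (1 / (?A w)\<^sup>2) ^ k)))
       has_field_derivative (\<Sum>k\<le>min n m. D k)) (at (of_real 0))"
    unfolding of_real_0 by (intro DERIV_sum tm)
  note deriv = has_vector_derivative_real_field[OF this]
  have eq: "laguerre_coef \<kappa> t n m = (\<Sum>k\<le>min n m. ?A (of_real t) powr (- of_real \<kappa>) *
      (?c k * ((- \<i> * of_real t / ?A (of_real t)) ^ ?j k * (1 / (?A (of_real t))\<^sup>2) ^ k)))" for t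
    unfolding laguerre_coef_def hcoef_def sum_distrib_left
    by (intro sum.cong refl) (simp only: power_add mult.assoc)
  have "((\<lambda>t. laguerre_coef \<kappa> t n m) has_vector_derivative (\<Sum>k\<le>min n m. D k)) (at 0)"
    unfolding eq by (rule deriv)
  moreover have "(\<Sum>k\<le>min n m. D k) = (\<Sum>k\<in>{min n m}. D k)"
  proof (rule sum.mono_neutral_right; simp?)
    show "\<forall>i\<in>{..min n m} - {min n m}. D i = 0"
    proof
      fix i assume "i \<in> {..min n m} - {min n m}"
      then have "?j i \<ge> 2" by auto
      then have "(0::complex) ^ ?j i = 0" "(0::complex) ^ (?j i - 1) = 0" by (auto simp: power_0_left)
      then show "D i = 0" unfolding D_def by (simp only: mult_zero_right add_0)
    qed
  qed
  moreover have "D (min n m) = - \<i> * of_real (if n = m then 2 * real m + \<kappa> else if n = Suc m then \<kappa> + real m else if m = Suc n then real m else 0)"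
  proof -
    consider "n = m" | "n = Suc m" | "m = Suc n" | "n \<ge> m + 2" | "m \<ge> n + 2" by linarith
    then show ?thesis by cases (auto simp: D_def power_0_left min_def algebra_simps)
  qed
  ultimately show ?thesis by simp
qed

lemma laguerre_kernel_deriv_0:
  assumes \<kappa>: "\<kappa> > 0"
  shows "((\<lambda>t. laguerre_kernel \<kappa> t n m) has_vector_derivative (- \<i> * of_real (laguerre_matrix \<kappa> n m))) (at 0)"
proof -
  let ?w = "nb_weight \<kappa>"
  let ?h = "if n = m then 2 * real m + \<kappa> else if n = Suc m then \<kappa> + real m else if m = Suc n then real m else 0"
  have w: "?w n > 0" for n using \<kappa> by (simp add: nb_weight_pos)
  have sq: "sqrt (a / b) * b = sqrt (a * b)" if "a > 0" "b > 0" for a b :: real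
    using that by (simp add: real_sqrt_divide real_sqrt_mult real_div_sqrt field_simps)
  have 1: "sqrt (?w m / ?w (Suc m)) * (\<kappa> + real m) = sqrt ((real m + 1) * (real m + \<kappa>))" for m
  proof -
    have "?w m / ?w (Suc m) = (real m + 1) / (\<kappa> + real m)"
      using w[of m] \<kappa> by (simp add: nb_weight_Suc)
    then show ?thesis using sq[of "real m + 1" "\<kappa> + real m"] \<kappa> by (simp add: add.commute)
  qed
  have 2: "sqrt (?w (Suc n) / ?w n) * (real n + 1) = sqrt ((real n + 1) * (real n + \<kappa>))" for n
  proof -
    have "?w (Suc n) / ?w n = (\<kappa> + real n) / (real n + 1)"
      using w[of n] \<kappa> by (simp add: nb_weight_Suc)
    then show ?thesis using sq[of "\<kappa> + real n" "real n + 1"] \<kappa> by (simp add: add.commute mult.commute)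
  qed
  have "sqrt (?w m / ?w n) * ?h = laguerre_matrix \<kappa> n m"
    using w[of m] 1[of m] 2[of n] by (auto simp: laguerre_matrix_def add.commute)
  then have "complex_of_real (laguerre_matrix \<kappa> n m) = of_real (sqrt (?w m / ?w n)) * of_real ?h"
    by (simp only: of_real_mult[symmetric])
  then have "- \<i> * of_real (laguerre_matrix \<kappa> n m) = of_real (sqrt (?w m / ?w n)) * (- \<i> * of_real ?h)"
    by simp
  then show ?thesis unfolding laguerre_kernel_def
    by (simp only:) (intro has_vector_derivative_mult_right laguerre_coef_deriv_0)
qed

text \<open>On the diagonal the powers of \<open>\<i> t\<close> pair up, so all that is complex is
  one power of \<open>1 + \<i> t\<close>; the rest is a real polynomial in
  \<open>t\<^sup>2\<close>.\<close>

lemma laguerre_kernel_diagonal: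
  assumes "\<kappa> > 0"
  shows "laguerre_kernel \<kappa> t m m = (1 + \<i> * of_real t) powr (- of_real (\<kappa> + 2 * real m)) *
    of_real (\<Sum>k\<le>m. real (m choose k) * (pochhammer (\<kappa> + real k) (m - k) / fact (m - k)) * (- (t\<^sup>2)) ^ (m - k))"
proof -
  let ?A = "1 + \<i> * of_real t"
  have A: "?A \<noteq> 0" by (rule one_plus_i_nz)
  have "(- \<i> * of_real t / ?A) ^ (m - k) * (- \<i> * of_real t / ?A) ^ (m - k) * (1 / ?A\<^sup>2) ^ k =
      of_real (- (t\<^sup>2)) ^ (m - k) / (?A\<^sup>2) ^ m" if "k \<le> m" for k
  proof -
    have 1: "(- \<i> * of_real t / ?A) * (- \<i> * of_real t / ?A) = of_real (- (t\<^sup>2)) * (1 / ?A\<^sup>2)"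
    proof -
      have "(- \<i> * of_real t) * (- \<i> * of_real t) = complex_of_real (- (t\<^sup>2))"
        by (simp add: complex_eq_iff power2_eq_square)
      then show ?thesis unfolding times_divide_times_eq by (simp only:) (simp add: power2_eq_square)
    qed
    have "(- \<i> * of_real t / ?A) ^ (m - k) * (- \<i> * of_real t / ?A) ^ (m - k) =
       of_real (- (t\<^sup>2)) ^ (m - k) * (1 / ?A\<^sup>2) ^ (m - k)"
      by (simp only: power_mult_distrib[symmetric] 1)
    moreover have "(1 / ?A\<^sup>2) ^ (m - k) * (1 / ?A\<^sup>2) ^ k = (1 / ?A\<^sup>2) ^ m"
      using that by (simp only: power_add[symmetric] le_add_diff_inverse2)
    ultimately have "(- \<i> * of_real t / ?A) ^ (m - k) * (- \<i> * of_real t / ?A) ^ (m - k) * (1 / ?A\<^sup>2) ^ k =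
       of_real (- (t\<^sup>2)) ^ (m - k) * (1 / ?A\<^sup>2) ^ m"
      by (simp only: mult.assoc)
    then show ?thesis by (simp add: power_divide)
  qed
  then have "hcoef \<kappa> (- \<i> * of_real t / ?A) (1 / ?A\<^sup>2) m m =
     (\<Sum>k\<le>m. of_real (real (m choose k) * (pochhammer (\<kappa> + real k) (m - k) / fact (m - k))) *
        (of_real (- (t\<^sup>2)) ^ (m - k) / (?A\<^sup>2) ^ m))"
    unfolding hcoef_def by (intro sum.cong) (auto simp: mult.assoc)
  also have "\<dots> = of_real (\<Sum>k\<le>m. real (m choose k) * (pochhammer (\<kappa> + real k) (m - k) / fact (m - k)) * (- (t\<^sup>2)) ^ (m - k)) / (?A\<^sup>2) ^ m"
    by (simp add: sum_divide_distrib)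
  finally have h: "hcoef \<kappa> (- \<i> * of_real t / ?A) (1 / ?A\<^sup>2) m m = \<dots>" .
  have "- complex_of_real (\<kappa> + 2 * real m) = - of_real \<kappa> - of_nat (2 * m)" by simp
  then have e: "?A powr (- of_real (\<kappa> + 2 * real m)) = ?A powr (- of_real \<kappa>) / (?A\<^sup>2) ^ m"
    using powr_nat'[of ?A "2 * m"] A by (simp only: powr_diff power_mult simp_thms)
  have "nb_weight \<kappa> m / nb_weight \<kappa> m = 1" using nb_weight_pos[OF assms, of m] by simp
  then show ?thesis
    unfolding laguerre_kernel_def laguerre_coef_def h e
    by (simp only: real_sqrt_one of_real_1 mult_1_left times_divide_eq_right times_divide_eq_left)
qed

lemma Re_powr_second_order:
  "((\<lambda>t. (1 - Re ((1 + \<i> * of_real t) powr (- of_real \<mu>))) / t\<^sup>2) \<longlongrightarrow> \<mu> * (\<mu> + 1) / 2) (at 0)"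
proof -
  have pd: "((\<lambda>t. (1 + \<i> * of_real t) powr (- of_real \<mu>)) has_vector_derivative
      (- \<i> * of_real \<mu> * (1 + \<i> * of_real t) powr (- of_real (\<mu> + 1)))) (at t)" for \<mu> t
  proof -
    have nr: "1 + \<i> * of_real t \<notin> \<real>\<^sub>\<le>\<^sub>0" by (simp add: complex_nonpos_Reals_iff)
    have "((\<lambda>w. (1 + \<i> * w) powr (- of_real \<mu>)) has_field_derivative
      (- of_real \<mu> * (1 + \<i> * of_real t) powr (- of_real \<mu> - 1)) * \<i>) (at (of_real t))"
      by (rule DERIV_chain2[where g = "\<lambda>w. 1 + \<i> * w" and x = "of_real t", OF has_field_derivative_powr[OF nr]]) (auto intro!: derivative_eq_intros)
    from has_vector_derivative_real_field[OF this] show ?thesis by (simp add: mult_ac)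
  qed
  let ?f = "\<lambda>\<mu> t. (1 + \<i> * of_real t) powr (- of_real \<mu>)"
  have dRe: "((\<lambda>t. 1 - Re (?f \<mu> t)) has_real_derivative - (\<mu> * Im (?f (\<mu> + 1) t))) (at t)" for t
    using has_vector_derivative_diff[OF has_vector_derivative_const[of 1] bounded_linear.has_vector_derivative[OF bounded_linear_Re pd[of \<mu> t]]]
    by (simp add: has_real_derivative_iff_has_vector_derivative)
  have dIm: "((\<lambda>t. Im (?f (\<mu> + 1) t)) has_real_derivative - (\<mu> + 1)) (at 0)"
    using bounded_linear.has_vector_derivative[OF bounded_linear_Im pd[of "\<mu> + 1" 0]]
    by (simp add: has_real_derivative_iff_has_vector_derivative)
  show ?thesis
  proof (rule lhopital)
    show "((\<lambda>t. 1 - Re (?f \<mu> t)) \<longlongrightarrow> 0) (at 0)"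
      using DERIV_isCont[OF dRe[of 0]] by (simp add: isCont_def)
    show "((\<lambda>t::real. t\<^sup>2) \<longlongrightarrow> 0) (at 0)" by (auto intro!: tendsto_eq_intros)
    show "eventually (\<lambda>t::real. t\<^sup>2 \<noteq> 0) (at 0)" "eventually (\<lambda>t::real. 2 * t \<noteq> 0) (at 0)"
      by (simp_all add: eventually_at_filter)
    show "eventually (\<lambda>t. ((\<lambda>t. 1 - Re (?f \<mu> t)) has_real_derivative - (\<mu> * Im (?f (\<mu> + 1) t))) (at t)) (at 0)"
      using dRe by simp
    show "eventually (\<lambda>t::real. ((\<lambda>t. t\<^sup>2) has_real_derivative 2 * t) (at t)) (at 0)"
      by (intro always_eventually allI) (auto intro!: derivative_eq_intros)
    have "((\<lambda>t. (- \<mu> / 2) * (Im (?f (\<mu> + 1) t) / t)) \<longlongrightarrow> (- \<mu> / 2) * - (\<mu> + 1)) (at 0)"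
      using dIm by (intro tendsto_mult tendsto_const) (simp add: has_field_derivative_iff)
    moreover have "(- \<mu> / 2) * - (\<mu> + 1) = \<mu> * (\<mu> + 1) / 2" by (simp add: field_simps)
    moreover have "- \<mu> / 2 * (x / t) = - (\<mu> * x) / (2 * t)" for x t by simp
    ultimately show "((\<lambda>t. - (\<mu> * Im (?f (\<mu> + 1) t)) / (2 * t)) \<longlongrightarrow> \<mu> * (\<mu> + 1) / 2) (at 0)"
      by (simp only:)
  qed
qed

text \<open>The quotient is the squared norm of the difference quotient of the group at the m-th
  basis vector, and the limit is the squared norm of the m-th column of the operator. Convergence of
  norms is what upgrades entrywise convergence to norm convergence in
  \<open>generator_basis\<close>.\<close>

lemma laguerre_kernel_second_order:
  assumes \<kappa>: "\<kappa> > 0"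
  shows "((\<lambda>t. (2 - 2 * Re (laguerre_kernel \<kappa> t m m)) / t\<^sup>2) \<longlongrightarrow>
     (2 * real m + \<kappa>)\<^sup>2 + real m * (real m + \<kappa> - 1) + (real m + 1) * (real m + \<kappa>)) (at 0)"
proof -
  let ?\<mu> = "\<kappa> + 2 * real m"
  define P where "P u = (\<Sum>k\<le>m. real (m choose k) * (pochhammer (\<kappa> + real k) (m - k) / fact (m - k)) * (- u) ^ (m - k))" for u :: real
  have "(\<Sum>k\<le>m. real (m choose k) * (pochhammer (\<kappa> + real k) (m - k) / fact (m - k)) * 0 ^ (m - k)) =
      (\<Sum>k\<in>{m}. real (m choose k) * (pochhammer (\<kappa> + real k) (m - k) / fact (m - k)) * 0 ^ (m - k))"
    by (rule sum.mono_neutral_right) auto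
  then have P0: "P 0 = 1" by (simp add: P_def)
  have "(P has_real_derivative (\<Sum>k\<le>m. real (m choose k) * (pochhammer (\<kappa> + real k) (m - k) / fact (m - k)) *
      (real (m - k) * (- 0) ^ (m - k - 1) * (- 1)))) (at 0)"
    unfolding P_def by (intro DERIV_sum DERIV_cmult) (auto intro!: derivative_eq_intros)
  moreover have "(\<Sum>k\<le>m. real (m choose k) * (pochhammer (\<kappa> + real k) (m - k) / fact (m - k)) *
      (real (m - k) * (- 0) ^ (m - k - 1) * (- 1))) = - (real m * (\<kappa> + real m - 1))"
  proof (cases m)
    case (Suc l)
    have "(\<Sum>k\<le>m. real (m choose k) * (pochhammer (\<kappa> + real k) (m - k) / fact (m - k)) *
      (real (m - k) * (- 0) ^ (m - k - 1) * (- 1))) = (\<Sum>k\<in>{l}. real (m choose k) * (pochhammer (\<kappa> + real k) (m - k) / fact (m - k)) *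
      (real (m - k) * (- 0) ^ (m - k - 1) * (- 1)))"
      by (rule sum.mono_neutral_right) (auto simp: Suc power_0_left)
    then show ?thesis by (simp add: Suc)
  qed simp
  ultimately have dP: "(P has_real_derivative - (real m * (\<kappa> + real m - 1))) (at 0)" by simp
  have sq: "filterlim (\<lambda>t::real. t\<^sup>2) (at 0) (at 0)"
    by (auto simp: filterlim_at eventually_at_filter intro!: tendsto_eq_intros)
  have "((\<lambda>u. (P u - 1) / u) \<longlongrightarrow> - (real m * (\<kappa> + real m - 1))) (at 0)"
    using dP P0 by (simp add: has_field_derivative_iff)
  from filterlim_compose[OF this sq]
  have l1: "((\<lambda>t. (P (t\<^sup>2) - 1) / t\<^sup>2) \<longlongrightarrow> - (real m * (\<kappa> + real m - 1))) (at 0)" by simp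
  have "(P \<longlongrightarrow> 1) (at 0)" using DERIV_isCont[OF dP] P0 by (simp add: isCont_def)
  from filterlim_compose[OF this sq] have l2: "((\<lambda>t. P (t\<^sup>2)) \<longlongrightarrow> 1) (at 0)" by simp
  have "((\<lambda>t. 2 * ((1 - Re ((1 + \<i> * of_real t) powr (- of_real ?\<mu>))) / t\<^sup>2) * P (t\<^sup>2) - 2 * ((P (t\<^sup>2) - 1) / t\<^sup>2)) \<longlongrightarrow>
      2 * (?\<mu> * (?\<mu> + 1) / 2) * 1 - 2 * (- (real m * (\<kappa> + real m - 1)))) (at 0)"
    by (intro tendsto_intros Re_powr_second_order l1 l2)
  moreover have "2 * ((1 - Re ((1 + \<i> * of_real t) powr (- of_real ?\<mu>))) / t\<^sup>2) * P (t\<^sup>2) - 2 * ((P (t\<^sup>2) - 1) / t\<^sup>2) =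
      (2 - 2 * Re (laguerre_kernel \<kappa> t m m)) / t\<^sup>2" for t
  proof -
    have "Re (x * of_real q) = Re x * q" for x q by simp
    then have "Re (laguerre_kernel \<kappa> t m m) = Re ((1 + \<i> * of_real t) powr (- of_real ?\<mu>)) * P (t\<^sup>2)"
      unfolding laguerre_kernel_diagonal[OF \<kappa>] P_def by (simp only:)
    then show ?thesis by (simp only:) (simp add: diff_divide_distrib algebra_simps)
  qed
  moreover have "2 * (?\<mu> * (?\<mu> + 1) / 2) * 1 - 2 * (- (real m * (\<kappa> + real m - 1))) =
     (2 * real m + \<kappa>)\<^sup>2 + real m * (real m + \<kappa> - 1) + (real m + 1) * (real m + \<kappa>)"
    by (simp add: power2_eq_square algebra_simps)
  ultimately show ?thesis by simp
qed

section \<open>The Hilbert space of square-summable sequences\<close>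

lemma ell2_scale: "u \<in> ell2 \<Longrightarrow> (\<lambda>n. c * u n) \<in> ell2"
  unfolding ell2_def by (simp add: norm_mult power_mult_distrib summable_mult)

lemma ell2_add:
  assumes "u \<in> ell2" "v \<in> ell2" shows "(\<lambda>n. u n + v n) \<in> ell2"
proof -
  have "summable (\<lambda>n. 2 * (cmod (u n))\<^sup>2 + 2 * (cmod (v n))\<^sup>2)"
    using assms unfolding ell2_def by (auto intro!: summable_add summable_mult)
  moreover have "norm ((cmod (x + y))\<^sup>2) \<le> 2 * (cmod x)\<^sup>2 + 2 * (cmod y)\<^sup>2" for x y
  proof -
    have "(cmod (x + y))\<^sup>2 \<le> (cmod x + cmod y)\<^sup>2" by (intro power_mono norm_triangle_ineq) simp
    also have "\<dots> \<le> 2 * (cmod x)\<^sup>2 + 2 * (cmod y)\<^sup>2"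
      using sum_squares_bound[of "cmod x" "cmod y"] by (simp add: power2_sum)
    finally show ?thesis by simp
  qed
  ultimately show ?thesis unfolding ell2_def by (simp add: summable_comparison_test')
qed

lemma ell2_mult_summable:
  assumes "u \<in> ell2" "v \<in> ell2" shows "summable (\<lambda>n. cmod (u n) * cmod (v n))"
proof -
  have "summable (\<lambda>n. (cmod (u n))\<^sup>2 + (cmod (v n))\<^sup>2)"
    using assms unfolding ell2_def by (auto intro!: summable_add)
  moreover have "norm (cmod x * cmod y) \<le> (cmod x)\<^sup>2 + (cmod y)\<^sup>2" for x y
  proof -
    have "2 * cmod x * cmod y \<le> (cmod x)\<^sup>2 + (cmod y)\<^sup>2" by (rule sum_squares_bound)
    moreover have "0 \<le> cmod x * cmod y" by simp
    ultimately show ?thesis by (simp only: real_norm_def abs_of_nonneg)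
  qed
  ultimately show ?thesis by (rule summable_comparison_test'[of _ 0])
qed

text \<open>As a type in the class of real inner product spaces, the sequences inherit limits and
  vector derivatives in a real variable; the complex structure is added by \<open>cscale\<close> and
  \<open>cinner\<close>.\<close>

typedef l2 = ell2 morphisms coord Abs_l2
  by (rule exI[of _ "\<lambda>_. 0"]) (simp add: ell2_def)

setup_lifting type_definition_l2

lemma l2_eqI: "(\<And>n. coord x n = coord y n) \<Longrightarrow> x = y"
  by (simp add: coord_inject[symmetric] fun_eq_iff)

lemma coord_summable_inner: "summable (\<lambda>n. inner (coord x n) (coord y n))"
proof (rule summable_comparison_test'[OF ell2_mult_summable[OF coord coord], of 0])
  show "norm (inner (coord x n) (coord y n)) \<le> cmod (coord x n) * cmod (coord y n)" for n
    using Cauchy_Schwarz_ineq2[of "coord x n" "coord y n"] by simp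
qed

instantiation l2 :: real_vector
begin

lift_definition zero_l2 :: l2 is "\<lambda>_. 0" by (simp add: ell2_def)
lift_definition plus_l2 :: "l2 \<Rightarrow> l2 \<Rightarrow> l2" is "\<lambda>u v n. u n + v n" by (rule ell2_add)
lift_definition uminus_l2 :: "l2 \<Rightarrow> l2" is "\<lambda>u n. - u n" by (simp add: ell2_def)
lift_definition minus_l2 :: "l2 \<Rightarrow> l2 \<Rightarrow> l2" is "\<lambda>u v n. u n - v n"
  using ell2_add[OF _ ell2_scale[of _ "-1"]] by simp
lift_definition scaleR_l2 :: "real \<Rightarrow> l2 \<Rightarrow> l2" is "\<lambda>r u n. of_real r * u n" by (rule ell2_scale)

lemmas coord_simps [simp] = zero_l2.rep_eq plus_l2.rep_eq uminus_l2.rep_eq minus_l2.rep_eq scaleR_l2.rep_eq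

instance by intro_classes (auto intro!: l2_eqI simp: algebra_simps)

end

instantiation l2 :: real_inner
begin

definition inner_l2 :: "l2 \<Rightarrow> l2 \<Rightarrow> real" where
  "inner_l2 x y = (\<Sum>n. inner (coord x n) (coord y n))"
definition norm_l2 :: "l2 \<Rightarrow> real" where "norm_l2 (x :: l2) = sqrt (inner x x)"
definition dist_l2 :: "l2 \<Rightarrow> l2 \<Rightarrow> real" where "dist_l2 x y = norm (x - y)"
definition sgn_l2 :: "l2 \<Rightarrow> l2" where "sgn_l2 x = x /\<^sub>R norm x"
definition uniformity_l2 :: "(l2 \<times> l2) filter" where
  "uniformity_l2 = (INF e\<in>{0<..}. principal {(x, y). dist x y < e})"
definition open_l2 :: "l2 set \<Rightarrow> bool" where
  "open_l2 S = (\<forall>x\<in>S. \<forall>\<^sub>F (x', y) in uniformity. x' = x \<longrightarrow> y \<in> S)"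

instance
proof
  fix x y z :: l2 and r s :: real and S :: "l2 set"
  show "dist x y = norm (x - y)" "sgn x = x /\<^sub>R norm x" "norm x = sqrt (inner x x)"
    "uniformity = (INF e\<in>{0<..}. principal {(x, y :: l2). dist x y < e})"
    "open S = (\<forall>x\<in>S. \<forall>\<^sub>F (x', y) in uniformity. x' = x \<longrightarrow> y \<in> S)"
    by (rule dist_l2_def sgn_l2_def norm_l2_def uniformity_l2_def open_l2_def)+
  show "inner x y = inner y x" by (simp add: inner_l2_def inner_commute)
  show "inner (x + y) z = inner x z + inner y z"
    by (simp add: inner_l2_def plus_l2.rep_eq inner_add_left suminf_add coord_summable_inner)
  show "inner (r *\<^sub>R x) y = r * inner x y"
  proof -
    have "inner (of_real r * a) b = r * inner a b" for a b :: complex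
      by (simp add: scaleR_conv_of_real[symmetric])
    then show ?thesis by (simp add: inner_l2_def scaleR_l2.rep_eq suminf_mult coord_summable_inner)
  qed
  show "0 \<le> inner x x" unfolding inner_l2_def by (rule suminf_nonneg[OF coord_summable_inner]) simp
  show "inner x x = 0 \<longleftrightarrow> x = 0"
  proof
    assume "inner x x = 0"
    then have "\<forall>n. inner (coord x n) (coord x n) = 0"
      unfolding inner_l2_def by (subst (asm) suminf_eq_zero_iff[OF coord_summable_inner]) auto
    then show "x = 0" by (simp add: zero_l2.rep_eq coord_inject[symmetric] fun_eq_iff)
  qed (simp add: inner_l2_def zero_l2.rep_eq)
qed

end

lemma norm_l2_eq: "norm x = ell2_norm (coord x)"
  by (simp add: norm_eq_sqrt_inner inner_l2_def ell2_norm_def power2_norm_eq_inner)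

lemma coord_sums_norm: "(\<lambda>n. (cmod (coord x n))\<^sup>2) sums (norm x)\<^sup>2"
proof -
  have "(norm x)\<^sup>2 = (\<Sum>n. (cmod (coord x n))\<^sup>2)"
    by (simp add: power2_norm_eq_inner inner_l2_def)
  then show ?thesis
    using coord_summable_inner[of x x] by (simp add: sums_iff power2_norm_eq_inner)
qed

lemma coord_sum [simp]: "coord (\<Sum>i\<in>A. f i) n = (\<Sum>i\<in>A. coord (f i) n)"
  by (induction A rule: infinite_finite_induct) simp_all

lemma sum_coord_le: "(\<Sum>n<N. (cmod (coord x n))\<^sup>2) \<le> (norm x)\<^sup>2"
  using sum_le_suminf[OF sums_summable[OF coord_sums_norm[of x]], of "{..<N}"] sums_unique[OF coord_sums_norm[of x]]
  by simp

lemma coord_le_norm: "cmod (coord x n) \<le> norm x"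
proof -
  have "(cmod (coord x n))\<^sup>2 \<le> (\<Sum>k<Suc n. (cmod (coord x k))\<^sup>2)"
    by (simp add: sum_nonneg)
  also have "\<dots> \<le> (norm x)\<^sup>2" by (rule sum_coord_le)
  finally show ?thesis by (simp add: power_mono_iff)
qed

lemma norm_le_of_partial_sums:
  assumes "C \<ge> 0" "\<And>N. (\<Sum>n<N. (cmod (coord x n))\<^sup>2) \<le> C\<^sup>2"
  shows "norm x \<le> C"
proof -
  have "(norm x)\<^sup>2 \<le> C\<^sup>2"
    by (rule sums_le[OF _ coord_sums_norm, of _ "\<lambda>_. 0"] LIMSEQ_le_const2[OF coord_sums_norm[unfolded sums_def]])
      (use assms in auto)
  then show ?thesis using assms(1) by (simp add: power2_le_iff_abs_le)
qed

lemma ell2_of_partial_sums: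
  assumes "\<And>N. (\<Sum>n<N. (cmod (u n))\<^sup>2) \<le> B"
  shows "u \<in> ell2"
  unfolding ell2_def using assms by (auto intro!: summableI_nonneg_bounded[where x = B])

lift_definition cscale :: "complex \<Rightarrow> l2 \<Rightarrow> l2" is "\<lambda>c u n. c * u n" by (rule ell2_scale)
definition basis :: "nat \<Rightarrow> l2" where
  "basis m = Abs_l2 (\<lambda>n. if n = m then 1 else 0)"

lemma coord_basis [simp]: "coord (basis m) n = (if n = m then 1 else 0)"
proof -
  have "(\<lambda>n. if n = m then 1 else 0) \<in> ell2"
    unfolding ell2_def mem_Collect_eq by (rule summable_finite[of "{m}"]) auto
  then show ?thesis by (simp add: basis_def Abs_l2_inverse)
qed

lemmas [simp] = cscale.rep_eq

lemma norm_cscale [simp]: "norm (cscale c x) = cmod c * norm x"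
proof -
  have "(\<lambda>n. (cmod c)\<^sup>2 * (cmod (coord x n))\<^sup>2) sums ((cmod c)\<^sup>2 * (norm x)\<^sup>2)"
    by (intro sums_mult coord_sums_norm)
  moreover have "(\<lambda>n. (cmod c)\<^sup>2 * (cmod (coord x n))\<^sup>2) sums (norm (cscale c x))\<^sup>2"
    using coord_sums_norm[of "cscale c x"] by (simp add: norm_mult power_mult_distrib)
  ultimately have "(norm (cscale c x))\<^sup>2 = (cmod c * norm x)\<^sup>2"
    unfolding power_mult_distrib by (rule sums_unique2[symmetric])
  then show ?thesis by (simp add: power2_eq_iff_nonneg)
qed

lemma bounded_linear_cscale: "bounded_linear (cscale c)"
  by (rule bounded_linear_intro[where K = "cmod c"])
    (auto intro!: l2_eqI simp: algebra_simps)

lemma cscale_simps: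
  "cscale c (x + y) = cscale c x + cscale c y" "cscale c (x - y) = cscale c x - cscale c y"
  "cscale c (r *\<^sub>R x) = r *\<^sub>R cscale c x" "cscale c (- x) = - cscale c x"
  "cscale c (cscale d x) = cscale (c * d) x" "cscale 1 x = x" "cscale (of_real r) x = r *\<^sub>R x"
  "cscale (- c) x = - cscale c x" "cscale c 0 = 0"
  by (auto intro!: l2_eqI simp: algebra_simps)

text \<open>The imaginary part rests on \<open>Re (cnj (\<i> * x) * y) = Im (cnj x * y)\<close>; the
  form is conjugate-linear in its first argument.\<close>

definition cinner :: "l2 \<Rightarrow> l2 \<Rightarrow> complex" where
  "cinner x y = Complex (inner x y) (inner (cscale \<i> x) y)"

lemma cinner_sums: "(\<lambda>n. cnj (coord x n) * coord y n) sums cinner x y"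
proof -
  have 1: "(\<lambda>n. inner (coord x n) (coord y n)) sums inner x y" for x y
    unfolding inner_l2_def by (rule summable_sums[OF coord_summable_inner])
  show ?thesis
    unfolding sums_complex_iff cinner_def
    using 1[of x y] 1[of "cscale \<i> x" y] by (simp add: inner_complex_def algebra_simps)
qed

lemma cinner_eq: "cinner x y = ell2_inner (coord x) (coord y)"
  using cinner_sums unfolding ell2_inner_def by (rule sums_unique)

lemma bounded_bilinear_cinner: "bounded_bilinear cinner"
proof (rule bounded_bilinear.intro)
  show "\<exists>K. \<forall>a b. norm (cinner a b) \<le> norm a * norm b * K"
  proof (intro exI allI)
    fix a b
    have "norm (cinner a b) \<le> \<bar>inner a b\<bar> + \<bar>inner (cscale \<i> a) b\<bar>"
      using cmod_le[of "cinner a b"] by (simp add: cinner_def)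
    also have "\<dots> \<le> norm a * norm b + norm (cscale \<i> a) * norm b"
      by (intro add_mono Cauchy_Schwarz_ineq2)
    finally show "norm (cinner a b) \<le> norm a * norm b * 2" by simp
  qed
qed (auto simp: cinner_def cscale_simps inner_add_left inner_add_right complex_eq_iff)

lemma Re_cinner: "Re (cinner x y) = inner x y" by (simp add: cinner_def)

lemma cinner_cscale: "cinner (cscale c x) y = cnj c * cinner x y" "cinner x (cscale c y) = c * cinner x y"
  using cinner_sums[of "cscale c x" y] sums_mult[OF cinner_sums[of x y], of "cnj c"]
    cinner_sums[of x "cscale c y"] sums_mult[OF cinner_sums[of x y], of c]
  by (auto simp: mult_ac intro: sums_unique2)

lemma cinner_commute: "cinner y x = cnj (cinner x y)"
proof -
  have "(\<lambda>n. cnj (cnj (coord x n) * coord y n)) sums cnj (cinner x y)"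
    unfolding sums_cnj by (rule cinner_sums)
  then show ?thesis using cinner_sums[of y x] by (auto simp: mult.commute intro: sums_unique2)
qed

lemma cinner_basis: "cinner (basis n) x = coord x n"
proof -
  have "(\<lambda>k. if k = n then coord x k else 0) sums coord x n" by (rule sums_single)
  moreover have "(\<lambda>k. cnj (coord (basis n) k) * coord x k) = (\<lambda>k. if k = n then coord x k else 0)" by auto
  ultimately show ?thesis using cinner_sums[of "basis n" x] by (auto intro: sums_unique2)
qed

definition truncate :: "nat \<Rightarrow> l2 \<Rightarrow> l2" where
  "truncate N x = (\<Sum>m<N. cscale (coord x m) (basis m))"

lemma coord_truncate: "coord (truncate N x) n = (if n < N then coord x n else 0)"
  by (simp add: truncate_def if_distrib cong: if_cong)

lemma truncate_tendsto: "(\<lambda>N. truncate N x) \<longlonglongrightarrow> x"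
proof -
  have "(norm (truncate N x - x))\<^sup>2 = (norm x)\<^sup>2 - (\<Sum>n<N. (cmod (coord x n))\<^sup>2)" for N
  proof -
    have "(\<lambda>n. if n \<in> {..<N} then (cmod (coord x n))\<^sup>2 else 0) sums (\<Sum>n<N. (cmod (coord x n))\<^sup>2)"
      by (rule sums_If_finite_set) simp
    from sums_diff[OF coord_sums_norm[of x] this]
    have "(\<lambda>n. (cmod (coord (truncate N x - x) n))\<^sup>2) sums ((norm x)\<^sup>2 - (\<Sum>n<N. (cmod (coord x n))\<^sup>2))"
      by (rule sums_cong[THEN iffD1, rotated]) (auto simp: coord_truncate)
    then show ?thesis using coord_sums_norm[of "truncate N x - x"] by (auto intro: sums_unique2)
  qed
  moreover have "(\<lambda>N. (norm x)\<^sup>2 - (\<Sum>n<N. (cmod (coord x n))\<^sup>2)) \<longlonglongrightarrow> (norm x)\<^sup>2 - (norm x)\<^sup>2"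
    by (intro tendsto_intros coord_sums_norm[unfolded sums_def])
  ultimately have "(\<lambda>N. (norm (truncate N x - x))\<^sup>2) \<longlonglongrightarrow> 0" by simp
  from tendsto_real_sqrt[OF this] show ?thesis by (simp add: tendsto_norm_zero_iff LIM_zero_iff)
qed

lemma eq_on_basis:
  assumes F: "bounded_linear F" "\<And>c x. F (cscale c x) = cscale c (F x)"
    and G: "bounded_linear G" "\<And>c x. G (cscale c x) = cscale c (G x)"
    and eq: "\<And>m. F (basis m) = G (basis m)"
  shows "F x = (G x :: l2)"
proof -
  have "F (truncate N x) = G (truncate N x)" for N
    unfolding truncate_def
    by (simp add: linear_sum[OF bounded_linear.linear[OF F(1)]] linear_sum[OF bounded_linear.linear[OF G(1)]] F(2) G(2) eq)
  moreover have "(\<lambda>N. F (truncate N x)) \<longlonglongrightarrow> F x" "(\<lambda>N. G (truncate N x)) \<longlonglongrightarrow> G x"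
    by (intro bounded_linear.tendsto[OF F(1)] bounded_linear.tendsto[OF G(1)] truncate_tendsto)+
  ultimately show ?thesis using LIMSEQ_unique by auto
qed

section \<open>Unitary flows\<close>

lemma cinner_truncate: "cinner (truncate N w) z = (\<Sum>n<N. cnj (coord w n) * coord z n)"
proof -
  have "(\<lambda>n. if n \<in> {..<N} then cnj (coord w n) * coord z n else 0) sums (\<Sum>n<N. cnj (coord w n) * coord z n)"
    by (rule sums_If_finite_set) simp
  moreover have "(\<lambda>n. if n \<in> {..<N} then cnj (coord w n) * coord z n else 0) = (\<lambda>n. cnj (coord (truncate N w) n) * coord z n)"
    by (auto simp: coord_truncate)
  ultimately show ?thesis using cinner_sums[of "truncate N w" z] by (auto intro: sums_unique2)
qed

text \<open>Real Cauchy-Schwarz after multiplying \<open>z\<close> by the conjugate of the inner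
  product, which makes the pairing real and nonnegative.\<close>

lemma norm_cinner_le: "norm (cinner v z) \<le> norm v * norm z"
proof -
  have "complex_of_real ((cmod (cinner v z))\<^sup>2) = cinner v (cscale (cnj (cinner v z)) z)"
    unfolding cinner_cscale by (metis complex_norm_square mult.commute)
  then have "(cmod (cinner v z))\<^sup>2 = inner v (cscale (cnj (cinner v z)) z)"
    by (metis Re_cinner Re_complex_of_real)
  also have "\<dots> \<le> norm v * (cmod (cinner v z) * norm z)"
    using norm_cauchy_schwarz[of v "cscale (cnj (cinner v z)) z"] by simp
  finally have "cmod (cinner v z) * cmod (cinner v z) \<le> cmod (cinner v z) * (norm v * norm z)"
    by (simp add: power2_eq_square mult_ac)
  then show ?thesis by (cases "cmod (cinner v z) = 0") (simp_all only: mult_le_cancel_left_pos norm_le_zero_iff zero_less_norm_iff norm_eq_zero norm_zero zero_le_mult_iff norm_ge_zero simp_thms not_False_eq_True)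
qed

lemma inner_finite_support:
  assumes "\<And>n. n \<ge> N \<Longrightarrow> coord z n = 0"
  shows "inner x z = (\<Sum>n<N. inner (coord x n) (coord z n))"
  unfolding inner_l2_def using assms by (intro suminf_finite) (auto simp: not_less)

lemma has_vector_derivative_iff_quotient:
  fixes f :: "real \<Rightarrow> 'a::real_normed_vector"
  shows "(f has_vector_derivative D) (at x) \<longleftrightarrow> ((\<lambda>h. (1 / h) *\<^sub>R (f (x + h) - f x)) \<longlongrightarrow> D) (at 0)"
proof -
  have "norm (f (x + h) - f x - h *\<^sub>R D) / norm h = norm ((1 / h) *\<^sub>R (f (x + h) - f x) - D)" if "h \<noteq> 0" for h
  proof -
    have "f (x + h) - f x - h *\<^sub>R D = h *\<^sub>R ((1 / h) *\<^sub>R (f (x + h) - f x) - D)"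
      using that by (simp add: scaleR_diff_right)
    then show ?thesis using that by simp
  qed
  then have "eventually (\<lambda>h. norm (f (x + h) - f x - h *\<^sub>R D) / norm h = norm ((1 / h) *\<^sub>R (f (x + h) - f x) - D)) (at 0)"
    by (auto simp: eventually_at_filter)
  then have "((\<lambda>h. norm (f (x + h) - f x - h *\<^sub>R D) / norm h) \<longlongrightarrow> 0) (at 0) \<longleftrightarrow>
      ((\<lambda>h. norm ((1 / h) *\<^sub>R (f (x + h) - f x) - D)) \<longlongrightarrow> 0) (at 0)"
    by (rule tendsto_cong)
  also have "\<dots> \<longleftrightarrow> ((\<lambda>h. (1 / h) *\<^sub>R (f (x + h) - f x)) \<longlongrightarrow> D) (at 0)"
    by (simp only: tendsto_norm_zero_iff LIM_zero_iff)
  finally show ?thesis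
    unfolding has_vector_derivative_def has_derivative_at by (simp add: bounded_linear_scaleR_left)
qed

locale l2_flow =
  fixes U :: "real \<Rightarrow> l2 \<Rightarrow> l2"
  assumes add: "U t (x + y) = U t x + U t y"
    and scale: "U t (cscale c x) = cscale c (U t x)"
    and isometry: "norm (U t x) = norm x"
    and zero: "U 0 x = x"
    and group: "U (s + t) x = U s (U t x)"
begin

lemma bounded_linear: "bounded_linear (U t)"
  by (rule bounded_linear_intro[where K = 1]) (simp_all add: add isometry scale flip: cscale_simps(7))

lemma diff: "U t (x - y) = U t x - U t y"
  by (rule linear_diff[OF bounded_linear.linear[OF bounded_linear]])

lemma scaleR: "U t (r *\<^sub>R x) = r *\<^sub>R U t x"
  by (rule linear_cmul[OF bounded_linear.linear[OF bounded_linear]])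

lemma inverse: "U (- t) (U t x) = x" "U t (U (- t) x) = x"
  by (simp_all add: zero flip: group)

lemma inner_preserved: "inner (U t x) (U t y) = inner x y"
proof -
  have "(norm (U t (x + y)))\<^sup>2 = (norm (x + y))\<^sup>2" by (simp add: isometry)
  then have "(norm (U t x + U t y))\<^sup>2 = (norm (x + y))\<^sup>2" by (simp add: add)
  moreover have "(norm (U t x))\<^sup>2 = (norm x)\<^sup>2" "(norm (U t y))\<^sup>2 = (norm y)\<^sup>2" by (simp_all add: isometry)
  ultimately show ?thesis
    by (simp add: power2_norm_eq_inner inner_add_left inner_add_right inner_commute)
qed

lemma cinner_preserved: "cinner (U t x) (U t y) = cinner x y"
  by (simp add: cinner_def inner_preserved flip: scale)

lemma cinner_adjoint: "cinner (U t x) y = cinner x (U (- t) y)"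
  using cinner_preserved[of "- t" "U t x" y] by (simp add: inverse)

text \<open>A relation, since the generator is only partially defined. The factor
  \<open>- \<i>\<close> makes \<open>y\<close> the image under the self-adjoint operator
  itself.\<close>

definition generator :: "l2 \<Rightarrow> l2 \<Rightarrow> bool" where
  "generator x y \<longleftrightarrow> ((\<lambda>t. (1 / t) *\<^sub>R (U t x - x)) \<longlongrightarrow> cscale (- \<i>) y) (at 0)"

lemma generator_flow:
  assumes "generator x y" shows "generator (U s x) (U s y)"
proof -
  have "((\<lambda>t. U s ((1 / t) *\<^sub>R (U t x - x))) \<longlongrightarrow> U s (cscale (- \<i>) y)) (at 0)"
    using assms unfolding generator_def by (rule bounded_linear.tendsto[OF bounded_linear])
  moreover have "U s (U t x) = U t (U s x)" for t by (simp add: add.commute flip: group)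
  ultimately show ?thesis unfolding generator_def by (simp add: scaleR diff scale)
qed

lemma generator_deriv:
  assumes "generator x y"
  shows "((\<lambda>t. U t x) has_vector_derivative cscale (- \<i>) (U s y)) (at s)"
proof -
  have "((\<lambda>t. (1 / t) *\<^sub>R (U t (U s x) - U s x)) \<longlongrightarrow> cscale (- \<i>) (U s y)) (at 0)"
    using generator_flow[OF assms] by (simp add: generator_def)
  then show ?thesis
    unfolding has_vector_derivative_iff_quotient by (simp add: add.commute[of s] flip: group)
qed

text \<open>\<open>U (- t)\<close> is the adjoint of \<open>U t\<close>, so the difference quotient
  at t in the first argument becomes minus the one at -t in the second; both converge.\<close>

lemma generator_symmetric:
  assumes "generator x y" "generator x' y'" shows "cinner y x' = cinner x y'"
proof -
  interpret B: bounded_bilinear cinner by (rule bounded_bilinear_cinner)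
  have "((\<lambda>t. cinner ((1 / t) *\<^sub>R (U t x - x)) x') \<longlongrightarrow> cinner (cscale (- \<i>) y) x') (at 0)"
    using assms unfolding generator_def by (intro B.tendsto tendsto_const)
  moreover have "filterlim uminus (at (0::real)) (at 0)"
    by (auto simp: filterlim_at eventually_at_filter intro!: tendsto_eq_intros)
  from filterlim_compose[OF assms(2)[unfolded generator_def] this]
  have "((\<lambda>t. - cinner x ((1 / (- t)) *\<^sub>R (U (- t) x' - x'))) \<longlongrightarrow> - cinner x (cscale (- \<i>) y')) (at 0)"
    by (intro tendsto_minus B.tendsto tendsto_const)
  moreover have "- cinner x ((1 / (- t)) *\<^sub>R (U (- t) x' - x')) = cinner ((1 / t) *\<^sub>R (U t x - x)) x'" for t
    by (simp add: B.scaleR_left B.scaleR_right B.diff_left B.diff_right B.minus_right cinner_adjoint)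
  ultimately have "cinner (cscale (- \<i>) y) x' = - cinner x (cscale (- \<i>) y')"
    by (intro tendsto_unique[OF _ _]) (simp_all only: trivial_limit_at not_False_eq_True)
  then show ?thesis by (simp add: cinner_cscale)
qed

end

text \<open>
  Uniqueness in Stone's theorem: the inner product of two flows with a common generator is constant.
\<close>

lemma l2_flow_unique:
  assumes U: "l2_flow U" and V: "l2_flow V"
    and gen: "\<And>x y. l2_flow.generator U x y \<longleftrightarrow> l2_flow.generator V x y"
    and dom: "\<And>m. l2_flow.generator U (basis m) (h m)"
  shows "U t x = V t x"
proof -
  interpret U: l2_flow U by (rule U)
  interpret V: l2_flow V by (rule V)
  interpret B: bounded_bilinear cinner by (rule bounded_bilinear_cinner)
  have "V t (basis m) = U t (basis m)" for m
  proof -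
    have "cinner (U s (basis n)) (V s (basis m)) = cinner (basis n) (basis m)" for n s
    proof -
      let ?f = "\<lambda>s. cinner (U s (basis n)) (V s (basis m))"
      have "(?f has_vector_derivative 0) (at s)" for s
      proof -
        have gU: "U.generator (U s (basis n)) (U s (h n))" by (intro U.generator_flow dom)
        have gV: "U.generator (V s (basis m)) (V s (h m))"
          unfolding gen by (intro V.generator_flow dom[unfolded gen])
        have "(?f has_vector_derivative (cinner (U s (basis n)) (cscale (- \<i>) (V s (h m))) +
            cinner (cscale (- \<i>) (U s (h n))) (V s (basis m)))) (at s)"
          by (intro B.has_vector_derivative U.generator_deriv V.generator_deriv dom dom[unfolded gen])
        then show ?thesis
          using U.generator_symmetric[OF gU gV] by (simp add: cinner_cscale)
      qed
      then obtain c where "\<And>s. s \<in> UNIV \<Longrightarrow> ?f s = c"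
        using has_vector_derivative_zero_constant[of UNIV ?f] by auto
      then have "?f s = ?f 0" by simp
      then show ?thesis by (simp add: U.zero V.zero)
    qed
    \<comment> \<open>Equal pairings with every \<open>U t (basis n)\<close> mean equal coordinates
      after applying \<open>U (- t)\<close>, so the two images coincide.\<close>
    then have "cinner (U t (basis n)) (V t (basis m) - U t (basis m)) = 0" for n
      by (simp add: B.diff_right U.cinner_preserved)
    then have "coord (U (- t) (V t (basis m) - U t (basis m))) n = 0" for n
      by (simp add: U.cinner_adjoint flip: cinner_basis)
    then have "U (- t) (V t (basis m) - U t (basis m)) = 0" by (intro l2_eqI) simp
    then have "norm (V t (basis m) - U t (basis m)) = 0" by (metis U.isometry norm_zero)
    then show ?thesis by simp
  qed
  from this[symmetric] show ?thesis
    by (rule eq_on_basis[OF U.bounded_linear U.scale V.bounded_linear V.scale])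
qed

section \<open>Unitary groups built from a symmetric kernel\<close>

locale kernel_group =
  fixes K :: "real \<Rightarrow> nat \<Rightarrow> nat \<Rightarrow> complex"
  assumes symmetric: "K t n m = K t m n"
    and cnj: "cnj (K t n m) = K (- t) n m"
    and mult: "(\<lambda>k. K s n k * K t k m) sums K (s + t) n m"
    and zero: "K 0 n m = (if n = m then 1 else 0)"
begin

definition col :: "real \<Rightarrow> nat \<Rightarrow> l2" where "col t m = Abs_l2 (\<lambda>n. K t n m)"

text \<open>Square-summability of a column is the multiplication law at times -t and t on the
  diagonal, where the summands are squared moduli.\<close>

lemma coord_col [simp]: "coord (col t m) n = K t n m"
proof -
  have "(\<lambda>k. K (- t) m k * K t k m) sums 1" using mult[of "- t" m t m] by (simp add: zero)
  moreover have "K (- t) m k * K t k m = of_real ((cmod (K t k m))\<^sup>2)" for k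
  proof -
    have "K (- t) m k = cnj (K t k m)" using cnj[of t k m] symmetric[of "- t" m k] by (simp only:)
    then show ?thesis by (metis complex_norm_square mult.commute)
  qed
  ultimately have "(\<lambda>k. complex_of_real ((cmod (K t k m))\<^sup>2)) sums of_real 1" by simp
  then have "(\<lambda>k. (cmod (K t k m))\<^sup>2) sums 1" by (simp only: sums_of_real_iff)
  then have "(\<lambda>n. K t n m) \<in> ell2" by (auto simp: ell2_def sums_iff)
  then show ?thesis by (simp add: col_def Abs_l2_inverse)
qed

lemma cinner_col: "cinner (col t n) (col t m) = (if n = m then 1 else 0)"
proof -
  have "(\<lambda>k. K (- t) n k * K t k m) sums (if n = m then 1 else 0)" using mult[of "- t" n t m] by (simp add: zero)
  moreover have "K (- t) n k * K t k m = cnj (coord (col t n) k) * coord (col t m) k" for k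
    using cnj[of t k n] symmetric[of "- t" n k] by simp
  ultimately show ?thesis using cinner_sums[of "col t n" "col t m"] by (simp add: sums_unique2)
qed

lemma bessel: "(\<Sum>n<N. (cmod (cinner (col t n) x))\<^sup>2) \<le> (norm x)\<^sup>2"
proof -
  interpret B: bounded_bilinear cinner by (rule bounded_bilinear_cinner)
  define c where "c n = cinner (col t n) x" for n
  define y where "y = (\<Sum>n<N. cscale (c n) (col t n))"
  let ?S = "\<Sum>n<N. (cmod (c n))\<^sup>2"
  have sq: "cnj z * z = of_real ((cmod z)\<^sup>2)" for z by (metis complex_norm_square mult.commute)
  have 1: "cinner y x = of_real ?S"
    by (simp add: y_def B.sum_left cinner_cscale sq flip: c_def) 
  have "cinner (col t n) y = (if n < N then c n else 0)" for n
    by (simp add: y_def B.sum_right cinner_cscale cinner_col if_distrib cong: if_cong)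
  then have "cinner y y = of_real ?S"
    by (subst (1) y_def) (simp add: B.sum_left cinner_cscale sq)
  then have "inner y y = ?S" "inner y x = ?S" using 1 by (simp_all only: Re_cinner[symmetric] Re_complex_of_real)
  moreover have "0 \<le> inner (x - y) (x - y)" by simp
  ultimately have "?S \<le> inner x x" by (simp add: inner_diff_left inner_diff_right inner_commute)
  then show ?thesis by (simp add: power2_norm_eq_inner c_def)
qed

text \<open>Row n of \<open>K t\<close> is the conjugate of column n of \<open>K (- t)\<close>, so
  matrix multiplication is a pairing with that column; \<open>bessel\<close> makes the result
  square-summable and the map a contraction.\<close>

definition flow :: "real \<Rightarrow> l2 \<Rightarrow> l2" where
  "flow t x = Abs_l2 (\<lambda>n. cinner (col (- t) n) x)"

lemma coord_flow [simp]: "coord (flow t x) n = cinner (col (- t) n) x"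
  by (simp add: flow_def Abs_l2_inverse[OF ell2_of_partial_sums[OF bessel]])

lemma coord_flow_sums: "(\<lambda>m. K t n m * coord x m) sums coord (flow t x) n"
proof -
  have "K t n m = cnj (coord (col (- t) n) m)" for m
    using cnj[of "- t" m n] symmetric[of t n m] by simp
  then show ?thesis using cinner_sums[of "col (- t) n" x] by simp
qed

lemma flow_basis: "flow t (basis m) = col t m"
proof (rule l2_eqI)
  fix n
  show "coord (flow t (basis m)) n = coord (col t m) n"
    using cinner_commute[of "col (- t) n" "basis m"] cnj[of "- t" m n] symmetric[of t n m]
    by (simp add: cinner_basis)
qed

lemma flow_add: "flow t (x + y) = flow t x + flow t y"
  by (rule l2_eqI) (simp add: bounded_bilinear.add_right[OF bounded_bilinear_cinner])

lemma flow_cscale: "flow t (cscale c x) = cscale c (flow t x)"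
  by (rule l2_eqI) (simp add: cinner_cscale)

lemma norm_flow_le: "norm (flow t x) \<le> norm x"
  by (rule norm_le_of_partial_sums) (simp_all add: bessel)

lemma bounded_linear_flow: "bounded_linear (flow t)"
  by (rule bounded_linear_intro[where K = 1]) (simp_all add: flow_add flow_cscale norm_flow_le flip: cscale_simps(7))

lemma flow_group: "flow (s + t) x = flow s (flow t x)"
proof (rule eq_on_basis[of "flow (s + t)" "\<lambda>x. flow s (flow t x)"])
  show "flow (s + t) (basis m) = flow s (flow t (basis m))" for m
  proof (rule l2_eqI)
    fix n
    have "(\<lambda>k. K s n k * K t k m) sums coord (flow s (col t m)) n"
      using coord_flow_sums[of s n "col t m"] by simp
    then show "coord (flow (s + t) (basis m)) n = coord (flow s (flow t (basis m))) n"
      unfolding flow_basis coord_col using mult[of s n t m] by (rule sums_unique2[symmetric])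
  qed
qed (simp_all add: bounded_linear_flow bounded_linear_compose[OF bounded_linear_flow bounded_linear_flow] flow_cscale del: coord_flow)

lemma flow_zero: "flow 0 x = x"
proof (rule eq_on_basis[of "flow 0" "\<lambda>x. x", OF bounded_linear_flow flow_cscale bounded_linear_ident refl])
  show "flow 0 (basis m) = basis m" for m
    by (rule l2_eqI) (simp only: flow_basis coord_col zero coord_basis)
qed

sublocale l2_flow flow
proof
  show "norm (flow t x) = norm x" for t x
  proof (rule antisym[OF norm_flow_le])
    \<comment> \<open>A group of contractions is isometric: contractivity at -t gives the reverse
      inequality.\<close>
    have "norm x = norm (flow (- t) (flow t x))" by (simp add: flow_zero flip: flow_group)
    also have "\<dots> \<le> norm (flow t x)" by (rule norm_flow_le)
    finally show "norm x \<le> norm (flow t x)" .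
  qed
qed (simp_all add: flow_add flow_cscale flow_zero flow_group del: coord_flow)

text \<open>The only input from unitarity to the norm estimates. The bound is the same for all
  parameters, as the doubling argument requires.\<close>

lemma norm_kernel_le: "cmod (K t n m) \<le> 1"
proof -
  have "cmod (coord (flow t (basis m)) n) \<le> norm (flow t (basis m))" by (rule coord_le_norm)
  also have "\<dots> = norm (basis m)" by (rule isometry)
  also have "inner (basis m) (basis m) = 1" by (simp add: cinner_basis flip: Re_cinner)
  then have "norm (basis m) = 1" by (simp only: norm_eq_1)
  finally show ?thesis by (simp add: flow_basis del: coord_flow)
qed

end

section \<open>The discrete Laguerre operator\<close>

locale laguerre =
  fixes \<kappa> :: real
  assumes \<kappa>: "\<kappa> > 0"
begin

sublocale kernel_group "laguerre_kernel \<kappa>"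
  by unfold_locales (fact laguerre_kernel_symmetric[OF \<kappa>] cnj_laguerre_kernel
    laguerre_kernel_mult[OF \<kappa>] laguerre_kernel_0[OF \<kappa>])+

text \<open>The last nonzero row of column m of a tridiagonal matrix is m + 1, hence the range below
  \<open>m + 2\<close>.\<close>

definition hcol :: "nat \<Rightarrow> l2" where
  "hcol m = (\<Sum>n<m + 2. cscale (of_real (laguerre_matrix \<kappa> n m)) (basis n))"

lemma coord_hcol: "coord (hcol m) n = of_real (laguerre_matrix \<kappa> n m)"
proof -
  have "coord (hcol m) n = (\<Sum>k<m + 2. if n = k then of_real (laguerre_matrix \<kappa> k m) else 0)"
    unfolding hcol_def coord_sum by (intro sum.cong) auto
  also have "\<dots> = of_real (laguerre_matrix \<kappa> n m)"
    by (subst sum.delta') (auto simp: laguerre_matrix_def)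
  finally show ?thesis .
qed

text \<open>The matrix is real and symmetric, so row n acts as a pairing with column n, a finitely
  supported vector.\<close>

lemma cinner_hcol: "cinner (hcol n) x = laguerre_op (\<kappa> - 1) (coord x) n"
proof -
  interpret B: bounded_bilinear cinner by (rule bounded_bilinear_cinner)
  have "cinner (hcol n) x = (\<Sum>k<n + 2. of_real (laguerre_matrix \<kappa> k n) * coord x k)"
    by (simp only: hcol_def B.sum_left cinner_cscale cinner_basis complex_cnj_complex_of_real)
  also have "\<dots> = laguerre_op (\<kappa> - 1) (coord x) n"
  proof (cases n)
    case (Suc m)
    have "(\<Sum>k<m. of_real (laguerre_matrix \<kappa> k (Suc m)) * coord x k) = 0"
      by (intro sum.neutral) (auto simp: laguerre_matrix_def)
    then show ?thesis
      using Suc by (simp add: laguerre_op_def laguerre_matrix_def algebra_simps)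
  qed (simp add: laguerre_op_def laguerre_matrix_def algebra_simps)
  finally show ?thesis .
qed

lemma inner_hcol:
  "inner (hcol m) (hcol m) = (2 * real m + \<kappa>)\<^sup>2 + real m * (real m + \<kappa> - 1) + (real m + 1) * (real m + \<kappa>)"
proof -
  have "inner (hcol m) (hcol m) = (\<Sum>n<m + 2. (laguerre_matrix \<kappa> n m)\<^sup>2)"
    by (subst inner_finite_support[where N = "m + 2"])
      (auto simp: coord_hcol laguerre_matrix_def power2_eq_square inner_complex_def)
  also have "\<dots> = (2 * real m + \<kappa>)\<^sup>2 + real m * (real m + \<kappa> - 1) + (real m + 1) * (real m + \<kappa>)"
  proof (cases m)
    case (Suc k)
    have "(\<Sum>n<k. (laguerre_matrix \<kappa> n (Suc k))\<^sup>2) = 0"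
      by (intro sum.neutral) (auto simp: laguerre_matrix_def)
    then show ?thesis
      using Suc \<kappa> by (simp add: laguerre_matrix_def algebra_simps)
  qed (use \<kappa> in \<open>simp add: laguerre_matrix_def\<close>)
  finally show ?thesis .
qed

text \<open>Norm convergence from \<open>|q - D|^2 = |q|^2 - 2 <q, D> + |D|^2\<close>. The first
  term converges by the second-order expansion; \<open>D\<close> has finite support, so entrywise
  limits settle the mixed term.\<close>

lemma generator_basis: "generator (basis m) (hcol m)"
proof -
  define q where "q t = (1 / t) *\<^sub>R (flow t (basis m) - basis m)" for t
  define D where "D = cscale (- \<i>) (hcol m)"
  have basis1: "inner (basis m) (basis m) = 1" by (simp add: cinner_basis flip: Re_cinner)
  have DD: "inner D D = inner (hcol m) (hcol m)"
    by (simp add: D_def flip: power2_norm_eq_inner)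
  have "inner (q t) (q t) = (2 - 2 * Re (laguerre_kernel \<kappa> t m m)) / t\<^sup>2" for t
  proof -
    have "inner (basis m) (flow t (basis m)) = Re (laguerre_kernel \<kappa> t m m)"
      by (simp add: cinner_basis flow_basis del: coord_flow flip: Re_cinner)
    then have "inner (flow t (basis m) - basis m) (flow t (basis m) - basis m) = 2 - 2 * Re (laguerre_kernel \<kappa> t m m)"
      by (simp add: inner_diff_left inner_diff_right inner_preserved basis1 inner_commute[of "flow t (basis m)"])
    then show ?thesis by (simp add: q_def power2_eq_square)
  qed
  then have 1: "((\<lambda>t. inner (q t) (q t)) \<longlongrightarrow> inner D D) (at 0)"
    unfolding DD inner_hcol using laguerre_kernel_second_order[OF \<kappa>, of m] by simp
  have "((\<lambda>t. coord (q t) n) \<longlongrightarrow> coord D n) (at 0)" for n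
  proof -
    have "coord (q t) n = (1 / t) *\<^sub>R (laguerre_kernel \<kappa> (0 + t) n m - laguerre_kernel \<kappa> 0 n m)" for t
      by (simp add: q_def flow_basis zero scaleR_conv_of_real del: coord_flow)
    then show ?thesis
      using laguerre_kernel_deriv_0[OF \<kappa>, of n m]
      unfolding has_vector_derivative_iff_quotient by (simp add: D_def coord_hcol)
  qed
  then have "((\<lambda>t. \<Sum>n<m + 2. inner (coord (q t) n) (coord D n)) \<longlongrightarrow> (\<Sum>n<m + 2. inner (coord D n) (coord D n))) (at 0)"
    by (intro tendsto_sum tendsto_inner tendsto_const)
  moreover have "coord D n = 0" if "n \<ge> m + 2" for n
    using that by (simp add: D_def coord_hcol laguerre_matrix_def)
  ultimately have 2: "((\<lambda>t. inner (q t) D) \<longlongrightarrow> inner D D) (at 0)"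
    by (simp add: inner_finite_support[of "m + 2" D])
  have "((\<lambda>t. inner (q t) (q t) - 2 * inner (q t) D + inner D D) \<longlongrightarrow> inner D D - 2 * inner D D + inner D D) (at 0)"
    by (intro tendsto_intros 1 2)
  moreover have "inner (q t) (q t) - 2 * inner (q t) D + inner D D = (norm (q t - D))\<^sup>2" for t
    by (simp add: power2_norm_eq_inner inner_diff_left inner_diff_right inner_commute)
  ultimately have "((\<lambda>t. (norm (q t - D))\<^sup>2) \<longlongrightarrow> 0) (at 0)" by simp
  from tendsto_real_sqrt[OF this] have "((\<lambda>t. norm (q t - D)) \<longlongrightarrow> 0) (at 0)" by simp
  then show ?thesis
    unfolding generator_def q_def D_def by (simp only: tendsto_norm_zero_iff LIM_zero_iff)
qed

lemma flow_tendsto: "((\<lambda>t. flow t x) \<longlongrightarrow> x) (at 0)"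
proof -
  have basis: "((\<lambda>t. flow t (basis m)) \<longlongrightarrow> basis m) (at 0)" for m
  proof -
    have "isCont (\<lambda>t. flow t (basis m)) 0"
      using generator_deriv[OF generator_basis, of m 0] by (rule has_vector_derivative_continuous)
    then show ?thesis by (simp add: isCont_def flow_zero)
  qed
  have trunc: "((\<lambda>t. flow t (truncate N x)) \<longlongrightarrow> truncate N x) (at 0)" for N
  proof -
    have "flow t (truncate N x) = (\<Sum>m<N. cscale (coord x m) (flow t (basis m)))" for t
      unfolding truncate_def linear_sum[OF bounded_linear.linear[OF bounded_linear]] flow_cscale ..
    moreover have "((\<lambda>t. \<Sum>m<N. cscale (coord x m) (flow t (basis m))) \<longlongrightarrow> truncate N x) (at 0)"
      unfolding truncate_def by (intro tendsto_sum bounded_linear.tendsto[OF bounded_linear_cscale] basis)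
    ultimately show ?thesis by simp
  qed
  show ?thesis
  proof (rule tendstoI)
    fix e :: real assume e: "e > 0"
    obtain N where N: "dist (truncate N x) x < e / 3"
      using metric_LIMSEQ_D[OF truncate_tendsto[of x], of "e / 3"] e by auto
    have "eventually (\<lambda>t. dist (flow t (truncate N x)) (truncate N x) < e / 3) (at 0)"
      using trunc[of N] e by (intro tendstoD) auto
    then show "eventually (\<lambda>t. dist (flow t x) x < e) (at 0)"
    proof eventually_elim
      case (elim t)
      have "dist (flow t x) (flow t (truncate N x)) = dist (truncate N x) x"
        by (simp add: dist_norm isometry norm_minus_commute flip: diff)
      then show ?case
        using N elim dist_triangle[of "flow t x" x "flow t (truncate N x)"]
          dist_triangle[of "flow t (truncate N x)" x "truncate N x"] by simp
    qed
  qed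
qed

section \<open>The maximal operator as generator\<close>

definition maximal :: "l2 \<Rightarrow> l2 \<Rightarrow> bool" where
  "maximal x y \<longleftrightarrow> (\<forall>n. coord y n = cinner (hcol n) x)"

text \<open>Basis vectors belong to the domain of the generator, and its symmetry against them
  yields the coordinates of \<open>y\<close>.\<close>

lemma generator_imp_maximal:
  assumes "generator x y" shows "maximal x y"
  unfolding maximal_def
proof
  fix n
  have "cinner (hcol n) x = cinner (basis n) y"
    by (rule generator_symmetric[OF generator_basis assms])
  then show "coord y n = cinner (hcol n) x" by (simp add: cinner_basis)
qed

text \<open>
  Carleman's argument: the boundary term of the summation by parts is
  \<open>O(P)\<close> times a summable sequence, so its limit can only be 0.
\<close>

lemma maximal_symmetric:
  assumes xy: "maximal x y" and xy': "maximal x' y'"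
  shows "cinner y x' = cinner x y'"
proof (rule ccontr)
  define a where "a n = sqrt ((real n + 1) * (real n + \<kappa>))" for n
  define S where "S P = (\<Sum>n<P. cnj (coord y n) * coord x' n - cnj (coord x n) * coord y' n)" for P
  define g where "g P = cmod (coord x (Suc P)) * cmod (coord x' P) + cmod (coord x P) * cmod (coord x' (Suc P))" for P
  define L where "L = cinner y x' - cinner x y'"
  assume "cinner y x' \<noteq> cinner x y'"
  then have L: "cmod L > 0" by (simp add: L_def)
  have rec: "coord y n = (if n = 0 then 0 else of_real (a (n - 1)) * coord x (n - 1)) + of_real (2 * real n + \<kappa>) * coord x n +
      of_real (a n) * coord x (Suc n)" if "maximal x y" for n x y
    using that by (cases n) (simp_all add: maximal_def cinner_hcol laguerre_op_def a_def algebra_simps)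
  \<comment> \<open>Diagonal coefficients are real and cancel, inner couplings telescope, and only
    the coupling between P and P + 1 is left.\<close>
  have S: "S (Suc P) = of_real (a P) * (cnj (coord x (Suc P)) * coord x' P - cnj (coord x P) * coord x' (Suc P))" for P
  proof (induction P)
    case 0
    show ?case by (simp add: S_def rec[OF xy] rec[OF xy'] algebra_simps)
  next
    case (Suc P)
    have "S (Suc (Suc P)) = S (Suc P) + (cnj (coord y (Suc P)) * coord x' (Suc P) - cnj (coord x (Suc P)) * coord y' (Suc P))"
      by (simp add: S_def)
    then show ?case unfolding Suc by (simp add: rec[OF xy] rec[OF xy'] algebra_simps)
  qed
  define C where "C = sqrt (1 + \<kappa>)"
  have C: "C > 0" using \<kappa> by (simp add: C_def)
  have a: "a P \<le> C * real (Suc P)" for P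
  proof -
    have "(real P + 1) * (real P + \<kappa>) \<le> (1 + \<kappa>) * (real (Suc P))\<^sup>2"
    proof -
      have "real P + \<kappa> \<le> (1 + \<kappa>) * (real P + 1)" using \<kappa> by (simp add: algebra_simps)
      from mult_left_mono[OF this, of "real P + 1"] show ?thesis
        by (simp add: power2_eq_square mult_ac add.commute)
    qed
    then have "a P \<le> sqrt ((1 + \<kappa>) * (real (Suc P))\<^sup>2)" unfolding a_def by (rule real_sqrt_le_mono)
    then show ?thesis by (simp add: C_def real_sqrt_mult)
  qed
  have Sg: "cmod (S (Suc P)) \<le> C * real (Suc P) * g P" for P
  proof -
    have "cmod (S (Suc P)) \<le> a P * g P"
      unfolding S norm_mult g_def using norm_triangle_ineq4[of "cnj (coord x (Suc P)) * coord x' P" "cnj (coord x P) * coord x' (Suc P)"]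
      by (intro mult_mono) (auto simp: norm_mult a_def \<kappa> less_imp_le)
    also have "\<dots> \<le> C * real (Suc P) * g P" by (intro mult_right_mono a) (simp add: g_def)
    finally show ?thesis .
  qed
  have shift: "(\<lambda>n. coord z (Suc n)) \<in> ell2" for z
    using coord[of z] summable_Suc_iff[of "\<lambda>n. (cmod (coord z n))\<^sup>2"] by (simp add: ell2_def)
  have g: "summable g"
    unfolding g_def by (intro summable_add ell2_mult_summable shift coord)
  have "S \<longlonglongrightarrow> L"
    using sums_diff[OF cinner_sums[of y x'] cinner_sums[of x y']] by (simp add: sums_def S_def[abs_def] L_def)
  then have "(\<lambda>P. cmod (S (Suc P))) \<longlonglongrightarrow> cmod L" by (intro tendsto_norm LIMSEQ_Suc)
  then have "eventually (\<lambda>P. cmod L / 2 < cmod (S (Suc P))) sequentially"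
    using L by (intro order_tendstoD) auto
  \<comment> \<open>For nonzero L the harmonic series would be dominated by a multiple of the
    summable \<open>g\<close>.\<close>
  then have "eventually (\<lambda>P. norm (inverse (real (Suc P))) \<le> (2 * C / cmod L) * g P) sequentially"
  proof eventually_elim
    case (elim P)
    then have "cmod L / 2 \<le> C * real (Suc P) * g P" using Sg[of P] by simp
    then show ?case using L by (simp add: field_simps)
  qed
  then have "summable (\<lambda>P. inverse (real (Suc P)))"
    by (rule summable_comparison_test_ev[OF _ summable_mult[OF g]])
  then show False using not_summable_harmonic[where 'a = real] by (subst (asm) summable_Suc_iff) simp
qed

text \<open>Coordinates of \<open>flow s x\<close> are pairings of \<open>x\<close> with
  \<open>flow (- s) (basis n)\<close>, which stays in the domain. They are differentiated there, and
  \<open>maximal_symmetric\<close> moves the operator onto \<open>x\<close>. A mean value estimate,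
  uniform in the number of coordinates, upgrades this to norm convergence.\<close>

lemma maximal_imp_generator:
  assumes "maximal x y" shows "generator x y"
proof -
  have coord_deriv: "((\<lambda>s. coord (flow s x) n) has_vector_derivative - \<i> * coord (flow s y) n) (at s)" for n s
  proof -
    let ?e = "flow (- s) (basis n)" and ?h = "flow (- s) (hcol n)"
    have "generator ?e ?h" by (intro generator_flow generator_basis)
    then have "cinner ?h x = cinner ?e y"
      by (intro maximal_symmetric generator_imp_maximal assms)
    moreover have "((\<lambda>s. flow (- s) (basis n)) has_vector_derivative - cscale (- \<i>) ?h) (at s)"
      using vector_diff_chain_at[OF has_vector_derivative_minus[OF has_vector_derivative_id]
          generator_deriv[OF generator_basis, of n "- s"]] by (simp add: o_def)
    then have "((\<lambda>s. cinner (flow (- s) (basis n)) x) has_vector_derivative cinner (- cscale (- \<i>) ?h) x) (at s)"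
      by (rule bounded_linear.has_vector_derivative[OF bounded_bilinear.bounded_linear_left[OF bounded_bilinear_cinner]])
    moreover have "cinner (flow (- s) (basis n)) z = coord (flow s z) n" for s z
      by (simp add: cinner_adjoint cinner_basis del: coord_flow)
    ultimately show ?thesis
      by (simp add: cscale_simps(8)[symmetric] cinner_cscale del: coord_flow)
  qed
  show ?thesis
    unfolding generator_def
  proof (rule tendstoI)
    fix e :: real assume e: "e > 0"
    have "eventually (\<lambda>t. dist (flow t y) y < e / 2) (at 0)"
      using flow_tendsto[of y] e by (intro tendstoD) auto
    then obtain d where d: "d > 0" "\<And>t. t \<noteq> 0 \<Longrightarrow> \<bar>t\<bar> < d \<Longrightarrow> dist (flow t y) y < e / 2"
      unfolding eventually_at by (auto simp: dist_real_def)
    have "dist ((1 / t) *\<^sub>R (flow t x - x)) (cscale (- \<i>) y) < e" if t: "t \<noteq> 0" "\<bar>t\<bar> < d" for t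
    proof -
      define w where "w = flow t x - x - t *\<^sub>R cscale (- \<i>) y"
      have bd: "norm (truncate N w) \<le> \<bar>t\<bar> * (e / 2)" for N
      proof -
        \<comment> \<open>The error is tested against its own truncation: a finite combination of
          coordinates, hence differentiable, whose pairing with \<open>w\<close> is the square of
          its norm.\<close>
        let ?v = "truncate N w"
        have der: "((\<lambda>s. cinner ?v (flow s x)) has_vector_derivative cinner ?v (cscale (- \<i>) (flow s y))) (at s within S)" for s S
        proof -
          have "((\<lambda>s. \<Sum>n<N. cnj (coord w n) * coord (flow s x) n) has_vector_derivative
              (\<Sum>n<N. cnj (coord w n) * (- \<i> * coord (flow s y) n))) (at s)"
            by (intro has_vector_derivative_sum has_vector_derivative_mult_right coord_deriv)
          then show ?thesis
            unfolding cinner_truncate cscale.rep_eq by (rule has_vector_derivative_at_within)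
        qed
        have "norm (cinner ?v (flow t x) - cinner ?v (flow 0 x) - (t - 0) *\<^sub>R cinner ?v (cscale (- \<i>) (flow 0 y))) \<le>
          norm (t - 0) * (norm ?v * (e / 2))"
        proof (rule vector_differentiable_bound_linearization[OF der])
          show "closed_segment 0 t \<subseteq> closed_segment 0 t" "0 \<in> closed_segment 0 t" by auto
          fix s assume "s \<in> closed_segment 0 t"
          then have s: "\<bar>s\<bar> < d" using t by (auto simp: closed_segment_eq_real_ivl split: if_splits)
          have "norm (flow s y - y) \<le> e / 2"
            using d(2)[OF _ s] e by (cases "s = 0") (auto simp: dist_norm flow_zero)
          then have "norm ?v * norm (flow s y - y) \<le> norm ?v * (e / 2)" by (rule mult_left_mono) simp
          moreover have "cinner ?v (cscale (- \<i>) (flow s y)) - cinner ?v (cscale (- \<i>) (flow 0 y)) =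
              - \<i> * cinner ?v (flow s y - y)"
            by (simp only: cinner_cscale flow_zero bounded_bilinear.diff_right[OF bounded_bilinear_cinner] right_diff_distrib)
          then have "norm (cinner ?v (cscale (- \<i>) (flow s y)) - cinner ?v (cscale (- \<i>) (flow 0 y))) =
              norm (cinner ?v (flow s y - y))"
            by (simp only: norm_mult norm_minus_cancel norm_ii mult_1_left)
          ultimately show "norm (cinner ?v (cscale (- \<i>) (flow s y)) - cinner ?v (cscale (- \<i>) (flow 0 y))) \<le> norm ?v * (e / 2)"
            using norm_cinner_le[of ?v "flow s y - y"] by linarith
        qed
        also have "cinner ?v (flow t x) - cinner ?v (flow 0 x) - (t - 0) *\<^sub>R cinner ?v (cscale (- \<i>) (flow 0 y)) = cinner ?v w"
          by (simp only: w_def flow_zero bounded_bilinear.diff_right[OF bounded_bilinear_cinner]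
             bounded_bilinear.scaleR_right[OF bounded_bilinear_cinner] diff_0_right)
        also have "cinner ?v w = cinner ?v ?v"
          by (simp add: cinner_truncate coord_truncate)
        finally have "norm (cinner ?v ?v) \<le> \<bar>t\<bar> * (norm ?v * (e / 2))" by simp
        moreover have "(norm ?v)\<^sup>2 \<le> norm (cinner ?v ?v)"
          using complex_Re_le_cmod[of "cinner ?v ?v"] by (simp add: Re_cinner power2_norm_eq_inner)
        ultimately have "norm ?v * norm ?v \<le> norm ?v * (\<bar>t\<bar> * (e / 2))" by (simp add: power2_eq_square mult_ac)
        then show ?thesis using e by (cases "norm ?v = 0") auto
      qed
      have "norm w \<le> \<bar>t\<bar> * (e / 2)"
        by (rule LIMSEQ_le_const2[OF tendsto_norm[OF truncate_tendsto]]) (use bd in auto)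
      then have le: "norm ((1 / t) *\<^sub>R w) \<le> e / 2" using t by (simp add: field_simps)
      have eq: "(1 / t) *\<^sub>R (flow t x - x) - cscale (- \<i>) y = (1 / t) *\<^sub>R w"
        using t by (simp add: w_def scaleR_diff_right)
      show ?thesis unfolding dist_norm eq using le e by linarith
    qed
    then show "eventually (\<lambda>t. dist ((1 / t) *\<^sub>R (flow t x - x)) (cscale (- \<i>) y) < e) (at 0)"
      unfolding eventually_at using d(1) by (auto simp: dist_real_def)
  qed
qed

lemma generator_iff_maximal: "generator x y \<longleftrightarrow> maximal x y"
  using generator_imp_maximal maximal_imp_generator by blast

end

section \<open>Comparison with the definitions on sequences\<close>

lemma generator_transfer:
  assumes flow: "l2_flow V" and V: "\<And>t. coord (V t x) = U t (coord x)"
  shows "l2_flow.generator V x y \<longleftrightarrow>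
    ((\<lambda>t. ell2_norm (\<lambda>n. (U t (coord x) n - coord x n) / of_real t - (- \<i> * coord y n))) \<longlongrightarrow> 0) (at 0)"
proof -
  have "norm ((1 / t) *\<^sub>R (V t x - x) - cscale (- \<i>) y) =
    ell2_norm (\<lambda>n. (U t (coord x) n - coord x n) / of_real t - (- \<i> * coord y n))" for t
    unfolding norm_l2_eq by (rule arg_cong[where f = ell2_norm]) (simp add: fun_eq_iff V divide_inverse mult.commute)
  moreover have "l2_flow.generator V x y \<longleftrightarrow>
      ((\<lambda>t. norm ((1 / t) *\<^sub>R (V t x - x) - cscale (- \<i>) y)) \<longlongrightarrow> 0) (at 0)"
    unfolding l2_flow.generator_def[OF flow] by (simp only: tendsto_norm_zero_iff LIM_zero_iff)
  ultimately show ?thesis by (simp only:)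
qed

lemma ball_ell2: "(\<forall>u\<in>ell2. P u) \<longleftrightarrow> (\<forall>x. P (coord x))"
  by (metis coord Abs_l2_inverse)

lemma l2_flow_of_unitary_group:
  assumes "unitary_group_ell2 U"
  shows "l2_flow (\<lambda>t x. Abs_l2 (U t (coord x)))" "coord (Abs_l2 (U t (coord x))) = U t (coord x)"
proof -
  have un: "unitary_ell2 (U t)" for t using assms by (simp add: unitary_group_ell2_def)
  have mem: "U t (coord x) \<in> ell2" for t x
    using un[of t] coord[of x] by (auto simp: unitary_ell2_def bij_betw_def)
  show c: "coord (Abs_l2 (U t (coord x))) = U t (coord x)" for t x
    by (rule Abs_l2_inverse[OF mem])
  have lin: "U t (\<lambda>n. coord x n + a * coord y n) = (\<lambda>n. U t (coord x) n + a * U t (coord y) n)" for t x y a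
    using un[of t] coord[of x] coord[of y] by (auto simp: unitary_ell2_def)
  show "l2_flow (\<lambda>t x. Abs_l2 (U t (coord x)))"
  proof
    fix s t a x y
    have "coord (x + y) = (\<lambda>n. coord x n + 1 * coord y n)" by auto
    then have "U t (coord (x + y)) n = U t (coord x) n + U t (coord y) n" for n
      using fun_cong[OF lin[of t x 1 y], of n] by (simp only: mult_1_left)
    then show "Abs_l2 (U t (coord (x + y))) = Abs_l2 (U t (coord x)) + Abs_l2 (U t (coord y))"
      by (intro l2_eqI) (simp only: c plus_l2.rep_eq[of "Abs_l2 (U t (coord x))"])
    \<comment> \<open>Linearity is available for combinations u + c v. With both vectors zero it
      reads z = z + z, so zero is preserved, and scaling follows.\<close>
    have "coord 0 = (\<lambda>n. coord 0 n + 1 * coord 0 n)" by auto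
    then have "U t (coord 0) n = U t (coord 0) n + 1 * U t (coord 0) n" for n
      using fun_cong[OF lin[of t 0 1 0], of n] by simp
    then have z: "U t (coord 0) n = 0" for n by simp
    have "coord (cscale a x) = (\<lambda>n. coord 0 n + a * coord x n)" by auto
    then have "U t (coord (cscale a x)) n = a * U t (coord x) n" for n
      using fun_cong[OF lin[of t 0 a x], of n] by (simp only: z add_0)
    then show "Abs_l2 (U t (coord (cscale a x))) = cscale a (Abs_l2 (U t (coord x)))"
      by (intro l2_eqI) (simp only: c cscale.rep_eq[of a "Abs_l2 (U t (coord x))"])
    have "cinner (Abs_l2 (U t (coord x))) (Abs_l2 (U t (coord x))) = cinner x x"
      using un[of t] coord[of x] by (simp add: cinner_eq c unitary_ell2_def)
    then have "inner (Abs_l2 (U t (coord x))) (Abs_l2 (U t (coord x))) = inner x x"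
      by (simp only: Re_cinner[symmetric])
    then show "norm (Abs_l2 (U t (coord x))) = norm x" by (simp only: norm_eq_sqrt_inner)
    show "Abs_l2 (U 0 (coord x)) = x"
      using assms coord[of x] by (simp add: unitary_group_ell2_def coord_inverse)
    show "Abs_l2 (U (s + t) (coord x)) = Abs_l2 (U s (coord (Abs_l2 (U t (coord x)))))"
      unfolding c using assms coord[of x] by (simp add: unitary_group_ell2_def)
  qed
qed

context laguerre
begin

definition group_ell2 :: "real \<Rightarrow> (nat \<Rightarrow> complex) \<Rightarrow> (nat \<Rightarrow> complex)" where
  "group_ell2 t = restrict (\<lambda>u. coord (flow t (Abs_l2 u))) ell2"

lemma group_ell2_coord: "group_ell2 t (coord x) = coord (flow t x)"
  by (simp add: group_ell2_def coord coord_inverse del: coord_flow)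

lemma maximal_iff: "maximal x y \<longleftrightarrow> coord x \<in> laguerre_dom (\<kappa> - 1) \<and> laguerre_op (\<kappa> - 1) (coord x) = coord y"
proof -
  have "maximal x y \<longleftrightarrow> coord y = laguerre_op (\<kappa> - 1) (coord x)"
    unfolding maximal_def cinner_hcol by auto
  then show ?thesis using coord[of x] coord[of y] by (auto simp: laguerre_dom_def)
qed

lemma unitary_group_ell2: "unitary_group_ell2 group_ell2"
proof -
  have ex: "\<exists>x. u = coord x" if "u \<in> ell2" for u using that by (metis Abs_l2_inverse)
  have inv: "group_ell2 (- t) (group_ell2 t (coord x)) = coord x" for t x
    unfolding group_ell2_coord inverse ..
  have lin: "(\<lambda>n. coord x n + c * coord y n) = coord (x + cscale c y)" for x y c by auto
  have "unitary_ell2 (group_ell2 t)" for t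
    unfolding unitary_ell2_def
  proof (intro conjI ballI allI)
    show "bij_betw (group_ell2 t) ell2 ell2"
    proof (rule bij_betw_byWitness[where f' = "group_ell2 (- t)"])
      show "\<forall>u\<in>ell2. group_ell2 (- t) (group_ell2 t u) = u" "\<forall>u\<in>ell2. group_ell2 t (group_ell2 (- t) u) = u"
        using ex inv[of t] inv[of "- t"] by (metis, metis minus_minus)
      show "group_ell2 t ` ell2 \<subseteq> ell2" "group_ell2 (- t) ` ell2 \<subseteq> ell2"
        using ex coord by (auto simp: group_ell2_coord simp del: coord_flow dest!: ex)
    qed
    fix u v c assume "u \<in> ell2" "v \<in> ell2"
    then obtain x y where xy: "u = coord x" "v = coord y" using ex by blast
    show "group_ell2 t (\<lambda>n. u n + c * v n) = (\<lambda>n. group_ell2 t u n + c * group_ell2 t v n)"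
      unfolding xy lin group_ell2_coord by (rule ext) (simp only: flow_add flow_cscale coord_simps cscale.rep_eq)
    show "ell2_inner (group_ell2 t u) (group_ell2 t v) = ell2_inner u v"
      unfolding xy group_ell2_coord cinner_eq[symmetric] by (rule cinner_preserved)
  qed
  moreover have "group_ell2 0 u = u" if "u \<in> ell2" for u
    using ex[OF that] by (auto simp: group_ell2_coord flow_zero simp del: coord_flow)
  moreover have "group_ell2 (s + t) u = group_ell2 s (group_ell2 t u)" if "u \<in> ell2" for u s t
    using ex[OF that] by (auto simp: group_ell2_coord flow_group simp del: coord_flow)
  moreover have "((\<lambda>s. ell2_norm (\<lambda>n. group_ell2 s u n - group_ell2 t u n)) \<longlongrightarrow> 0) (at t)" if u: "u \<in> ell2" for u t
  proof -
    obtain x where x: "u = coord x" using ex[OF u] by blast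
    have "ell2_norm (\<lambda>n. group_ell2 (t + h) u n - group_ell2 t u n) = norm (flow h x - x)" for h
    proof -
      have "ell2_norm (\<lambda>n. group_ell2 (t + h) u n - group_ell2 t u n) = norm (flow (t + h) x - flow t x)"
        unfolding norm_l2_eq x group_ell2_coord by (simp only: coord_simps[abs_def])
      also have "\<dots> = norm (flow t (flow h x - x))" by (simp only: flow_group diff)
      finally show ?thesis by (simp only: isometry)
    qed
    moreover have "((\<lambda>h. norm (flow h x - x)) \<longlongrightarrow> 0) (at 0)"
      using flow_tendsto[of x] by (simp add: tendsto_norm_zero_iff LIM_zero_iff)
    ultimately have "((\<lambda>h. ell2_norm (\<lambda>n. group_ell2 (t + h) u n - group_ell2 t u n)) \<longlongrightarrow> 0) (at 0)" by simp
    then show ?thesis by (rule LIM_offset_zero_cancel)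
  qed
  ultimately show ?thesis unfolding unitary_group_ell2_def by blast
qed

text \<open>Existence is \<open>generator_iff_maximal\<close> for the constructed group. Any
  competitor has the same generator relation, and basis vectors lie in its domain, so
  \<open>l2_flow_unique\<close> applies.\<close>

lemma laguerre_group_eq: "laguerre_group (\<kappa> - 1) = group_ell2"
  unfolding laguerre_group_def exp_group_ell2_def
proof (rule the_equality, intro conjI allI)
  have generator: "generates_ell2 (laguerre_dom (\<kappa> - 1)) (laguerre_op (\<kappa> - 1)) U \<longleftrightarrow>
      (\<forall>x y. maximal x y \<longleftrightarrow> l2_flow.generator V x y)"
    if "l2_flow V" "\<And>t x. coord (V t x) = U t (coord x)" for U V
  proof -
    have tr: "l2_flow.generator V x y \<longleftrightarrow> ((\<lambda>t. ell2_norm (\<lambda>n. (U t (coord x) n - coord x n) / of_real t - (- \<i> * coord y n))) \<longlongrightarrow> 0) (at 0)" for x y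
      by (rule generator_transfer[OF that(1)]) (rule that(2))
    show ?thesis unfolding generates_ell2_def maximal_iff tr ball_ell2 ..
  qed
  show "unitary_group_ell2 group_ell2" by (rule unitary_group_ell2)
  show "generates_ell2 (laguerre_dom (\<kappa> - 1)) (laguerre_op (\<kappa> - 1)) group_ell2"
    by (subst generator[of flow])
      (simp_all add: l2_flow_axioms group_ell2_coord generator_iff_maximal del: coord_flow)
  show "group_ell2 t \<in> extensional ell2" for t by (simp add: group_ell2_def)
  fix U assume U: "unitary_group_ell2 U \<and> generates_ell2 (laguerre_dom (\<kappa> - 1)) (laguerre_op (\<kappa> - 1)) U \<and>
      (\<forall>t. U t \<in> extensional ell2)"
  define V where "V t x = Abs_l2 (U t (coord x))" for t x
  have V: "l2_flow V" "coord (V t x) = U t (coord x)" for t x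
    unfolding V_def[abs_def] using l2_flow_of_unitary_group U by blast+
  have "V t x = flow t x" for t x
  proof (rule sym, rule l2_flow_unique[OF l2_flow_axioms V(1) _ generator_basis])
    show "generator x y \<longleftrightarrow> l2_flow.generator V x y" for x y
      using generator[of V U, OF V] U generator_iff_maximal by blast
  qed
  then have "U t (coord x) = group_ell2 t (coord x)" for t x
    unfolding group_ell2_coord V(2)[symmetric] by simp
  then have eq: "U t u = group_ell2 t u" if "u \<in> ell2" for t u
    using that by (metis Abs_l2_inverse)
  show "U = group_ell2"
  proof (rule ext, rule ext)
    fix t u
    show "U t u = group_ell2 t u"
      using eq[of u t] U by (cases "u \<in> ell2") (auto simp: extensional_def group_ell2_def)
  qed
qed

section \<open>The operator norm in terms of kernel entries\<close>

lemma opnorm_upper: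
  assumes "\<And>n m. cmod (laguerre_kernel \<kappa> t n m) \<le> B"
  shows "opnorm_1_inf (group_ell2 t) \<le> ennreal B"
  unfolding opnorm_1_inf_def
proof (rule SUP_least)
  fix u assume "u \<in> {u \<in> ell1. ell1_norm u \<le> 1}"
  then have u: "summable (\<lambda>n. cmod (u n))" "(\<Sum>n. cmod (u n)) \<le> 1" by (auto simp: ell1_def ell1_norm_def)
  have B: "B \<ge> 0" using order_trans[OF norm_ge_zero assms] .
  \<comment> \<open>Entries eventually below 1 dominate their squares, so \<open>ell1\<close> lies
    in \<open>ell2\<close>, where the group is given by the kernel.\<close>
  have "eventually (\<lambda>n. cmod (u n) < 1) sequentially"
    using summable_LIMSEQ_zero[OF u(1)] by (intro order_tendstoD) auto
  then have "eventually (\<lambda>n. norm ((cmod (u n))\<^sup>2) \<le> cmod (u n)) sequentially"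
  proof eventually_elim
    case (elim n)
    then show ?case using mult_left_le[of "cmod (u n)" "cmod (u n)"] by (simp add: power2_eq_square)
  qed
  then have "u \<in> ell2" unfolding ell2_def mem_Collect_eq by (rule summable_comparison_test_ev[OF _ u(1)])
  then obtain x where x: "u = coord x" by (metis Abs_l2_inverse)
  have "cmod (group_ell2 t u n) \<le> B" for n
  proof -
    have bd: "cmod (laguerre_kernel \<kappa> t n m * coord x m) \<le> B * cmod (coord x m)" for m
      unfolding norm_mult by (intro mult_right_mono assms) simp
    have sm: "summable (\<lambda>m. cmod (laguerre_kernel \<kappa> t n m * coord x m))"
      by (rule summable_comparison_test'[OF summable_mult[OF u(1), of B], of 0]) (use bd in \<open>simp add: x\<close>)
    have "group_ell2 t u n = (\<Sum>m. laguerre_kernel \<kappa> t n m * coord x m)"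
      unfolding x group_ell2_coord by (rule sums_unique[OF coord_flow_sums])
    also have "cmod \<dots> \<le> (\<Sum>m. cmod (laguerre_kernel \<kappa> t n m * coord x m))" by (rule summable_norm[OF sm])
    also have "\<dots> \<le> (\<Sum>m. B * cmod (coord x m))"
      using u(1) by (intro suminf_le bd sm summable_mult) (simp add: x)
    also have "\<dots> = B * (\<Sum>m. cmod (u m))" unfolding x using u(1) by (intro suminf_mult) (simp add: x)
    also have "\<dots> \<le> B" using mult_left_mono[OF u(2) B] by simp
    finally show ?thesis .
  qed
  then show "ellinf_norm (group_ell2 t u) \<le> ennreal B"
    unfolding ellinf_norm_def by (intro SUP_least ennreal_leI)
qed

lemma opnorm_lower: "ennreal (cmod (laguerre_kernel \<kappa> t n m)) \<le> opnorm_1_inf (group_ell2 t)"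
  unfolding opnorm_1_inf_def
proof (rule SUP_upper2)
  have "(\<lambda>k. cmod (coord (basis m) k)) = (\<lambda>k. if k = m then 1 else 0)" by auto
  then have "(\<lambda>k. cmod (coord (basis m) k)) sums 1" using sums_single[of m "\<lambda>_. 1 :: real"] by simp
  then show "coord (basis m) \<in> {u \<in> ell1. ell1_norm u \<le> 1}"
    unfolding ell1_def ell1_norm_def mem_Collect_eq by (simp add: sums_iff del: coord_basis)
  have "group_ell2 t (coord (basis m)) n = laguerre_kernel \<kappa> t n m"
    unfolding group_ell2_coord flow_basis by (rule coord_col)
  then show "ennreal (cmod (laguerre_kernel \<kappa> t n m)) \<le> ellinf_norm (group_ell2 t (coord (basis m)))"
    unfolding ellinf_norm_def by (intro SUP_upper2[of n]) (simp_all del: coord_basis)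
qed

end

section \<open>Norm estimates\<close>

text \<open>Compare successive ratios. With x = n + 1 + \<alpha>, the logarithm inequalities give
  \<alpha> ln((x + 1)/x) \<le> \<alpha>/x \<le> ln(x/(n + 1)), and x/(n + 1) is the ratio of
  consecutive weights.\<close>

lemma nb_weight_lower_bound:
  assumes \<alpha>: "\<alpha> \<ge> 0"
  shows "nb_weight (1 + \<alpha>) n \<ge> ((real n + 1 + \<alpha>) / (1 + \<alpha>)) powr \<alpha>"
proof (induction n)
  case 0
  show ?case using \<alpha> by (simp add: nb_weight_def)
next
  case (Suc n)
  let ?x = "real n + 1 + \<alpha>"
  have x: "?x > 0" using \<alpha> by simp
  have "\<alpha> * ln ((?x + 1) / ?x) \<le> \<alpha> * (1 / ?x)"
  proof (rule mult_left_mono[OF _ \<alpha>])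
    have "ln (1 + 1 / ?x) \<le> 1 / ?x" using x by (intro ln_add_one_self_le_self) simp
    moreover have "1 + 1 / ?x = (?x + 1) / ?x" using x by (simp add: field_simps)
    ultimately show "ln ((?x + 1) / ?x) \<le> 1 / ?x" by simp
  qed
  also have "\<alpha> * (1 / ?x) \<le> ln (?x / (real n + 1))"
  proof -
    have "ln ((real n + 1) / ?x) \<le> (real n + 1) / ?x - 1" using x by (intro ln_le_minus_one) simp
    also have "(real n + 1) / ?x - 1 = - (\<alpha> * (1 / ?x))" using x by (simp add: field_simps)
    finally show ?thesis using x by (simp add: ln_div)
  qed
  finally have "exp (\<alpha> * ln ((?x + 1) / ?x)) \<le> exp (ln (?x / (real n + 1)))" by simp
  then have step: "((?x + 1) / ?x) powr \<alpha> \<le> ?x / (real n + 1)"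
    using x by (simp add: powr_def)
  have "((real (Suc n) + 1 + \<alpha>) / (1 + \<alpha>)) powr \<alpha> = (?x / (1 + \<alpha>)) powr \<alpha> * ((?x + 1) / ?x) powr \<alpha>"
    using x \<alpha> by (simp add: add_ac flip: powr_mult)
  also have "\<dots> \<le> nb_weight (1 + \<alpha>) n * (?x / (real n + 1))"
    by (intro mult_mono Suc step) (use nb_weight_pos[of "1 + \<alpha>" n] \<alpha> in \<open>auto simp: less_imp_le\<close>)
  also have "\<dots> = nb_weight (1 + \<alpha>) (Suc n)" by (simp add: nb_weight_Suc add_ac)
  finally show ?case .
qed

lemma powr_half_square: "x > 0 \<Longrightarrow> (x powr (a / 2))\<^sup>2 = x powr a" for x a :: real
  by (simp add: power2_eq_square flip: powr_add)

context laguerre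
begin

text \<open>The squared kernel is \<sigma>^2 times the quantity Q of the doubling argument, so Q
  \<le> 1 is the claim. The second conclusion records Q \<le> 1 itself, which the case \<kappa> < 1
  takes as input.\<close>

lemma kernel_bound_ge_1:
  assumes "\<kappa> \<ge> 1"
  shows "cmod (laguerre_kernel \<kappa> t n m) \<le> (1 + t\<^sup>2) powr (- 1 / 2)"
    and "(1 / sqrt (1 + t\<^sup>2)) powr (2 * (\<kappa> - 1)) *
      (su11 (t * (1 / sqrt (1 + t\<^sup>2))) \<kappa> n m * su11 (t * (1 / sqrt (1 + t\<^sup>2))) \<kappa> m n) \<le> 1"
proof -
  define \<sigma> where "\<sigma> = 1 / sqrt (1 + t\<^sup>2)"
  have pos: "1 + t\<^sup>2 > 0" by (simp add: add_pos_nonneg)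
  have \<sigma>: "\<sigma> > 0" "(t * \<sigma>)\<^sup>2 + \<sigma>\<^sup>2 = 1" "\<sigma>\<^sup>2 = 1 / (1 + t\<^sup>2)"
    using pos by (simp_all add: \<sigma>_def power_mult_distrib power_divide field_simps)
  have split: "\<sigma> powr (2 * (1 + \<alpha>)) = \<sigma>\<^sup>2 * \<sigma> powr (2 * \<alpha>)" for \<alpha>
    using \<sigma>(1) powr_realpow[of \<sigma> 2] by (simp add: distrib_left powr_add)
  have crude: "\<sigma> powr (2 * \<alpha>) * (su11 (t * \<sigma>) (1 + \<alpha>) l l * su11 (t * \<sigma>) (1 + \<alpha>) l l) \<le> 1 / \<sigma>\<^sup>2"
    if "\<alpha> \<ge> 0" for \<alpha> l
  proof -
    interpret L: laguerre "1 + \<alpha>" by unfold_locales (use that in simp)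
    have "(cmod (laguerre_kernel (1 + \<alpha>) t l l))\<^sup>2 \<le> 1"
      using L.norm_kernel_le by (simp add: power_le_one)
    then show ?thesis
      unfolding norm_laguerre_kernel_square[OF L.\<kappa>, where t = t, folded \<sigma>_def] split
      using \<sigma>(1) by (simp add: field_simps)
  qed
  have k1: "1 + (\<kappa> - 1) = \<kappa>" by simp
  have bd: "\<sigma> powr (2 * (\<kappa> - 1)) * (su11 (t * \<sigma>) \<kappa> n m * su11 (t * \<sigma>) \<kappa> m n) \<le> 1"
    using su11_bound_nonneg[OF \<sigma>(1,2) _ crude, of "\<kappa> - 1" n m] assms unfolding k1 by simp
  then show "(1 / sqrt (1 + t\<^sup>2)) powr (2 * (\<kappa> - 1)) *
      (su11 (t * (1 / sqrt (1 + t\<^sup>2))) \<kappa> n m * su11 (t * (1 / sqrt (1 + t\<^sup>2))) \<kappa> m n) \<le> 1"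
    by (simp only: \<sigma>_def)
  have "(cmod (laguerre_kernel \<kappa> t n m))\<^sup>2 = \<sigma>\<^sup>2 * (\<sigma> powr (2 * (\<kappa> - 1)) * (su11 (t * \<sigma>) \<kappa> n m * su11 (t * \<sigma>) \<kappa> m n))"
    unfolding norm_laguerre_kernel_square[OF \<kappa>, where t = t, folded \<sigma>_def] using split[of "\<kappa> - 1"] by (simp add: k1)
  also have "\<dots> \<le> \<sigma>\<^sup>2 * 1" by (intro mult_left_mono bd) simp
  finally have "(cmod (laguerre_kernel \<kappa> t n m))\<^sup>2 \<le> \<sigma>\<^sup>2" by simp
  then have "cmod (laguerre_kernel \<kappa> t n m) \<le> \<sigma>" by (rule power2_le_imp_le) (use \<sigma>(1) in simp)
  also have "\<sigma> = (1 + t\<^sup>2) powr (- 1 / 2)"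
    using pos by (simp add: \<sigma>_def powr_minus_divide powr_half_sqrt)
  finally show "cmod (laguerre_kernel \<kappa> t n m) \<le> (1 + t\<^sup>2) powr (- 1 / 2)" .
qed

lemma kernel_bound_le_1:
  assumes "\<kappa> \<le> 1"
  shows "cmod (laguerre_kernel \<kappa> t n m) \<le> (1 + t\<^sup>2) powr (- \<kappa> / 2)"
\<comment> \<open>At \<kappa> = 1 the complementary parameter 1 - \<kappa> is not positive, but
  there the bound for \<kappa> \<ge> 1 has the same exponent.\<close>
proof (cases "\<kappa> = 1")
  case True
  then show ?thesis using kernel_bound_ge_1(1)[of t n m] by simp
next
  case False
  define \<sigma> where "\<sigma> = 1 / sqrt (1 + t\<^sup>2)"
  have pos: "1 + t\<^sup>2 > 0" by (simp add: add_pos_nonneg)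
  have \<sigma>: "\<sigma> > 0" "(t * \<sigma>)\<^sup>2 + \<sigma>\<^sup>2 = 1"
    using pos by (simp_all add: \<sigma>_def power_mult_distrib power_divide field_simps)
  have "su11 (t * \<sigma>) \<kappa> n m * su11 (t * \<sigma>) \<kappa> m n \<le> 1"
  proof (rule su11_bound_le_1[OF \<sigma> \<kappa>])
    fix \<alpha> :: real and n m assume \<alpha>: "\<alpha> \<ge> 0"
    interpret L: laguerre "1 + \<alpha>" by unfold_locales (use \<alpha> in simp)
    show "\<sigma> powr (2 * \<alpha>) * (su11 (t * \<sigma>) (1 + \<alpha>) n m * su11 (t * \<sigma>) (1 + \<alpha>) m n) \<le> 1"
      using L.kernel_bound_ge_1(2)[of t n m] \<alpha> by (simp add: \<sigma>_def)
  qed (use assms False in simp)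
  then have "\<sigma> powr (2 * \<kappa>) * (su11 (t * \<sigma>) \<kappa> n m * su11 (t * \<sigma>) \<kappa> m n) \<le> \<sigma> powr (2 * \<kappa>) * 1"
    by (rule mult_left_mono) simp
  then have "(cmod (laguerre_kernel \<kappa> t n m))\<^sup>2 \<le> (\<sigma> powr \<kappa>)\<^sup>2"
    unfolding norm_laguerre_kernel_square[OF \<kappa>, where t = t, folded \<sigma>_def] using powr_half_square[OF \<sigma>(1), of "2 * \<kappa>"] by simp
  then have "cmod (laguerre_kernel \<kappa> t n m) \<le> \<sigma> powr \<kappa>" by (rule power2_le_imp_le) simp
  also have "\<dots> = (1 + t\<^sup>2) powr (- \<kappa> / 2)"
    using pos by (simp add: \<sigma>_def powr_minus_divide powr_divide powr_powr flip: powr_half_sqrt)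
  finally show ?thesis .
qed

lemma norm_kernel_0_0: "cmod (laguerre_kernel \<kappa> t 0 0) = (1 + t\<^sup>2) powr (- \<kappa> / 2)"
proof -
  have pos: "1 + t\<^sup>2 > 0" by (simp add: add_pos_nonneg)
  have "(1 / sqrt (1 + t\<^sup>2)) powr (2 * \<kappa>) = (1 + t\<^sup>2) powr (- \<kappa>)"
    using pos by (simp add: powr_minus_divide powr_divide powr_powr flip: powr_half_sqrt)
  then have "(cmod (laguerre_kernel \<kappa> t 0 0))\<^sup>2 = ((1 + t\<^sup>2) powr (- \<kappa> / 2))\<^sup>2"
    unfolding norm_laguerre_kernel_square[OF \<kappa>] powr_half_square[OF pos] by (simp add: su11_0_0)
  then show ?thesis by (simp add: power2_eq_iff_nonneg)
qed

text \<open>The largest entries of the first column are those in rows \<open>n\<close> of size \<open>t\<^sup>2\<close>.\<close>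

lemma kernel_lower_bound:
  assumes "\<kappa> \<ge> 1" and t: "\<bar>t\<bar> \<ge> 1"
  shows "\<exists>n. cmod (laguerre_kernel \<kappa> t n 0) \<ge> sqrt (2 powr (- \<kappa>) * \<kappa> powr (1 - \<kappa>) * exp (- 2)) * \<bar>t\<bar> powr (- 1)"
proof -
  \<comment> \<open>The squared entry is \<open>\<sigma> powr (2 * \<kappa>) * nb_weight \<kappa> n
    * ((t * \<sigma>)\<^sup>2) ^ n\<close>. At this n the last factor is still bounded below, while
    the weight has reached the order of \<open>(t\<^sup>2) powr (\<kappa> - 1)\<close>; together
    they leave the order of \<open>1 / t\<^sup>2\<close>.\<close>
  define n where "n = nat \<lceil>t\<^sup>2\<rceil>"
  have t2: "t\<^sup>2 \<ge> 1" using t by (metis one_le_power power2_abs)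
  have n: "t\<^sup>2 \<le> real n" "real n \<le> t\<^sup>2 + 1" unfolding n_def using t2 by linarith+
  define \<sigma> where "\<sigma> = 1 / sqrt (1 + t\<^sup>2)"
  have pos: "1 + t\<^sup>2 > 0" by (simp add: add_pos_nonneg)
  have s1: "\<sigma> powr (2 * \<kappa>) = (1 + t\<^sup>2) powr (- \<kappa>)"
    using pos by (simp add: \<sigma>_def powr_minus_divide powr_divide powr_powr flip: powr_half_sqrt)
  have "su11 \<rho> \<kappa> n 0 = nb_weight \<kappa> n * \<rho> ^ n" "su11 \<rho> \<kappa> 0 n = \<rho> ^ n" for \<rho>
    by (simp_all add: su11_def mob_eq_sum_pochhammer nb_weight_def)
  then have "(cmod (laguerre_kernel \<kappa> t n 0))\<^sup>2 = (1 + t\<^sup>2) powr (- \<kappa>) * (nb_weight \<kappa> n * ((t * \<sigma>)\<^sup>2) ^ n)"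
    unfolding norm_laguerre_kernel_square[OF \<kappa>, where t = t, folded \<sigma>_def] s1
    by (simp add: power2_eq_square power_mult_distrib mult_ac)
  moreover have "2 powr (- \<kappa>) * (t\<^sup>2) powr (- \<kappa>) \<le> (1 + t\<^sup>2) powr (- \<kappa>)"
  proof -
    have "2 powr (- \<kappa>) * (t\<^sup>2) powr (- \<kappa>) = (2 * t\<^sup>2) powr (- \<kappa>)" by (simp add: powr_mult)
    also have "\<dots> \<le> (1 + t\<^sup>2) powr (- \<kappa>)"
      using t2 \<kappa> pos by (intro powr_mono2') auto
    finally show ?thesis .
  qed
  moreover have "\<kappa> powr (1 - \<kappa>) * (t\<^sup>2) powr (\<kappa> - 1) \<le> nb_weight \<kappa> n"
  proof -
    have "\<kappa> powr (1 - \<kappa>) * (t\<^sup>2) powr (\<kappa> - 1) = (t\<^sup>2 / \<kappa>) powr (\<kappa> - 1)"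
      using \<kappa> powr_minus_divide[of \<kappa> "\<kappa> - 1"] by (simp add: powr_divide)
    also have "\<dots> \<le> ((real n + \<kappa>) / \<kappa>) powr (\<kappa> - 1)"
      using assms n t2 \<kappa> by (intro powr_mono2 divide_right_mono) auto
    also have "\<dots> \<le> nb_weight \<kappa> n"
      using nb_weight_lower_bound[of "\<kappa> - 1" n] assms by simp
    finally show ?thesis .
  qed
  \<comment> \<open>From 1 + 1/t^2 \<le> exp(1/t^2), the power is at least exp(-n/t^2), and n \<le>
    t^2 + 1 \<le> 2 t^2.\<close>
  moreover have "exp (- 2) \<le> ((t * \<sigma>)\<^sup>2) ^ n"
  proof -
    have "t\<^sup>2 \<noteq> 0" using t2 by linarith
    then have "1 + 1 / t\<^sup>2 = (1 + t\<^sup>2) / t\<^sup>2" by (simp add: add_divide_distrib)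
    then have "(t * \<sigma>)\<^sup>2 = 1 / (1 + 1 / t\<^sup>2)"
      using pos by (simp add: \<sigma>_def power_mult_distrib power_divide)
    also have "\<dots> \<ge> 1 / exp (1 / t\<^sup>2)"
      using t2 by (intro divide_left_mono exp_ge_add_one_self mult_pos_pos add_pos_nonneg) auto
    finally have "(1 / exp (1 / t\<^sup>2)) ^ n \<le> ((t * \<sigma>)\<^sup>2) ^ n" by (rule power_mono) simp
    moreover have "(1 / exp (1 / t\<^sup>2)) ^ n = exp (- (real n / t\<^sup>2))"
      by (simp add: exp_minus inverse_eq_divide power_divide flip: exp_of_nat_mult)
    moreover have "real n / t\<^sup>2 \<le> 2" using n t2 by (simp add: divide_le_eq)
    then have "exp (- 2) \<le> exp (- (real n / t\<^sup>2))" by simp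
    ultimately show ?thesis by linarith
  qed
  ultimately have "(2 powr (- \<kappa>) * (t\<^sup>2) powr (- \<kappa>)) * ((\<kappa> powr (1 - \<kappa>) * (t\<^sup>2) powr (\<kappa> - 1)) * exp (- 2)) \<le>
      (cmod (laguerre_kernel \<kappa> t n 0))\<^sup>2"
    using nb_weight_pos[OF \<kappa>, of n] by (simp only:) (intro mult_mono; simp)
  moreover have "(t\<^sup>2) powr (- \<kappa>) * (t\<^sup>2) powr (\<kappa> - 1) = (\<bar>t\<bar> powr (- 1))\<^sup>2"
  proof -
    have "(t\<^sup>2) powr (- \<kappa>) * (t\<^sup>2) powr (\<kappa> - 1) = (t\<^sup>2) powr (- 1)" by (simp flip: powr_add)
    also have "\<dots> = (\<bar>t\<bar> powr (- 1))\<^sup>2" using t2 t by (simp add: powr_minus power_inverse)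
    finally show ?thesis .
  qed
  ultimately have "(2 powr (- \<kappa>) * \<kappa> powr (1 - \<kappa>) * exp (- 2)) * (\<bar>t\<bar> powr (- 1))\<^sup>2 \<le> (cmod (laguerre_kernel \<kappa> t n 0))\<^sup>2"
    by (simp add: mult_ac)
  moreover have "(sqrt (2 powr (- \<kappa>) * \<kappa> powr (1 - \<kappa>) * exp (- 2)))\<^sup>2 = 2 powr (- \<kappa>) * \<kappa> powr (1 - \<kappa>) * exp (- 2)"
    by (intro real_sqrt_pow2) simp
  ultimately have "(sqrt (2 powr (- \<kappa>) * \<kappa> powr (1 - \<kappa>) * exp (- 2)) * \<bar>t\<bar> powr (- 1))\<^sup>2 \<le> (cmod (laguerre_kernel \<kappa> t n 0))\<^sup>2"
    by (simp only: power_mult_distrib)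
  from power2_le_imp_le[OF this norm_ge_zero] show ?thesis by blast
qed

end

theorem theorem1p3:
  fixes \<alpha> :: real
  assumes "\<alpha> > -1"
  shows "(\<alpha> \<le> 0 \<longrightarrow>
            (\<forall>t::real. opnorm_1_inf (laguerre_group \<alpha> t) = ennreal ((1 + t\<^sup>2) powr (-(1 + \<alpha>) / 2)))) \<and>
         (\<alpha> \<ge> 0 \<longrightarrow>
            (\<forall>t::real. opnorm_1_inf (laguerre_group \<alpha> t) \<le> ennreal ((1 + t\<^sup>2) powr (- 1 / 2)))) \<and>
         (\<exists>c C T :: real. c > 0 \<and> C > 0 \<and>
            (\<forall>t::real. \<bar>t\<bar> \<ge> T \<longrightarrow>
               ennreal (c * \<bar>t\<bar> powr (- min 1 (1 + \<alpha>))) \<le> opnorm_1_inf (laguerre_group \<alpha> t) \<and>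
               opnorm_1_inf (laguerre_group \<alpha> t) \<le> ennreal (C * \<bar>t\<bar> powr (- min 1 (1 + \<alpha>)))))"
proof -
  interpret laguerre "1 + \<alpha>" by unfold_locales (use assms in simp)
  have group: "laguerre_group \<alpha> = group_ell2" using laguerre_group_eq by simp
  \<comment> \<open>The entry (0, 0) attains the upper bound for every t, which gives
    equality.\<close>
  have i: "opnorm_1_inf (laguerre_group \<alpha> t) = ennreal ((1 + t\<^sup>2) powr (-(1 + \<alpha>) / 2))" if "\<alpha> \<le> 0" for t
    unfolding group using opnorm_upper[OF kernel_bound_le_1] opnorm_lower[of t 0 0] that
    by (intro antisym) (simp_all only: norm_kernel_0_0 add_le_same_cancel1)
  have ii: "opnorm_1_inf (laguerre_group \<alpha> t) \<le> ennreal ((1 + t\<^sup>2) powr (- 1 / 2))" if "\<alpha> \<ge> 0" for t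
    unfolding group by (intro opnorm_upper kernel_bound_ge_1(1)) (use that in simp)
  have upper: "(1 + t\<^sup>2) powr (- a / 2) \<le> \<bar>t\<bar> powr (- a)" if "a > 0" "\<bar>t\<bar> \<ge> 1" for a t :: real
  proof -
    have "(1 + t\<^sup>2) powr (- a / 2) \<le> (t\<^sup>2) powr (- a / 2)"
      using that by (intro powr_mono2') auto
    also have "\<dots> = \<bar>t\<bar> powr (- a)"
      using that powr_powr[of "\<bar>t\<bar>" 2 "- a / 2"] by (simp add: powr_numeral)
    finally show ?thesis .
  qed
  \<comment> \<open>For |t| \<ge> 1 the quantity 1 + t^2 is at most 2 t^2, whence the
    constant.\<close>
  have lower: "2 powr (- a / 2) * \<bar>t\<bar> powr (- a) \<le> (1 + t\<^sup>2) powr (- a / 2)" if "a > 0" "\<bar>t\<bar> \<ge> 1" for a t :: real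
  proof -
    have t2: "t\<^sup>2 \<ge> 1" using that by (metis one_le_power power2_abs)
    have "2 powr (- a / 2) * \<bar>t\<bar> powr (- a) = (2 * t\<^sup>2) powr (- a / 2)"
      using that powr_powr[of "\<bar>t\<bar>" 2 "- a / 2"] by (simp add: powr_numeral powr_mult)
    also have "\<dots> \<le> (1 + t\<^sup>2) powr (- a / 2)"
      using that t2 by (intro powr_mono2' add_pos_nonneg) auto
    finally show ?thesis .
  qed
  have iii: "\<exists>c C T :: real. c > 0 \<and> C > 0 \<and>
            (\<forall>t::real. \<bar>t\<bar> \<ge> T \<longrightarrow>
               ennreal (c * \<bar>t\<bar> powr (- min 1 (1 + \<alpha>))) \<le> opnorm_1_inf (laguerre_group \<alpha> t) \<and>
               opnorm_1_inf (laguerre_group \<alpha> t) \<le> ennreal (C * \<bar>t\<bar> powr (- min 1 (1 + \<alpha>))))"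
  proof (cases "\<alpha> \<le> 0")
    case True
    then have m: "min 1 (1 + \<alpha>) = 1 + \<alpha>" by simp
    show ?thesis
      unfolding m i[OF True]
      by (rule exI[of _ "2 powr (- (1 + \<alpha>) / 2)"], rule exI[of _ 1], rule exI[of _ 1])
        (use lower[of "1 + \<alpha>"] upper[of "1 + \<alpha>"] assms in \<open>auto intro!: ennreal_leI\<close>)
  next
    case False
    then have m: "min 1 (1 + \<alpha>) = 1" and \<alpha>: "\<alpha> \<ge> 0" "1 + \<alpha> \<ge> 1" by auto
    define c where "c = sqrt (2 powr (- (1 + \<alpha>)) * (1 + \<alpha>) powr (1 - (1 + \<alpha>)) * exp (- 2))"
    have c: "c > 0" using \<alpha> by (simp add: c_def)
    have "ennreal (c * \<bar>t\<bar> powr (- 1)) \<le> opnorm_1_inf (laguerre_group \<alpha> t)" if t: "\<bar>t\<bar> \<ge> 1" for t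
    proof -
      obtain n where "c * \<bar>t\<bar> powr (- 1) \<le> cmod (laguerre_kernel (1 + \<alpha>) t n 0)"
        using kernel_lower_bound[OF \<alpha>(2) t] by (auto simp: c_def)
      then show ?thesis unfolding group by (intro order_trans[OF ennreal_leI opnorm_lower])
    qed
    moreover have "opnorm_1_inf (laguerre_group \<alpha> t) \<le> ennreal (1 * \<bar>t\<bar> powr (- 1))" if "\<bar>t\<bar> \<ge> 1" for t
      using upper[of 1 t] that by (intro order_trans[OF ii[OF \<alpha>(1)] ennreal_leI]) simp
    ultimately show ?thesis
      unfolding m using c by (intro exI[of _ c] exI[of _ 1]) auto
  qed
  show ?thesis using i ii iii by blast
qed

end
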